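(* Let $x=P(x)$ be a max-minPPS in simple normal form with greatest fixed point $g^*<\mathbf{1}$ and variable set $X$. The procedure described in the context always terminates and outputs precisely the set $\{x_i\in X: g^*_i=0\}$, in time polynomial in $|P|$. Furthermore, one can compute in polynomial time a deterministic policy $\sigma$ for the max player such that $(g^*_{\sigma,*})_i>0$ for all variables $x_i$ with $g^*_i>0$.
   Context: A max-minPPS in SNF is a system $x_i=P_i(x)$ where each $P_i$ has form L ($a_{i,0}+\sum_ja_{i,j}x_j$, rational $a_{i,j}\ge0$, $\sum_{j\ge0}a_{i,j}\le1$), Q ($x_jx_k$), M$_{\max}$ ($\max\{x_j,x_k\}$) or M$_{\min}$ ($\min\{x_j,x_k\}$); $|P|$ is its bit size, $g^*$ its greatest fixed point in $[0,1]^n$. A deterministic policy $\sigma$ for the max player picks one of the two variables at each M$_{\max}$ variable; $g^*_{\sigma,*}$ is the GFP of the resulting min-system $x=P_{\sigma,*}(x)$. The procedure: (1) $S:=\{x_i\in X: P_i(\mathbf{0})>0\}$. (2) Repeat until neither applies: (a) if $x_i$ has form L or M$_{\max}$ and $P_i$ contains a variable in $S$, add $x_i$ to $S$; (b) if $x_i$ has form Q or M$_{\min}$ and both variables of $P_i$ are in $S$, add $x_i$ to $S$. (3) $F:=\{x_i\in X\setminus S: P_i(\mathbf{1})<1$ or $P_i$ has form Q$\}$. (4) Repeat until no more variables can be added: (a) if $x_i\in X\setminus S$ has form L or M$_{\min}$ and $P_i$ contains a term whose variable is in $F$, add $x_i$ to $F$; (b) if $x_i\in X\setminus S$ has form M$_{\max}$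 and both variables of $P_i$ are in $F$, add $x_i$ to $F$. (5) If $X=S\cup F$, terminate and output $F$. (6) Otherwise set $S:=X\setminus F$ and return to step (2). *)

theory Defs
  imports
    "HOL-Library.FuncSet"
    "HOL-Library.Log_Nat"
    "HOL-Computational_Algebra.Polynomial"
begin

section \<open>Max-min probabilistic polynomial systems in simple normal form\<close>

text \<open>
  The variables of a system \<open>P\<close> are the indices below \<open>length P\<close>, and \<open>P ! i\<close> is the right-hand
  side of the equation for variable \<open>i\<close>.  In \<open>FormL a\<^sub>0 as\<close> the coefficient of variable \<open>j\<close> is \<open>as ! j\<close>.
\<close>

datatype snf =
    FormL rat "rat list"
  | FormQ nat nat
  | FormMax nat nat
  | FormMin nat nat

type_synonym pps = "snf list"

abbreviation vars :: "pps \<Rightarrow> nat set" where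
  "vars P \<equiv> {..<length P}"

fun snf_ok :: "nat \<Rightarrow> snf \<Rightarrow> bool" where
  "snf_ok n (FormL a0 as) \<longleftrightarrow>
     length as = n \<and> a0 \<ge> 0 \<and> (\<forall>a\<in>set as. a \<ge> 0) \<and> a0 + sum_list as \<le> 1"
| "snf_ok n (FormQ j k) \<longleftrightarrow> j < n \<and> k < n"
| "snf_ok n (FormMax j k) \<longleftrightarrow> j < n \<and> k < n"
| "snf_ok n (FormMin j k) \<longleftrightarrow> j < n \<and> k < n"

definition max_min_pps :: "pps \<Rightarrow> bool" where
  "max_min_pps P \<longleftrightarrow> (\<forall>e\<in>set P. snf_ok (length P) e)"

fun eval :: "snf \<Rightarrow> (nat \<Rightarrow> real) \<Rightarrow> real" where
  "eval (FormL a0 as) x = of_rat a0 + (\<Sum>j<length as. of_rat (as ! j) * x j)"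
| "eval (FormQ j k) x = x j * x k"
| "eval (FormMax j k) x = max (x j) (x k)"
| "eval (FormMin j k) x = min (x j) (x k)"

definition pps_map :: "pps \<Rightarrow> (nat \<Rightarrow> real) \<Rightarrow> (nat \<Rightarrow> real)" where
  "pps_map P x = (\<lambda>i\<in>vars P. eval (P ! i) x)"

definition unit_box :: "nat \<Rightarrow> (nat \<Rightarrow> real) set" where
  "unit_box n = {..<n} \<rightarrow>\<^sub>E {0..1}"

text \<open>
  Elements of \<open>unit_box n\<close> agree outside \<open>{..<n}\<close>, so the pointwise order of functions is
  the coordinatewise order of vectors there.
\<close>

definition pps_gfp :: "pps \<Rightarrow> (nat \<Rightarrow> real)" where
  "pps_gfp P = (GREATEST x. x \<in> unit_box (length P) \<and> pps_map P x = x)"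

lemma eval_mono:
  assumes "snf_ok n e" and "\<And>i. i < n \<Longrightarrow> 0 \<le> x i \<and> x i \<le> y i"
  shows "eval e x \<le> eval e y"
proof (cases e)
  case (FormL a0 as)
  have "of_rat (as ! j) * x j \<le> of_rat (as ! j) * y j" if "j < length as" for j
    using assms FormL that by (intro mult_left_mono) auto
  then show ?thesis using FormL by (auto intro!: sum_mono)
next
  case (FormQ j k)
  with assms show ?thesis by (auto intro!: mult_mono dest: order_trans)
next
  case (FormMax j k)
  with assms show ?thesis by (auto simp: max.coboundedI1 max.coboundedI2)
next
  case (FormMin j k)
  with assms show ?thesis by (auto simp: min.coboundedI1 min.coboundedI2)
qed

lemma eval_unit:
  assumes "snf_ok n e" and "\<And>i. i < n \<Longrightarrow> 0 \<le> x i \<and> x i \<le> 1"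
  shows "eval e x \<in> {0..1}"
proof (cases e)
  case (FormL a0 as)
  have "of_rat (as ! j) * x j \<ge> 0" if "j < length as" for j
    using assms FormL that by (intro mult_nonneg_nonneg) auto
  then have "eval e x \<ge> 0"
    using assms FormL by (auto intro!: sum_nonneg add_nonneg_nonneg)
  moreover have "eval e x \<le> eval e (\<lambda>_. 1)"
    using assms by (rule eval_mono)
  moreover have "eval e (\<lambda>_. 1) = of_rat (a0 + sum_list as)"
    by (simp add: FormL of_rat_add of_rat_sum sum_list_sum_nth atLeast0LessThan)
  moreover have "of_rat (a0 + sum_list as) \<le> (1::real)"
    using assms FormL by simp
  ultimately show ?thesis unfolding atLeastAtMost_iff by linarith
next
  case (FormQ j k)
  with assms show ?thesis by (auto intro!: mult_le_one)
next
  case (FormMax j k)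
  with assms show ?thesis by (auto simp: max_def)
next
  case (FormMin j k)
  with assms show ?thesis by (auto simp: min_def)
qed

lemma pps_gfp_greatest:
  assumes "max_min_pps P"
  shows "pps_gfp P \<in> unit_box (length P)"
    and "pps_map P (pps_gfp P) = pps_gfp P"
    and "\<And>y. y \<in> unit_box (length P) \<Longrightarrow> pps_map P y = y \<Longrightarrow> y \<le> pps_gfp P"
proof -
  let ?n = "length P"
  define A where "A = {y \<in> unit_box ?n. y \<le> pps_map P y}"
  define g where "g = (\<lambda>i\<in>{..<?n}. Sup ((\<lambda>y. y i) ` A))"
  have ok: "snf_ok ?n (P ! i)" if "i < ?n" for i
    using assms that by (simp add: max_min_pps_def)
  have boxD: "0 \<le> y i \<and> y i \<le> 1" if "y \<in> unit_box ?n" "i < ?n" for y i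
    using that by (auto simp: unit_box_def PiE_def Pi_def)
  have map_box: "pps_map P y \<in> unit_box ?n" if "y \<in> unit_box ?n" for y
    using eval_unit[OF ok boxD[OF that]] by (auto simp: unit_box_def pps_map_def)
  have map_mono: "pps_map P x \<le> pps_map P y"
    if "x \<in> unit_box ?n" "y \<in> unit_box ?n" "x \<le> y" for x y
    using that boxD ok by (auto simp: le_fun_def pps_map_def intro!: eval_mono)
  have zero: "(\<lambda>i\<in>{..<?n}. 0) \<in> A"
  proof -
    have z: "(\<lambda>i\<in>{..<?n}. 0::real) \<in> unit_box ?n" by (auto simp: unit_box_def)
    from map_box[OF z] boxD have "0 \<le> pps_map P (\<lambda>i\<in>{..<?n}. 0) i" if "i < ?n" for i
      using that by blast
    then show ?thesis using z by (auto simp: A_def le_fun_def pps_map_def)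
  qed
  have bdd: "bdd_above ((\<lambda>y. y i) ` A)" if "i < ?n" for i
    using boxD that by (auto simp: A_def intro!: bdd_aboveI[of _ 1])
  have upper: "y \<le> g" if "y \<in> A" for y
  proof (rule le_funI)
    fix i show "y i \<le> g i"
    proof (cases "i < ?n")
      case True
      then show ?thesis using that bdd by (auto simp: g_def intro!: cSup_upper)
    next
      case False
      then show ?thesis using that by (auto simp: g_def A_def unit_box_def PiE_def extensional_def)
    qed
  qed
  have g_box: "g \<in> unit_box ?n"
  proof -
    have "g i \<in> {0..1}" if "i < ?n" for i
    proof -
      have "0 \<le> g i" using le_funD[OF upper[OF zero], of i] that by simp
      moreover have "g i \<le> 1"
        using zero boxD that by (auto simp: g_def A_def intro!: cSup_least)
      ultimately show ?thesis by simp
    qed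
    then show ?thesis by (auto simp: unit_box_def g_def)
  qed
  have g_post: "g \<le> pps_map P g"
  proof (rule le_funI)
    fix i show "g i \<le> pps_map P g i"
    proof (cases "i < ?n")
      case True
      have "y i \<le> pps_map P g i" if "y \<in> A" for y
        using that map_mono[OF _ g_box upper[OF that]] by (auto simp: A_def le_fun_def intro: order_trans)
      then have "Sup ((\<lambda>y. y i) ` A) \<le> pps_map P g i"
        using zero by (intro cSup_least) auto
      then show ?thesis using True by (simp add: g_def)
    next
      case False
      then show ?thesis by (simp add: g_def pps_map_def)
    qed
  qed
  have "pps_map P g \<in> A"
    using map_box[OF g_box] map_mono[OF g_box map_box[OF g_box] g_post] by (simp add: A_def)
  then have fp: "pps_map P g = g" using upper g_post by (simp add: antisym)
  have max: "y \<le> g" if "y \<in> unit_box ?n" "pps_map P y = y" for y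
    using that upper by (simp add: A_def)
  have "pps_gfp P = g"
    unfolding pps_gfp_def using g_box fp max by (intro Greatest_equality) auto
  then show "pps_gfp P \<in> unit_box ?n" "pps_map P (pps_gfp P) = pps_gfp P"
    "\<And>y. y \<in> unit_box ?n \<Longrightarrow> pps_map P y = y \<Longrightarrow> y \<le> pps_gfp P"
    using g_box fp max by auto
qed

section \<open>Deterministic policies for the max player\<close>

text \<open>The values of a policy at variables not of form \<open>FormMax\<close> are irrelevant.\<close>

definition max_policy :: "pps \<Rightarrow> (nat \<Rightarrow> nat) \<Rightarrow> bool" where
  "max_policy P \<sigma> \<longleftrightarrow> (\<forall>i\<in>vars P. \<forall>j k. P ! i = FormMax j k \<longrightarrow> \<sigma> i \<in> {j, k})"

definition var_form :: "nat \<Rightarrow> nat \<Rightarrow> snf" where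
  "var_form n j = FormL 0 (map (\<lambda>k. if k = j then 1 else 0) [0..<n])"

definition apply_policy :: "pps \<Rightarrow> (nat \<Rightarrow> nat) \<Rightarrow> pps" where
  "apply_policy P \<sigma> =
     map (\<lambda>i. case P ! i of FormMax j k \<Rightarrow> var_form (length P) (\<sigma> i) | e \<Rightarrow> e) [0..<length P]"

section \<open>The procedure\<close>

fun form_vars :: "snf \<Rightarrow> nat set" where
  "form_vars (FormL a0 as) = {j. j < length as \<and> as ! j \<noteq> 0}"
| "form_vars (FormQ j k) = {j, k}"
| "form_vars (FormMax j k) = {j, k}"
| "form_vars (FormMin j k) = {j, k}"

fun S_rule :: "snf \<Rightarrow> nat set \<Rightarrow> bool" where
  "S_rule (FormL a0 as) S \<longleftrightarrow> form_vars (FormL a0 as) \<inter> S \<noteq> {}"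
| "S_rule (FormMax j k) S \<longleftrightarrow> form_vars (FormMax j k) \<inter> S \<noteq> {}"
| "S_rule (FormQ j k) S \<longleftrightarrow> form_vars (FormQ j k) \<subseteq> S"
| "S_rule (FormMin j k) S \<longleftrightarrow> form_vars (FormMin j k) \<subseteq> S"

fun F_rule :: "snf \<Rightarrow> nat set \<Rightarrow> bool" where
  "F_rule (FormL a0 as) F \<longleftrightarrow> form_vars (FormL a0 as) \<inter> F \<noteq> {}"
| "F_rule (FormMin j k) F \<longleftrightarrow> form_vars (FormMin j k) \<inter> F \<noteq> {}"
| "F_rule (FormMax j k) F \<longleftrightarrow> form_vars (FormMax j k) \<subseteq> F"
| "F_rule (FormQ j k) F \<longleftrightarrow> False"

fun is_FormQ :: "snf \<Rightarrow> bool" where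
  "is_FormQ (FormQ j k) \<longleftrightarrow> True"
| "is_FormQ _ \<longleftrightarrow> False"

definition S_candidates :: "pps \<Rightarrow> nat set \<Rightarrow> nat set" where
  "S_candidates P S = {i \<in> vars P - S. S_rule (P ! i) S}"

definition F_candidates :: "pps \<Rightarrow> nat set \<Rightarrow> nat set \<Rightarrow> nat set" where
  "F_candidates P S F = {i \<in> vars P - S - F. F_rule (P ! i) F}"

datatype control = Step1 | Step2 | Step3 | Step4 | Step5 | Step6 | Halted

type_synonym config = "control \<times> nat set \<times> nat set"

text \<open>
  A configuration holds the step to be executed next and the current sets \<open>S\<close> and \<open>F\<close>.  The order
  in which variables are added in the two loops is left open, hence the nondeterminism.
\<close>

inductive proc_step :: "pps \<Rightarrow> config \<Rightarrow> config \<Rightarrow> bool" for P where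
  step1: "proc_step P (Step1, S, F) (Step2, {i \<in> vars P. eval (P ! i) (\<lambda>_. 0) > 0}, F)"
| step2_add: "i \<in> S_candidates P S \<Longrightarrow> proc_step P (Step2, S, F) (Step2, insert i S, F)"
| step2_exit: "S_candidates P S = {} \<Longrightarrow> proc_step P (Step2, S, F) (Step3, S, F)"
| step3: "proc_step P (Step3, S, F)
     (Step4, S, {i \<in> vars P - S. eval (P ! i) (\<lambda>_. 1) < 1 \<or> is_FormQ (P ! i)})"
| step4_add: "i \<in> F_candidates P S F \<Longrightarrow> proc_step P (Step4, S, F) (Step4, S, insert i F)"
| step4_exit: "F_candidates P S F = {} \<Longrightarrow> proc_step P (Step4, S, F) (Step5, S, F)"
| step5_halt: "vars P = S \<union> F \<Longrightarrow> proc_step P (Step5, S, F) (Halted, S, F)"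
| step5_continue: "vars P \<noteq> S \<union> F \<Longrightarrow> proc_step P (Step5, S, F) (Step6, S, F)"
| step6: "proc_step P (Step6, S, F) (Step2, vars P - F, F)"

definition proc_start :: config where
  "proc_start = (Step1, {}, {})"

text \<open>\<open>proc_run P cs F\<close>: the list \<open>cs\<close> is a complete execution of the procedure, with output \<open>F\<close>.\<close>

definition proc_run :: "pps \<Rightarrow> config list \<Rightarrow> nat set \<Rightarrow> bool" where
  "proc_run P cs F \<longleftrightarrow> cs \<noteq> [] \<and> hd cs = proc_start \<and> successively (proc_step P) cs \<and>
     (\<exists>S. last cs = (Halted, S, F))"

section \<open>Random access machines with logarithmic cost\<close>

text \<open>
  Polynomial time is measured on structured random access machine programs under the logarithmic
  cost criterion: an access or arithmetic operation is charged the binary lengths of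
  the addresses and numbers involved.  Up to a polynomial this is Turing machine time.
  The memory maps addresses to natural numbers; \<open>Sub\<close> is truncated subtraction and tests are
  tests for being nonzero.
\<close>

type_synonym mem = "nat \<Rightarrow> nat"

datatype aexp =
    Const nat
  | Mem aexp
  | Add aexp aexp
  | Sub aexp aexp
  | Mul aexp aexp
  | Div aexp aexp

datatype com =
    Skip
  | Store aexp aexp
  | Seq com com
  | If_nz aexp com com
  | While_nz aexp com

definition bits :: "nat \<Rightarrow> nat" where
  "bits k = max 1 (floorlog 2 k)"

fun aval :: "aexp \<Rightarrow> mem \<Rightarrow> nat" where
  "aval (Const k) s = k"
| "aval (Mem a) s = s (aval a s)"
| "aval (Add a b) s = aval a s + aval b s"
| "aval (Sub a b) s = aval a s - aval b s"
| "aval (Mul a b) s = aval a s * aval b s"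
| "aval (Div a b) s = aval a s div aval b s"

fun acost :: "aexp \<Rightarrow> mem \<Rightarrow> nat" where
  "acost (Const k) s = bits k"
| "acost (Mem a) s = acost a s + bits (aval a s) + bits (s (aval a s))"
| "acost (Add a b) s = acost a s + acost b s + bits (aval a s) + bits (aval b s)"
| "acost (Sub a b) s = acost a s + acost b s + bits (aval a s) + bits (aval b s)"
| "acost (Mul a b) s = acost a s + acost b s + bits (aval a s) + bits (aval b s)"
| "acost (Div a b) s = acost a s + acost b s + bits (aval a s) + bits (aval b s)"

text \<open>\<open>exec c s t s'\<close>: started in memory \<open>s\<close>, the program \<open>c\<close> halts in memory \<open>s'\<close> at cost \<open>t\<close>.\<close>

inductive exec :: "com \<Rightarrow> mem \<Rightarrow> nat \<Rightarrow> mem \<Rightarrow> bool" where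
  Skip: "exec Skip s 1 s"
| Store: "exec (Store a b) s
     (acost a s + acost b s + bits (aval a s) + bits (aval b s)) (s(aval a s := aval b s))"
| Seq: "exec c1 s t1 s1 \<Longrightarrow> exec c2 s1 t2 s2 \<Longrightarrow> exec (Seq c1 c2) s (t1 + t2) s2"
| If_true: "aval a s \<noteq> 0 \<Longrightarrow> exec c1 s t s' \<Longrightarrow>
     exec (If_nz a c1 c2) s (acost a s + bits (aval a s) + t) s'"
| If_false: "aval a s = 0 \<Longrightarrow> exec c2 s t s' \<Longrightarrow>
     exec (If_nz a c1 c2) s (acost a s + bits (aval a s) + t) s'"
| While_true: "aval a s \<noteq> 0 \<Longrightarrow> exec c s t1 s1 \<Longrightarrow> exec (While_nz a c) s1 t2 s2 \<Longrightarrow>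
     exec (While_nz a c) s (acost a s + bits (aval a s) + t1 + t2) s2"
| While_false: "aval a s = 0 \<Longrightarrow> exec (While_nz a c) s (acost a s + bits (aval a s)) s"

text \<open>A list of numbers is stored from address 1 on, its length at address 0.\<close>

definition load :: "nat list \<Rightarrow> mem" where
  "load xs = (\<lambda>i. if i = 0 then length xs else if i \<le> length xs then xs ! (i - 1) else 0)"

definition holds_list :: "mem \<Rightarrow> nat list \<Rightarrow> bool" where
  "holds_list s ys \<longleftrightarrow> s 0 = length ys \<and> (\<forall>i<length ys. s (Suc i) = ys ! i)"

text \<open>
  The size of the output is charged too: otherwise storing one large number at address 0 would
  produce an exponentially long output of zeros.
\<close>

definition computes_within :: "com \<Rightarrow> nat list \<Rightarrow> nat list \<Rightarrow> nat \<Rightarrow> bool" where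
  "computes_within c xs ys T \<longleftrightarrow>
     (\<exists>t s. exec c (load xs) t s \<and> holds_list s ys \<and> t + sum_list (map bits ys) \<le> T)"

section \<open>Encodings\<close>

definition enc_rat :: "rat \<Rightarrow> nat list" where
  "enc_rat r = [nat (fst (quotient_of r)), nat (snd (quotient_of r))]"

fun enc_snf :: "snf \<Rightarrow> nat list" where
  "enc_snf (FormL a0 as) = 0 # enc_rat a0 @ concat (map enc_rat as)"
| "enc_snf (FormQ j k) = [1, j, k]"
| "enc_snf (FormMax j k) = [2, j, k]"
| "enc_snf (FormMin j k) = [3, j, k]"

definition enc_pps :: "pps \<Rightarrow> nat list" where
  "enc_pps P = length P # concat (map enc_snf P)"

definition pps_size :: "pps \<Rightarrow> nat" where
  "pps_size P = sum_list (map bits (enc_pps P))"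

definition enc_set :: "nat \<Rightarrow> nat set \<Rightarrow> nat list" where
  "enc_set n A = map (\<lambda>i. if i \<in> A then 1 else 0) [0..<n]"

fun enc_control :: "control \<Rightarrow> nat" where
  "enc_control Step1 = 1"
| "enc_control Step2 = 2"
| "enc_control Step3 = 3"
| "enc_control Step4 = 4"
| "enc_control Step5 = 5"
| "enc_control Step6 = 6"
| "enc_control Halted = 7"

fun enc_config :: "nat \<Rightarrow> config \<Rightarrow> nat list" where
  "enc_config n (pc, S, F) = enc_control pc # enc_set n S @ enc_set n F"

definition enc_run :: "nat \<Rightarrow> config list \<Rightarrow> nat list" where
  "enc_run n cs = concat (map (enc_config n) cs)"

definition enc_policy :: "nat \<Rightarrow> (nat \<Rightarrow> nat) \<Rightarrow> nat list" where
  "enc_policy n \<sigma> = map \<sigma> [0..<n]"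

end

theory Submission
  imports Defs
begin

text \<open>
  Every variable put into \<open>S\<close> has a positive value, and the additions to \<open>S\<close> record a choice at each
  maximum that witnesses this: in step 2 a variable already in \<open>S\<close>, in step 6 a variable outside \<open>F\<close>.
  The invariant is that every policy following the choices recorded on \<open>S\<close> is positive on \<open>S\<close>.
  On termination, on the complement \<open>F\<close> of \<open>S\<close> the minimising player can always force a positive
  chance of reaching an equation whose value lies strictly below the largest value on \<open>F\<close>, unless
  the latter is 0, because all values are below 1; hence it is 0.

  For the running time, a random access machine program simulates the procedure step by step.  Each
  step decreases a quadratically bounded potential and is carried out by loops over the
  variables, so only the lengths of the numbers computed need control.  They are handled by a unit
  cost that bounds both the number of operations and the growth of the lengths.
\<close>

section \<open>Correctness of the procedure\<close>

lemma max_min_ppsD: "max_min_pps P \<Longrightarrow> i < length P \<Longrightarrow> snf_ok (length P) (P ! i)"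
  by (simp add: max_min_pps_def)

lemma unit_boxD: "x \<in> unit_box n \<Longrightarrow> i < n \<Longrightarrow> 0 \<le> x i \<and> x i \<le> 1"
  by (auto simp: unit_box_def PiE_def Pi_def)

lemma pps_map_unit_box:
  assumes "max_min_pps P" "y \<in> unit_box (length P)"
  shows "pps_map P y \<in> unit_box (length P)"
  using eval_unit[OF max_min_ppsD[OF assms(1)] unit_boxD[OF assms(2)]]
  by (auto simp: unit_box_def pps_map_def)

lemma pps_map_mono:
  assumes "max_min_pps P" "x \<in> unit_box (length P)" "x \<le> y"
  shows "pps_map P x \<le> pps_map P y"
  using assms(3) unit_boxD[OF assms(2)] max_min_ppsD[OF assms(1)]
  by (auto simp: le_fun_def pps_map_def intro!: eval_mono[where n = "length P"])

lemma pps_gfp_upper: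
  assumes P: "max_min_pps P" and y: "y \<in> unit_box (length P)" and le: "y \<le> pps_map P y"
  shows "y \<le> pps_gfp P"
proof -
  let ?n = "length P"
  define A where "A = {z \<in> unit_box ?n. z \<le> pps_map P z}"
  define h where "h = (\<lambda>i\<in>{..<?n}. Sup ((\<lambda>z. z i) ` A))"
  have yA: "y \<in> A" using y le by (simp add: A_def)
  have bdd: "bdd_above ((\<lambda>z. z i) ` A)" if "i < ?n" for i
    using unit_boxD that by (auto simp: A_def intro!: bdd_aboveI[of _ 1])
  have upper: "z \<le> h" if "z \<in> A" for z
  proof (rule le_funI)
    fix i show "z i \<le> h i"
      using that bdd[of i]
      by (cases "i < ?n")
        (auto simp: h_def A_def unit_box_def PiE_def extensional_def intro!: cSup_upper)
  qed
  have h_box: "h \<in> unit_box ?n"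
  proof -
    have "h i \<in> {0..1}" if "i < ?n" for i
    proof -
      have "0 \<le> h i" using le_funD[OF upper[OF yA], of i] unit_boxD[OF y that] by simp
      moreover have "h i \<le> 1"
        using yA unit_boxD that by (auto simp: h_def A_def intro!: cSup_least)
      ultimately show ?thesis by simp
    qed
    then show ?thesis by (auto simp: unit_box_def h_def)
  qed
  have h_post: "h \<le> pps_map P h"
  proof (rule le_funI)
    fix i show "h i \<le> pps_map P h i"
    proof (cases "i < ?n")
      case True
      have "z i \<le> pps_map P h i" if "z \<in> A" for z
        using that pps_map_mono[OF P _ upper[OF that]]
        by (auto simp: A_def le_fun_def intro: order_trans)
      then have "Sup ((\<lambda>z. z i) ` A) \<le> pps_map P h i"
        using yA by (intro cSup_least) auto
      then show ?thesis using True by (simp add: h_def)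
    qed (simp add: h_def pps_map_def)
  qed
  have "pps_map P h \<in> A"
    using pps_map_unit_box[OF P h_box] pps_map_mono[OF P h_box h_post] by (simp add: A_def)
  then have "pps_map P h = h" using upper h_post by (simp add: antisym)
  then show ?thesis
    using pps_gfp_greatest(3)[OF P h_box] upper[OF yA] by (blast intro: order_trans)
qed

lemma pps_gfp_unit:
  assumes "max_min_pps P" "i < length P"
  shows "0 \<le> pps_gfp P i" "pps_gfp P i \<le> 1"
  using unit_boxD[OF pps_gfp_greatest(1)[OF assms(1)] assms(2)] by auto

lemma pps_gfp_eval:
  assumes "max_min_pps P" "i < length P"
  shows "pps_gfp P i = eval (P ! i) (pps_gfp P)"
proof -
  have "pps_gfp P i = pps_map P (pps_gfp P) i"
    using pps_gfp_greatest(2)[OF assms(1)] by simp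
  then show ?thesis using assms(2) by (simp add: pps_map_def)
qed

lemma length_apply_policy [simp]: "length (apply_policy P \<tau>) = length P"
  by (simp add: apply_policy_def)

lemma eval_var_form: "j < n \<Longrightarrow> eval (var_form n j) x = x j"
proof -
  assume j: "j < n"
  have "eval (var_form n j) x = (\<Sum>i<n. real_of_rat (if i = j then 1 else 0) * x i)"
    by (simp add: var_form_def)
  also have "\<dots> = (\<Sum>i<n. if i = j then x j else 0)"
    by (rule sum.cong) auto
  also have "\<dots> = x j" using j by simp
  finally show ?thesis .
qed

lemma snf_ok_var_form: "j < n \<Longrightarrow> snf_ok n (var_form n j)"
proof -
  assume j: "j < n"
  have "sum_list (map (\<lambda>k. if k = j then 1 else 0 :: rat) [0..<n]) = (\<Sum>i<n. if i = j then 1 else 0)"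
    by (simp add: interv_sum_list_conv_sum_set_nat atLeast0LessThan)
  also have "\<dots> = 1" using j by simp
  finally show ?thesis by (auto simp: var_form_def)
qed

lemma apply_policy_nth:
  "i < length P \<Longrightarrow> apply_policy P \<tau> ! i =
     (case P ! i of FormMax j k \<Rightarrow> var_form (length P) (\<tau> i) | e \<Rightarrow> e)"
  by (simp add: apply_policy_def split: snf.split)

lemma max_policy_less:
  assumes "max_min_pps P" "max_policy P \<tau>" "i < length P" "P ! i = FormMax j k"
  shows "\<tau> i < length P" "\<tau> i \<in> {j, k}"
  using assms(2-) max_min_ppsD[OF assms(1,3)] by (auto simp: max_policy_def)

lemma max_min_pps_apply_policy:
  assumes "max_min_pps P" "max_policy P \<tau>"
  shows "max_min_pps (apply_policy P \<tau>)"
proof -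
  have "snf_ok (length P) (apply_policy P \<tau> ! i)" if "i < length P" for i
    using max_min_ppsD[OF assms(1) that] max_policy_less[OF assms that]
    by (auto simp: apply_policy_nth that snf_ok_var_form split: snf.split)
  then show ?thesis
    by (auto simp: max_min_pps_def in_set_conv_nth)
qed

lemma eval_apply_policy:
  assumes "max_min_pps P" "max_policy P \<tau>" "i < length P"
  shows "eval (apply_policy P \<tau> ! i) x =
    (case P ! i of FormMax j k \<Rightarrow> x (\<tau> i) | e \<Rightarrow> eval e x)"
  using max_policy_less[OF assms]
  by (auto simp: apply_policy_nth assms(3) eval_var_form split: snf.split)

lemma pps_gfp_apply_policy_le:
  assumes P: "max_min_pps P" and \<tau>: "max_policy P \<tau>"
  shows "pps_gfp (apply_policy P \<tau>) \<le> pps_gfp P"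
proof (rule pps_gfp_upper[OF P])
  note P' = max_min_pps_apply_policy[OF P \<tau>]
  let ?g = "pps_gfp (apply_policy P \<tau>)"
  show box: "?g \<in> unit_box (length P)" using pps_gfp_greatest(1)[OF P'] by simp
  show "?g \<le> pps_map P ?g"
  proof (rule le_funI)
    fix i
    show "?g i \<le> pps_map P ?g i"
    proof (cases "i < length P")
      case True
      have "?g i = eval (apply_policy P \<tau> ! i) ?g" using pps_gfp_eval[OF P'] True by simp
      also have "\<dots> \<le> eval (P ! i) ?g"
      proof (cases "P ! i")
        case (FormMax j k)
        then show ?thesis
          using max_policy_less(2)[OF P \<tau> True FormMax] by (auto simp: eval_apply_policy[OF P \<tau> True])
      qed (auto simp: eval_apply_policy[OF P \<tau> True])
      finally show ?thesis using True by (simp add: pps_map_def)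
    next
      case False
      then show ?thesis using box by (simp add: pps_map_def unit_box_def PiE_def extensional_def)
    qed
  qed
qed

definition init_S :: "pps \<Rightarrow> nat set" where
  "init_S P = {i \<in> vars P. eval (P ! i) (\<lambda>_. 0) > 0}"

definition init_F :: "pps \<Rightarrow> nat set \<Rightarrow> nat set" where
  "init_F P S = {i \<in> vars P - S. eval (P ! i) (\<lambda>_. 1) < 1 \<or> is_FormQ (P ! i)}"

definition policy_positive :: "pps \<Rightarrow> nat set \<Rightarrow> (nat \<Rightarrow> nat) \<Rightarrow> bool" where
  "policy_positive P S \<sigma> \<longleftrightarrow> (\<forall>\<tau>. max_policy P \<tau> \<longrightarrow> (\<forall>i\<in>S. \<tau> i = \<sigma> i) \<longrightarrow>
     (\<forall>i\<in>S. 0 < pps_gfp (apply_policy P \<tau>) i))"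

lemma policy_positive_empty: "policy_positive P {} \<sigma>"
  by (simp add: policy_positive_def)

lemma policy_positive_init_S:
  assumes P: "max_min_pps P"
  shows "policy_positive P (init_S P) \<sigma>"
  unfolding policy_positive_def
proof (intro allI impI ballI)
  fix \<tau> i assume \<tau>: "max_policy P \<tau>" and i: "i \<in> init_S P"
  let ?g = "pps_gfp (apply_policy P \<tau>)"
  note P' = max_min_pps_apply_policy[OF P \<tau>]
  have il: "i < length P" and pos: "eval (P ! i) (\<lambda>_. 0) > 0" using i by (auto simp: init_S_def)
  have "0 < eval (apply_policy P \<tau> ! i) (\<lambda>_. 0)"
    using pos by (cases "P ! i") (auto simp: eval_apply_policy[OF P \<tau> il])
  also have "\<dots> \<le> eval (apply_policy P \<tau> ! i) ?g"
    using pps_gfp_unit[OF P'] max_min_ppsD[OF P', of i] il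
    by (intro eval_mono[of "length P"]) auto
  also have "\<dots> = ?g i" using pps_gfp_eval[OF P'] il by simp
  finally show "0 < ?g i" .
qed

lemma eval_FormL_pos:
  assumes ok: "snf_ok n (FormL a0 as)" and x: "\<And>i. i < n \<Longrightarrow> 0 \<le> x i"
    and j: "j \<in> form_vars (FormL a0 as)" "0 < x j"
  shows "0 < eval (FormL a0 as) x"
proof -
  have nn: "0 \<le> real_of_rat (as ! l) * x l" if "l < length as" for l
    using ok x that by (intro mult_nonneg_nonneg) auto
  have "as ! j > 0" using ok j by (auto simp: less_le)
  then have "0 < real_of_rat (as ! j) * x j" using j by simp
  then have "0 < (\<Sum>l<length as. real_of_rat (as ! l) * x l)"
    using j nn by (intro sum_pos2[of _ j]) auto
  then show ?thesis using ok by (simp add: add_nonneg_pos)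
qed

lemma policy_positive_insert:
  assumes P: "max_min_pps P" and S: "policy_positive P S \<sigma>" and i: "i \<in> S_candidates P S"
    and agree: "\<And>l. l \<in> S \<Longrightarrow> \<sigma>' l = \<sigma> l"
    and choice: "\<And>j k. P ! i = FormMax j k \<Longrightarrow> \<sigma>' i \<in> S"
  shows "policy_positive P (insert i S) \<sigma>'"
  unfolding policy_positive_def
proof (intro allI impI)
  fix \<tau> assume \<tau>: "max_policy P \<tau>" and eq: "\<forall>l\<in>insert i S. \<tau> l = \<sigma>' l"
  let ?g = "pps_gfp (apply_policy P \<tau>)"
  note P' = max_min_pps_apply_policy[OF P \<tau>]
  have pos: "0 < ?g l" if "l \<in> S" for l
    using S \<tau> eq agree that by (auto simp: policy_positive_def)
  have il: "i < length P" and rule: "S_rule (P ! i) S" using i by (auto simp: S_candidates_def)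
  have "0 < eval (apply_policy P \<tau> ! i) ?g"
  proof (cases "P ! i")
    case (FormL a0 as)
    with rule obtain j where "j \<in> form_vars (FormL a0 as)" "j \<in> S" by auto
    then show ?thesis
      using eval_FormL_pos[of "length P" a0 as ?g j] max_min_ppsD[OF P il] pps_gfp_unit[OF P'] pos FormL
      by (simp add: eval_apply_policy[OF P \<tau> il])
  next
    case (FormMax j k)
    then show ?thesis using choice eq pos by (auto simp: eval_apply_policy[OF P \<tau> il])
  qed (use rule pos in \<open>auto simp: eval_apply_policy[OF P \<tau> il]\<close>)
  then have "0 < ?g i" using pps_gfp_eval[OF P'] il by simp
  then show "\<forall>l\<in>insert i S. 0 < ?g l" using pos by auto
qed

lemma eval_FormL_ge:
  assumes ok: "snf_ok n (FormL a0 as)" and one: "1 \<le> eval (FormL a0 as) (\<lambda>_. 1)"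
    and c: "c \<le> 1" and x: "\<And>j. j \<in> form_vars (FormL a0 as) \<Longrightarrow> c \<le> x j" and c0: "0 \<le> c"
  shows "c \<le> eval (FormL a0 as) x"
proof -
  have "c \<le> c * eval (FormL a0 as) (\<lambda>_. 1)" using one c0 by (simp add: mult_le_cancel_left1)
  also have "\<dots> = c * of_rat a0 + (\<Sum>j<length as. of_rat (as ! j) * c)"
    by (simp add: algebra_simps sum_distrib_left)
  also have "\<dots> \<le> of_rat a0 + (\<Sum>j<length as. of_rat (as ! j) * x j)"
  proof (rule add_mono)
    show "c * of_rat a0 \<le> (of_rat a0 :: real)" using c ok by (simp add: mult_left_le_one_le c0)
    show "(\<Sum>j<length as. of_rat (as ! j) * c) \<le> (\<Sum>j<length as. of_rat (as ! j) * x j)"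
    proof (rule sum_mono)
      fix j assume "j \<in> {..<length as}"
      then show "of_rat (as ! j) * c \<le> of_rat (as ! j) * x j"
        using x[of j] ok by (cases "as ! j = 0") (auto intro!: mult_left_mono)
    qed
  qed
  finally show ?thesis by simp
qed

text \<open>
  A variable outside \<open>S \<union> F\<close> is not of form \<open>Q\<close>, loses no probability mass, and under a suitable
  policy depends only on variables outside \<open>F\<close>.  Hence raising the fixed point to a constant
  \<open>c \<le> 1\<close> not exceeding its values on \<open>S\<close> there gives a post-fixed point.
\<close>

lemma policy_positive_compl:
  assumes P: "max_min_pps P" and S: "policy_positive P S \<sigma>" and SV: "S \<subseteq> vars P"
    and init: "init_F P S \<subseteq> F" and closed: "F_candidates P S F = {}"
    and FS: "F \<inter> S = {}"
    and agree: "\<And>l. l \<in> S \<Longrightarrow> \<sigma>' l = \<sigma> l"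
    and choice: "\<And>i j k. i \<in> vars P - S - F \<Longrightarrow> P ! i = FormMax j k \<Longrightarrow> \<sigma>' i \<notin> F"
  shows "policy_positive P (vars P - F) \<sigma>'"
  unfolding policy_positive_def
proof (intro allI impI)
  fix \<tau> assume \<tau>: "max_policy P \<tau>" and eq: "\<forall>l\<in>vars P - F. \<tau> l = \<sigma>' l"
  let ?g = "pps_gfp (apply_policy P \<tau>)"
  note P' = max_min_pps_apply_policy[OF P \<tau>]
  have pos: "0 < ?g l" if "l \<in> S" for l
    proof -
    have "\<forall>i\<in>S. \<tau> i = \<sigma> i" 
    proof
      fix i assume i: "i \<in> S"
      then have "i \<in> vars P - F" using FS SV by auto
      then show "\<tau> i = \<sigma> i" using eq agree[OF i] by simp
    qed
    then show ?thesis using S \<tau> that by (auto simp: policy_positive_def)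
  qed
  define c where "c = Min (insert 1 (?g ` S))"
  have fin: "finite S" using SV finite_subset by blast
  have c0: "0 < c" and c1: "c \<le> 1" using pos fin by (auto simp: c_def)
  have cS: "c \<le> ?g l" if "l \<in> S" for l using that fin by (auto simp: c_def)
  define T where "T = vars P - S - F"
  define y where "y = (\<lambda>i. if i \<in> T then max (?g i) c else ?g i)"
  have gbox: "?g \<in> unit_box (length P)" using pps_gfp_greatest(1)[OF P'] by simp
  have ge: "?g \<le> y" by (auto simp: le_fun_def y_def)
  have ybox: "y \<in> unit_box (length P)"
    using gbox c0 c1 by (auto simp: unit_box_def y_def T_def PiE_def Pi_def extensional_def max_def)
  have yc: "c \<le> y l" if "l < length P" "l \<notin> F" for l
    using that cS by (auto simp: y_def T_def)
  have "y \<le> ?g"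
  proof (rule pps_gfp_upper[OF P'])
    show "y \<in> unit_box (length (apply_policy P \<tau>))" using ybox by simp
    show "y \<le> pps_map (apply_policy P \<tau>) y"
    proof (rule le_funI)
      fix i
      have g: "?g i \<le> pps_map (apply_policy P \<tau>) y i"
        using pps_map_mono[OF P' _ ge] gbox pps_gfp_greatest(2)[OF P'] by (auto simp: le_fun_def)
      show "y i \<le> pps_map (apply_policy P \<tau>) y i"
      proof (cases "i \<in> T")
        case False
        then show ?thesis using g by (simp add: y_def)
      next
        case True
        then have il: "i < length P" and iS: "i \<notin> S" and iF: "i \<notin> F" by (auto simp: T_def)
        have rule: "\<not> F_rule (P ! i) F" using closed il iS iF by (auto simp: F_candidates_def)
        have ini: "\<not> eval (P ! i) (\<lambda>_. 1) < 1" "\<not> is_FormQ (P ! i)"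
          using init il iS iF by (auto simp: init_F_def)
        have ok: "snf_ok (length P) (P ! i)" using max_min_ppsD[OF P il] .
        have "c \<le> eval (apply_policy P \<tau> ! i) y"
        proof (cases "P ! i")
          case (FormL a0 as)
          have "c \<le> eval (FormL a0 as) y"
          proof (rule eval_FormL_ge)
            show "snf_ok (length P) (FormL a0 as)" using ok FormL by simp
            show "1 \<le> eval (FormL a0 as) (\<lambda>_. 1)" using ini FormL by simp
            show "c \<le> y j" if "j \<in> form_vars (FormL a0 as)" for j
              using that rule FormL ok by (intro yc) auto
          qed (use c0 c1 in auto)
          then show ?thesis using FormL by (simp add: eval_apply_policy[OF P \<tau> il])
        next
          case (FormQ j k)
          then show ?thesis using ini by simp
        next
          case (FormMax j k)
          have "\<tau> i \<notin> F" using choice[of i j k] FormMax True eq by (auto simp: T_def)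
          then show ?thesis
            using FormMax yc max_policy_less[OF P \<tau> il FormMax]
            by (simp add: eval_apply_policy[OF P \<tau> il])
        next
          case (FormMin j k)
          then show ?thesis using rule yc ok by (simp add: eval_apply_policy[OF P \<tau> il])
        qed
        then show ?thesis using g il by (simp add: y_def pps_map_def)
      qed
    qed
  qed
  then have "c \<le> ?g l" if "l \<in> vars P - F" for l
    using yc[of l] le_funD[of y ?g l] that by auto
  then show "\<forall>l\<in>vars P - F. 0 < ?g l"
    using c0 less_le_trans by blast
qed

definition F_least :: "pps \<Rightarrow> nat set \<Rightarrow> nat set \<Rightarrow> bool" where
  "F_least P S F \<longleftrightarrow> (\<forall>G. init_F P S \<subseteq> G \<longrightarrow>
     (\<forall>i\<in>vars P - S. F_rule (P ! i) G \<longrightarrow> i \<in> G) \<longrightarrow> F \<subseteq> G)"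

lemma F_rule_mono: "F_rule e F \<Longrightarrow> F \<subseteq> G \<Longrightarrow> F_rule e G"
  by (cases e) auto

lemma F_least_init: "F_least P S (init_F P S)"
  by (simp add: F_least_def)

lemma F_least_insert:
  assumes F: "F_least P S F" and i: "i \<in> F_candidates P S F"
  shows "F_least P S (insert i F)"
  unfolding F_least_def
proof (intro allI impI)
  fix G assume G: "init_F P S \<subseteq> G" "\<forall>i\<in>vars P - S. F_rule (P ! i) G \<longrightarrow> i \<in> G"
  then have "F \<subseteq> G" using F by (auto simp: F_least_def)
  then show "insert i F \<subseteq> G"
    using i G F_rule_mono[of "P ! i" F G] by (auto simp: F_candidates_def)
qed

text \<open>
  The largest value \<open>m\<close> of the fixed point on \<open>F\<close> satisfies \<open>m < 1\<close>.  If \<open>m > 0\<close>, then the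
  variables with value below \<open>m\<close> include the initial set and are closed under the rules generating
  \<open>F\<close>, so no variable of \<open>F\<close> attains \<open>m\<close>.
\<close>

lemma pps_gfp_zero:
  assumes P: "max_min_pps P" and lt1: "\<forall>i\<in>vars P. pps_gfp P i < 1"
    and initS: "init_S P \<subseteq> S" and closed: "S_candidates P S = {}"
    and F: "F_least P S F" and disj: "F = vars P - S" and i: "i \<in> F"
  shows "pps_gfp P i = 0"
proof -
  let ?g = "pps_gfp P"
  define m where "m = Max (?g ` F)"
  have fin: "finite F" using disj by simp
  have le: "?g l \<le> m" if "l \<in> F" for l using that fin by (auto simp: m_def)
  have "m \<in> ?g ` F" unfolding m_def using fin i by (intro Max_in) auto
  then obtain l where l: "l \<in> F" "?g l = m" by auto
  have g0: "0 \<le> ?g l" if "l < length P" for l using pps_gfp_unit[OF P that] by simp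
  show ?thesis
  proof (rule ccontr)
    assume "?g i \<noteq> 0"
    then have mpos: "0 < m" using le[OF i] g0[of i] i disj by auto
    have facts: "snf_ok (length P) (P ! v)" "\<not> S_rule (P ! v) S" "?g v = eval (P ! v) ?g"
      "\<not> 0 < eval (P ! v) (\<lambda>_. 0)" if "v \<in> F" for v
      using that disj max_min_ppsD[OF P] closed pps_gfp_eval[OF P] initS
      by (auto simp: S_candidates_def init_S_def)
    have lin: "?g v \<le> m * eval (P ! v) (\<lambda>_. 1)
        \<and> ((\<exists>j\<in>form_vars (P ! v). ?g j < m) \<longrightarrow> ?g v < m)"
      if v: "v \<in> F" and L: "P ! v = FormL a0 as" for v a0 as
    proof -
      note fv = facts[OF v, unfolded L]
      have a0: "a0 = 0" using fv by simp
      have len: "length as = length P" using fv by simp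
      have nn: "0 \<le> as ! j" if "j < length as" for j using fv that by simp
      have inF: "j \<in> F" if "j < length as" "as ! j \<noteq> 0" for j
        using fv that len disj by auto
      have tm: "of_rat (as ! j) * ?g j \<le> of_rat (as ! j) * m" if "j < length as" for j
        using le inF[OF that] nn[OF that] by (cases "as ! j = 0") (auto intro!: mult_left_mono)
      have "?g v = (\<Sum>j<length as. of_rat (as ! j) * ?g j)" using fv a0 by simp
      moreover have "m * eval (P ! v) (\<lambda>_. 1) = (\<Sum>j<length as. of_rat (as ! j) * m)"
        using L a0 by (simp add: sum_distrib_left mult.commute)
      moreover have "(\<Sum>j<length as. of_rat (as ! j) * ?g j) \<le> (\<Sum>j<length as. of_rat (as ! j) * m)"
        using tm by (intro sum_mono) auto
      moreover have "(\<Sum>j<length as. of_rat (as ! j) * ?g j) < (\<Sum>j<length as. of_rat (as ! j) * m)"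
        if "j \<in> form_vars (P ! v)" "?g j < m" for j
      proof (rule sum_strict_mono_ex1)
        have "0 < as ! j" using nn that L by (auto simp: less_le)
        then show "\<exists>x\<in>{..<length as}. of_rat (as ! x) * ?g x < of_rat (as ! x) * m"
          using that L by (intro bexI[of _ j]) auto
      qed (use tm in auto)
      moreover have "m * eval (P ! v) (\<lambda>_. 1) \<le> m"
        using eval_unit[OF facts(1)[OF v], of "\<lambda>_. 1"] mpos by (simp add: mult_left_le)
      ultimately show ?thesis by (smt (verit))
    qed
    define G where "G = {v \<in> F. ?g v < m}"
    have "init_F P S \<subseteq> G"
    proof
      fix v assume v: "v \<in> init_F P S"
      have vF: "v \<in> F" using v disj by (simp add: init_F_def)
      have "?g v < m"
      proof -
        note fv = facts[OF vF]
        show "?g v < m"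
        proof (cases "P ! v")
          case (FormL a0 as)
          have "eval (P ! v) (\<lambda>_. 1) < 1" using v FormL by (auto simp: init_F_def)
          then have "m * eval (P ! v) (\<lambda>_. 1) < m" using mpos by simp
          then show ?thesis using lin[OF vF FormL] by linarith
        next
          case (FormQ j k)
          have jk: "j < length P" "k < length P" using fv FormQ by auto
          obtain a b where ab: "?g v = ?g a * ?g b" "a \<in> F" "b < length P"
          proof (cases "j \<in> S")
            case True
            then show ?thesis using that[of k j] fv FormQ jk disj by (simp add: mult.commute)
          next
            case False
            then show ?thesis using that[of j k] fv FormQ jk disj by simp
          qed
          have "?g a * ?g b \<le> m * ?g b" using le[OF ab(2)] g0[OF ab(3)] by (rule mult_right_mono)
          also have "\<dots> < m * 1" using lt1 ab(3) mpos by (intro mult_strict_left_mono) auto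
          finally show ?thesis using ab(1) by simp
        qed (use v in \<open>auto simp: init_F_def\<close>)
      qed
      then show "v \<in> G" using vF by (simp add: G_def)
    qed
    moreover have "v \<in> G" if v: "v \<in> vars P - S" and rule: "F_rule (P ! v) G" for v
    proof -
      have vF: "v \<in> F" using v disj by simp
      note fv = facts[OF vF]
      have "?g v < m"
      proof (cases "P ! v")
        case (FormL a0 as)
        obtain j where j: "j \<in> form_vars (P ! v)" "j \<in> G" using rule FormL by auto
        then have "j \<in> F" using fv FormL disj by auto
        then show ?thesis using lin[OF vF FormL] j by (auto simp: G_def)
      next
        case (FormMax j k)
        then show ?thesis using fv rule disj by (auto simp: G_def)
      next
        case (FormMin j k)
        obtain a where a: "a \<in> {j, k}" "a \<in> G" using rule FormMin by auto
        then show ?thesis using fv FormMin by (auto simp: G_def)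
      qed (use rule in auto)
      then show ?thesis using vF by (simp add: G_def)
    qed
    ultimately have "F \<subseteq> G" using F by (auto simp: F_least_def)
    then show False using l by (auto simp: G_def)
  qed
qed


fun proc_inv :: "pps \<Rightarrow> config \<Rightarrow> bool" where
  "proc_inv P (pc, S, F) \<longleftrightarrow> S \<subseteq> vars P \<and> F \<subseteq> vars P \<and>
     (pc = Step1 \<longrightarrow> S = {} \<and> F = {}) \<and>
     (pc \<noteq> Step1 \<longrightarrow> init_S P \<subseteq> S) \<and>
     (pc \<notin> {Step1, Step2} \<longrightarrow> S_candidates P S = {}) \<and>
     (pc \<notin> {Step1, Step2, Step3} \<longrightarrow> F \<inter> S = {} \<and> init_F P S \<subseteq> F \<and> F_least P S F) \<and>
     (pc \<in> {Step5, Step6, Halted} \<longrightarrow> F_candidates P S F = {}) \<and>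
     (pc = Step6 \<longrightarrow> vars P \<noteq> S \<union> F) \<and> (pc = Halted \<longrightarrow> vars P = S \<union> F)"

lemma proc_inv_start: "proc_inv P proc_start"
  by (simp add: proc_start_def)

lemma proc_inv_step:
  assumes "proc_step P c c'" "proc_inv P c"
  shows "proc_inv P c'"
  using assms
proof cases
  case (step1 S F)
  then show ?thesis using assms(2) by (auto simp: init_S_def)
next
  case (step2_add i S F)
  then show ?thesis using assms(2) by (auto simp: S_candidates_def)
next
  case (step3 S F)
  then show ?thesis using assms(2) F_least_init[of P S] by (auto simp: init_F_def)
next
  case (step4_add i S F)
  then show ?thesis using assms(2) F_least_insert[of P S F i] by (auto simp: F_candidates_def)
next
  case (step6 S F)
  then show ?thesis using assms(2) by auto
qed auto

fun proc_measure :: "pps \<Rightarrow> config \<Rightarrow> nat" where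
  "proc_measure P (pc, S, F) = (length P - card S) * (length P + 10) +
     (case pc of Step1 \<Rightarrow> length P + 10 | Step2 \<Rightarrow> length P + 9 | Step3 \<Rightarrow> length P + 8
      | Step4 \<Rightarrow> (length P - card F) + 5 | Step5 \<Rightarrow> 4 | Step6 \<Rightarrow> 3 | Halted \<Rightarrow> 0)"

lemma card_vars_insert:
  assumes "i \<in> vars P - S" "S \<subseteq> vars P"
  shows "length P - card S = Suc (length P - card (insert i S))"
proof -
  have fin: "finite S" using assms(2) finite_subset by blast
  have "card (insert i S) \<le> card (vars P)" using assms by (intro card_mono) auto
  then show ?thesis using assms fin by (simp add: card_insert_if)
qed

lemma proc_measure_step:
  assumes "proc_step P c c'" "proc_inv P c"
  shows "proc_measure P c' < proc_measure P c"
  using assms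
proof cases
  case (step1 S F)
  have "(length P - card (init_S P)) * (length P + 10) \<le> length P * (length P + 10)"
    by (intro mult_right_mono) auto
  then show ?thesis using step1 assms(2) by (simp add: init_S_def less_Suc_eq_le)
next
  case (step2_add i S F)
  then show ?thesis using assms(2) card_vars_insert[of i P S] by (auto simp: S_candidates_def)
next
  case (step4_add i S F)
  then show ?thesis using assms(2) card_vars_insert[of i P F] by (auto simp: F_candidates_def)
next
  case (step6 S F)
  have fin: "finite (vars P - F)" by simp
  have "S \<subset> vars P - F" using step6 assms(2) by auto
  then have "card S < card (vars P - F)" using fin psubset_card_mono by blast
  moreover have "card (vars P - F) \<le> length P" using card_mono[of "vars P" "vars P - F"] by simp
  ultimately have "length P - card (vars P - F) < length P - card S" by simp
  then have "Suc (length P - card (vars P - F)) * (length P + 10) \<le> (length P - card S) * (length P + 10)"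
    by (intro mult_right_mono) auto
  then show ?thesis using step6 by simp
qed auto

lemma proc_measure_start: "proc_measure P proc_start \<le> 20 * (length P + 1)\<^sup>2"
  by (simp add: proc_start_def power2_eq_square algebra_simps)

lemma proc_step_exists:
  assumes "pc \<noteq> Halted"
  shows "\<exists>c'. proc_step P (pc, S, F) c'"
proof (cases pc)
  case Step1
  then show ?thesis using proc_step.step1 by blast
next
  case Step2
  show ?thesis
    unfolding Step2 using proc_step.step2_add[of _ P S F] proc_step.step2_exit[of P S F] by blast
next
  case Step3
  then show ?thesis using proc_step.step3 by blast
next
  case Step4
  show ?thesis
    unfolding Step4 using proc_step.step4_add[of _ P S F] proc_step.step4_exit[of P S F] by blast
next
  case Step5
  show ?thesis
    unfolding Step5 using proc_step.step5_halt[of P S F] proc_step.step5_continue[of P S F] by blast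
next
  case Step6
  then show ?thesis using proc_step.step6 by blast
qed (use assms in simp)

lemma proc_step_policy:
  assumes P: "max_min_pps P" and step: "proc_step P (pc, S, F) (pc', S', F')"
    and inv: "proc_inv P (pc, S, F)" and \<sigma>: "max_policy P \<sigma>" "policy_positive P S \<sigma>"
  shows "\<exists>\<sigma>'. max_policy P \<sigma>' \<and> policy_positive P S' \<sigma>'"
  using step
proof cases
  case step1
  then show ?thesis using policy_positive_init_S[OF P] \<sigma> by (auto simp: init_S_def)
next
  case (step2_add i)
  define \<sigma>' where "\<sigma>' = \<sigma>(i := case P ! i of FormMax j k \<Rightarrow> if j \<in> S then j else k | _ \<Rightarrow> 0)"
  have cand: "i \<in> S_candidates P S" using step2_add by simp
  then have i: "i \<notin> S" "S_rule (P ! i) S" by (auto simp: S_candidates_def)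
  have "max_policy P \<sigma>'" using \<sigma>(1) by (auto simp: max_policy_def \<sigma>'_def)
  moreover have "policy_positive P (insert i S) \<sigma>'"
    using i by (intro policy_positive_insert[OF P \<sigma>(2) cand]) (auto simp: \<sigma>'_def)
  ultimately show ?thesis using step2_add by blast
next
  case step6
  define \<sigma>' where "\<sigma>' = (\<lambda>i. if i \<in> S then \<sigma> i else
    case P ! i of FormMax j k \<Rightarrow> if j \<in> F then k else j | _ \<Rightarrow> 0)"
  have "max_policy P \<sigma>'" using \<sigma>(1) by (auto simp: max_policy_def \<sigma>'_def)
  moreover have "policy_positive P (vars P - F) \<sigma>'"
  proof (rule policy_positive_compl[OF P \<sigma>(2)])
    show SV: "S \<subseteq> vars P" and "init_F P S \<subseteq> F" and closed: "F_candidates P S F = {}"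
      and "F \<inter> S = {}"
      using inv step6(1) by simp_all
    show "\<sigma>' l = \<sigma> l" if "l \<in> S" for l using that by (simp add: \<sigma>'_def)
    show "\<sigma>' i \<notin> F" if i: "i \<in> vars P - S - F" "P ! i = FormMax j k" for i j k
    proof -
      have "\<not> F_rule (P ! i) F" using closed i(1) by (auto simp: F_candidates_def)
      then show ?thesis using i by (auto simp: \<sigma>'_def)
    qed
  qed
  ultimately show ?thesis using step6(3) by blast
qed (use \<sigma> in blast)+

definition first_policy :: "pps \<Rightarrow> nat \<Rightarrow> nat" where
  "first_policy P i = (case P ! i of FormMax j k \<Rightarrow> j | _ \<Rightarrow> 0)"

lemma max_policy_first_policy: "max_policy P (first_policy P)"
  by (auto simp: max_policy_def first_policy_def)

lemma proc_reachable:
  assumes P: "max_min_pps P" and "(proc_step P)\<^sup>*\<^sup>* proc_start c"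
  shows "proc_inv P c \<and> (\<exists>\<sigma>. max_policy P \<sigma> \<and> policy_positive P (fst (snd c)) \<sigma>)"
  using assms(2)
proof (induction rule: rtranclp_induct)
  case base
  have "policy_positive P (fst (snd proc_start)) (first_policy P)"
    by (simp add: proc_start_def policy_positive_empty)
  then show ?case using proc_inv_start max_policy_first_policy by blast
next
  case (step c c')
  obtain pc S F pc' S' F' where c: "c = (pc, S, F)" "c' = (pc', S', F')" by (cases c, cases c')
  have "proc_inv P c'" using step proc_inv_step by blast
  moreover obtain \<sigma> where "max_policy P \<sigma>" "policy_positive P S \<sigma>"
    using step.IH unfolding c fst_conv snd_conv by blast
  then have "\<exists>\<sigma>. max_policy P \<sigma> \<and> policy_positive P S' \<sigma>"
    using proc_step_policy[OF P step.hyps(2)[unfolded c]] step.IH c(1) by blast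
  ultimately show ?case using c by simp
qed

lemma halted_output:
  assumes P: "max_min_pps P" and lt1: "\<forall>i\<in>vars P. pps_gfp P i < 1"
    and inv: "proc_inv P (Halted, S, F)" and \<sigma>: "max_policy P \<sigma>" "policy_positive P S \<sigma>"
  shows "F = {i \<in> vars P. pps_gfp P i = 0}" "S = {i \<in> vars P. pps_gfp P i > 0}"
    "\<forall>i\<in>S. 0 < pps_gfp (apply_policy P \<sigma>) i"
proof -
  have F: "F = vars P - S" and SV: "S \<subseteq> vars P" using inv by auto
  show pos: "\<forall>i\<in>S. 0 < pps_gfp (apply_policy P \<sigma>) i"
    using \<sigma> by (auto simp: policy_positive_def)
  have S: "0 < pps_gfp P i" if "i \<in> S" for i
    using pos[rule_format, OF that] le_funD[OF pps_gfp_apply_policy_le[OF P \<sigma>(1)], of i]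
    by (rule less_le_trans)
  have zero: "pps_gfp P i = 0" if "i \<in> F" for i
    using pps_gfp_zero[OF P lt1 _ _ _ F that] inv by simp
  show "F = {i \<in> vars P. pps_gfp P i = 0}"
    using F zero by (auto dest: S)
  show "S = {i \<in> vars P. pps_gfp P i > 0}"
    using F SV by (auto dest: S zero) (use zero in force)
qed

lemma proc_steps_bound:
  assumes "(proc_step P ^^ m) proc_start c"
  shows "proc_inv P c \<and> m + proc_measure P c \<le> proc_measure P proc_start"
  using assms
proof (induction m arbitrary: c)
  case 0
  then show ?case using proc_inv_start by auto
next
  case (Suc m)
  then obtain d where "(proc_step P ^^ m) proc_start d" "proc_step P d c" by auto
  then show ?case
    using Suc.IH[of d] proc_inv_step[of P d c] proc_measure_step[of P d c] by linarith
qed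

lemma proc_no_infinite_run:
  "\<nexists>f. f 0 = proc_start \<and> (\<forall>m. proc_step P (f m) (f (Suc m)))"
proof
  assume "\<exists>f. f 0 = proc_start \<and> (\<forall>m. proc_step P (f m) (f (Suc m)))"
  then obtain f where f: "f 0 = proc_start" "\<And>m. proc_step P (f m) (f (Suc m))" by auto
  have "(proc_step P ^^ m) proc_start (f m)" for m
    using f by (induction m) auto
  from proc_steps_bound[OF this[of "Suc (proc_measure P proc_start)"]] show False by simp
qed

lemma proc_stuck:
  assumes P: "max_min_pps P" and lt1: "\<forall>i\<in>vars P. pps_gfp P i < 1"
    and c: "(proc_step P)\<^sup>*\<^sup>* proc_start c" "\<nexists>c'. proc_step P c c'"
  shows "\<exists>S. c = (Halted, S, {i \<in> vars P. pps_gfp P i = 0})"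
proof -
  obtain pc S F where eq: "c = (pc, S, F)" by (cases c)
  have "pc = Halted" using c(2) eq proc_step_exists[of pc P S F] by auto
  then show ?thesis
    using proc_reachable[OF P c(1)] eq halted_output(1)[OF P lt1, of S F]
    by (auto simp del: proc_inv.simps)
qed

section \<open>Unit cost and weakest preconditions\<close>

lemma bits_le_iff: "bits k \<le> w \<longleftrightarrow> 1 \<le> w \<and> k < 2 ^ w"
  by (auto simp: bits_def floorlog_le_iff)

lemma bits_ge_1: "1 \<le> bits k"
  by (simp add: bits_def)

lemma less_power_bits: "k < 2 ^ bits k"
  using bits_le_iff[of k "bits k"] by simp

lemma bits_mono: "a \<le> b \<Longrightarrow> bits a \<le> bits b"
  using bits_ge_1[of b] less_power_bits[of b] by (simp add: bits_le_iff)

lemma bits_le_Suc: "bits k \<le> Suc k"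
  using less_exp[of "Suc k"] by (simp add: bits_le_iff)

lemma bits_add_le:
  assumes "bits a \<le> w" "bits b \<le> w"
  shows "bits (a + b) \<le> Suc w"
  using assms by (auto simp: bits_le_iff)

lemma bits_mult_le: "bits (a * b) \<le> bits a + bits b"
proof -
  have "a * b < 2 ^ bits a * 2 ^ bits b"
    using less_power_bits[of a] less_power_bits[of b] by (intro mult_strict_mono) auto
  then show ?thesis using bits_ge_1[of a] by (simp add: bits_le_iff power_add)
qed

lemma bits_16: "bits 16 = 5"
  by (simp add: bits_def compute_floorlog)

text \<open>
  The logarithmic cost of a run is bounded through a unit cost: a multiplication is charged the
  length of its second factor, every other operation a constant.  Then the length of all numbers
  grows by at most the unit cost spent, and the logarithmic cost is at most quadratic in it.
\<close>

fun ucost :: "aexp \<Rightarrow> mem \<Rightarrow> nat" where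
  "ucost (Const k) s = Suc k"
| "ucost (Mem a) s = ucost a s + 1"
| "ucost (Add a b) s = ucost a s + ucost b s + 1"
| "ucost (Sub a b) s = ucost a s + ucost b s + 1"
| "ucost (Mul a b) s = ucost a s + ucost b s + 1 + bits (aval b s)"
| "ucost (Div a b) s = ucost a s + ucost b s + 1"

lemma bits_aval_le:
  assumes "\<And>a. bits (s a) \<le> b"
  shows "bits (aval e s) \<le> b + ucost e s"
proof (induction e)
  case (Const k)
  then show ?case using bits_le_Suc[of k] by simp
next
  case (Mem e)
  then show ?case using assms[of "aval e s"] by simp
next
  case (Add e1 e2)
  then show ?case
    using bits_add_le[of "aval e1 s" "b + ucost e1 s + ucost e2 s" "aval e2 s"] by simp
next
  case (Sub e1 e2)
  then show ?case using bits_mono[of "aval e1 s - aval e2 s" "aval e1 s"] by simp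
next
  case (Mul e1 e2)
  then show ?case using bits_mult_le[of "aval e1 s" "aval e2 s"] by simp
next
  case (Div e1 e2)
  then show ?case using bits_mono[of "aval e1 s div aval e2 s" "aval e1 s"] by simp
qed

lemma quad_mono: "k \<le> k' \<Longrightarrow> b \<le> b' \<Longrightarrow> 2 * k * (b + k) \<le> 2 * k' * (b' + (k' :: nat))"
  by (intro mult_mono) auto

lemma quad_add:
  assumes "t1 \<le> 2 * k1 * (b + k1)" "t2 \<le> 2 * k2 * (b + k1 + k2)"
  shows "t1 + t2 \<le> 2 * (k1 + k2) * (b + (k1 + k2 :: nat))"
proof -
  have "t1 \<le> 2 * k1 * (b + (k1 + k2))"
    using assms(1) by (rule order_trans) (intro mult_left_mono, auto)
  then show ?thesis using assms(2) by (simp add: algebra_simps)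
qed

lemma acost_le:
  assumes "\<And>a. bits (s a) \<le> b"
  shows "acost e s \<le> 2 * ucost e s * (b + ucost e s)"
proof (induction e)
  case (Const k)
  have "bits k \<le> Suc k" by (rule bits_le_Suc)
  then show ?case by (simp add: algebra_simps)
next
  case (Mem e)
  have "acost e s + (bits (aval e s) + bits (s (aval e s)))
    \<le> 2 * (ucost e s + 1) * (b + (ucost e s + 1))"
    by (rule quad_add[OF Mem.IH])
      (use assms[of "aval e s"] bits_aval_le[of s b e, OF assms] in \<open>simp add: algebra_simps\<close>)
  then show ?case by (simp add: add.assoc)
next
  have two: "acost e1 s + acost e2 s + bits (aval e1 s) + bits (aval e2 s) \<le> 2 * k * (b + k)"
    if "acost e1 s \<le> 2 * ucost e1 s * (b + ucost e1 s)"
      "acost e2 s \<le> 2 * ucost e2 s * (b + ucost e2 s)"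
      "ucost e1 s + ucost e2 s + 1 \<le> k" for e1 e2 k
  proof -
    have "acost e1 s + acost e2 s
      \<le> 2 * (ucost e1 s + ucost e2 s) * (b + (ucost e1 s + ucost e2 s))"
      by (rule quad_add[OF that(1)]) (rule order_trans[OF that(2)], intro mult_left_mono, auto)
    from this have "(acost e1 s + acost e2 s) + (bits (aval e1 s) + bits (aval e2 s))
      \<le> 2 * (ucost e1 s + ucost e2 s + 1) * (b + (ucost e1 s + ucost e2 s + 1))"
      by (rule quad_add)
        (use bits_aval_le[of s b e1, OF assms] bits_aval_le[of s b e2, OF assms] in
          \<open>simp add: algebra_simps\<close>)
    also have "\<dots> \<le> 2 * k * (b + k)" using that(3) by (intro quad_mono) auto
    finally show ?thesis by simp
  qed
  {
    case (Add e1 e2) then show ?case unfolding acost.simps by (intro two) simp_all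
  next
    case (Sub e1 e2) then show ?case unfolding acost.simps by (intro two) simp_all
  next
    case (Mul e1 e2) then show ?case unfolding acost.simps by (intro two) simp_all
  next
    case (Div e1 e2) then show ?case unfolding acost.simps by (intro two) simp_all
  }
qed

definition runs :: "com \<Rightarrow> mem \<Rightarrow> nat \<Rightarrow> mem \<Rightarrow> bool" where
  "runs c s k s' \<longleftrightarrow> (\<exists>t. exec c s t s' \<and> (\<forall>b. (\<forall>a. bits (s a) \<le> b) \<longrightarrow>
     t \<le> 2 * k * (b + k) \<and> (\<forall>a. bits (s' a) \<le> b + k)))"

lemma runs_mono: "runs c s k s' \<Longrightarrow> k \<le> k' \<Longrightarrow> runs c s k' s'"
proof -
  assume "runs c s k s'" and k: "k \<le> k'"
  then obtain t where t: "exec c s t s'"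
    "\<And>b. (\<forall>a. bits (s a) \<le> b) \<Longrightarrow> t \<le> 2 * k * (b + k) \<and> (\<forall>a. bits (s' a) \<le> b + k)"
    unfolding runs_def by blast
  show ?thesis
    unfolding runs_def
  proof (intro exI[of _ t] conjI allI impI)
    fix b assume "\<forall>a. bits (s a) \<le> b"
    note tb = t(2)[OF this]
    show "t \<le> 2 * k' * (b + k')" using tb quad_mono[OF k order_refl, of b] by linarith
    show "bits (s' a) \<le> b + k'" for a using conjunct2[OF tb, rule_format, of a] k by linarith
  qed (rule t(1))
qed

lemma runs_Skip: "runs Skip s 1 s"
  unfolding runs_def
proof (intro exI[of _ 1] conjI exec.Skip allI impI)
  fix b a assume "\<forall>a. bits (s a) \<le> b"
  then show "bits (s a) \<le> b + 1" using trans_le_add1 by blast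
qed simp

lemma runs_Store:
  "runs (Store a b) s (ucost a s + ucost b s + 1) (s(aval a s := aval b s))"
  unfolding runs_def
proof (intro exI conjI allI impI)
  show "exec (Store a b) s (acost a s + acost b s + bits (aval a s) + bits (aval b s))
     (s(aval a s := aval b s))" by (rule exec.Store)
next
  fix w assume w: "\<forall>x. bits (s x) \<le> w"
  then have "acost (Add a b) s \<le> 2 * ucost (Add a b) s * (w + ucost (Add a b) s)"
    by (intro acost_le) simp
  then show "acost a s + acost b s + bits (aval a s) + bits (aval b s)
    \<le> 2 * (ucost a s + ucost b s + 1) * (w + (ucost a s + ucost b s + 1))" by simp
  fix x
  have "bits (aval b s) \<le> w + ucost b s" using w by (intro bits_aval_le) simp
  moreover have "bits (s x) \<le> w" using w by simp
  ultimately show "bits ((s(aval a s := aval b s)) x) \<le> w + (ucost a s + ucost b s + 1)"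
    by auto
qed

lemma runs_cost:
  assumes "exec c s (t0 + t) s'" "exec c1 s1 t s'"
  assumes "\<And>b. (\<forall>a. bits (s a) \<le> b) \<Longrightarrow> t0 \<le> 2 * k0 * (b + k0) \<and> (\<forall>a. bits (s1 a) \<le> b + k0)"
    and "\<And>b. (\<forall>a. bits (s1 a) \<le> b) \<Longrightarrow> t \<le> 2 * k * (b + k) \<and> (\<forall>a. bits (s' a) \<le> b + k)"
  shows "runs c s (k0 + k) s'"
  unfolding runs_def
proof (intro exI conjI allI impI)
  show "exec c s (t0 + t) s'" by fact
next
  fix b assume b: "\<forall>a. bits (s a) \<le> b"
  note 1 = assms(3)[OF b]
  note 2 = assms(4)[OF conjunct2[OF 1]]
  show "t0 + t \<le> 2 * (k0 + k) * (b + (k0 + k))" using 1 2 by (intro quad_add) auto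
  show "bits (s' a) \<le> b + (k0 + k)" for a using 2 by (simp add: add.assoc)
qed

lemma runs_Seq:
  assumes "runs c1 s k1 s1" "runs c2 s1 k2 s2"
  shows "runs (Seq c1 c2) s (k1 + k2) s2"
proof -
  obtain t1 where 1: "exec c1 s t1 s1"
    "\<And>b. (\<forall>a. bits (s a) \<le> b) \<Longrightarrow> t1 \<le> 2 * k1 * (b + k1) \<and> (\<forall>a. bits (s1 a) \<le> b + k1)"
    using assms(1) by (auto simp: runs_def)
  obtain t2 where 2: "exec c2 s1 t2 s2"
    "\<And>b. (\<forall>a. bits (s1 a) \<le> b) \<Longrightarrow> t2 \<le> 2 * k2 * (b + k2) \<and> (\<forall>a. bits (s2 a) \<le> b + k2)"
    using assms(2) by (auto simp: runs_def)
  show ?thesis by (rule runs_cost[OF exec.Seq[OF 1(1) 2(1)] 2(1) 1(2) 2(2)])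
qed

lemma test_cost:
  assumes "\<forall>a. bits (s a) \<le> b"
  shows "acost e s + bits (aval e s) \<le> 2 * (ucost e s + 1) * (b + (ucost e s + 1))
    \<and> (\<forall>a. bits (s a) \<le> b + (ucost e s + 1))"
proof
  have "acost (Mem e) s \<le> 2 * ucost (Mem e) s * (b + ucost (Mem e) s)"
    using assms by (intro acost_le) simp
  then show "acost e s + bits (aval e s) \<le> 2 * (ucost e s + 1) * (b + (ucost e s + 1))" by simp
  show "\<forall>a. bits (s a) \<le> b + (ucost e s + 1)" using assms trans_le_add1 by blast
qed

lemma runs_If:
  assumes "runs (if aval e s \<noteq> 0 then c1 else c2) s k s'"
  shows "runs (If_nz e c1 c2) s (ucost e s + 1 + k) s'"
proof -
  let ?c = "if aval e s \<noteq> 0 then c1 else c2"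
  obtain t where 1: "exec ?c s t s'"
    "\<And>b. (\<forall>a. bits (s a) \<le> b) \<Longrightarrow> t \<le> 2 * k * (b + k) \<and> (\<forall>a. bits (s' a) \<le> b + k)"
    using assms unfolding runs_def by blast
  have "exec (If_nz e c1 c2) s (acost e s + bits (aval e s) + t) s'"
    using 1(1) exec.If_true[of e s c1 t s' c2] exec.If_false[of e s c2 t s' c1]
    by (cases "aval e s = 0") simp_all
  from runs_cost[OF this 1(1) test_cost 1(2)] show ?thesis by simp
qed

lemma runs_While_false:
  assumes "aval e s = 0"
  shows "runs (While_nz e c) s (ucost e s + 1) s"
  unfolding runs_def
  by (intro exI conjI allI impI; (rule exec.While_false[OF assms])?) (use test_cost[of s _ e] in blast)+

lemma runs_While_true:
  assumes "aval e s \<noteq> 0" "runs c s k1 s1" "runs (While_nz e c) s1 k2 s2"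
  shows "runs (While_nz e c) s (ucost e s + 1 + k1 + k2) s2"
proof -
  obtain t1 where 1: "exec c s t1 s1"
    "\<And>b. (\<forall>a. bits (s a) \<le> b) \<Longrightarrow> t1 \<le> 2 * k1 * (b + k1) \<and> (\<forall>a. bits (s1 a) \<le> b + k1)"
    using assms(2) by (auto simp: runs_def)
  obtain t2 where 2: "exec (While_nz e c) s1 t2 s2"
    "\<And>b. (\<forall>a. bits (s1 a) \<le> b) \<Longrightarrow> t2 \<le> 2 * k2 * (b + k2) \<and> (\<forall>a. bits (s2 a) \<le> b + k2)"
    using assms(3) by (auto simp: runs_def)
  have body: "acost e s + bits (aval e s) + t1 \<le> 2 * (ucost e s + 1 + k1) * (b + (ucost e s + 1 + k1))
     \<and> (\<forall>a. bits (s1 a) \<le> b + (ucost e s + 1 + k1))" if b: "\<forall>a. bits (s a) \<le> b" for b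
  proof -
    note test = test_cost[OF b, of e]
    note 3 = 1(2)[OF conjunct2[OF test]]
    have "acost e s + bits (aval e s) + t1
       \<le> 2 * (ucost e s + 1 + k1) * (b + (ucost e s + 1 + k1))"
      by (rule quad_add[OF conjunct1[OF test]]) (use 3 in \<open>simp only: add.assoc\<close>)
    then show ?thesis using 3 by (simp add: add.assoc)
  qed
  show ?thesis
    by (rule runs_cost[OF exec.While_true[OF assms(1) 1(1) 2(1)] 2(1) body 2(2)])
qed

definition wp :: "com \<Rightarrow> (mem \<Rightarrow> nat \<Rightarrow> bool) \<Rightarrow> mem \<Rightarrow> nat \<Rightarrow> bool" where
  "wp c Q s t \<longleftrightarrow> (\<exists>s' k. runs c s k s' \<and> Q s' (t + k))"

lemma wp_conseq: "wp c Q s t \<Longrightarrow> (\<And>s' t'. Q s' t' \<Longrightarrow> Q' s' t') \<Longrightarrow> wp c Q' s t"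
  unfolding wp_def by blast

lemma wp_Skip: "Q s (t + 1) \<Longrightarrow> wp Skip Q s t"
  unfolding wp_def using runs_Skip by blast

lemma wp_Store:
  "Q (s(aval a s := aval b s)) (t + (ucost a s + ucost b s + 1)) \<Longrightarrow> wp (Store a b) Q s t"
  unfolding wp_def using runs_Store by blast

lemma wp_Seq: "wp c1 (wp c2 Q) s t \<Longrightarrow> wp (Seq c1 c2) Q s t"
proof -
  assume "wp c1 (wp c2 Q) s t"
  then obtain s1 k1 s2 k2 where "runs c1 s k1 s1" "runs c2 s1 k2 s2" "Q s2 (t + k1 + k2)"
    unfolding wp_def by blast
  then show ?thesis unfolding wp_def using runs_Seq[of c1 s k1 s1 c2 k2 s2] by (auto simp: add.assoc)
qed

lemma wp_If:
  assumes "aval e s \<noteq> 0 \<Longrightarrow> wp c1 Q s (t + (ucost e s + 1))"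
    and "aval e s = 0 \<Longrightarrow> wp c2 Q s (t + (ucost e s + 1))"
  shows "wp (If_nz e c1 c2) Q s t"
proof -
  have "wp (if aval e s \<noteq> 0 then c1 else c2) Q s (t + (ucost e s + 1))" using assms by simp
  then obtain s' k where "runs (if aval e s \<noteq> 0 then c1 else c2) s k s'"
    "Q s' (t + (ucost e s + 1) + k)" unfolding wp_def by blast
  then show ?thesis unfolding wp_def using runs_If[of e s c1 c2 k s'] by (auto simp only: add.assoc)
qed

lemma wp_While:
  assumes "I m s"
    and cost: "\<And>m s. I m s \<Longrightarrow> ucost e s \<le> E"
    and body: "\<And>m s t. I m s \<Longrightarrow> aval e s \<noteq> 0 \<Longrightarrow>
      wp c (\<lambda>s' t'. t' \<le> t + K \<and> (\<exists>m'<m. I m' s')) s t"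
    and Q: "\<And>m' s' t'. I m' s' \<Longrightarrow> aval e s' = 0 \<Longrightarrow> t' \<le> t + (m + 1) * (K + E + 1) \<Longrightarrow> Q s' t'"
  shows "wp (While_nz e c) Q s t"
proof -
  have "\<exists>s' k m'. runs (While_nz e c) s k s' \<and> k \<le> (m + 1) * (K + E + 1) \<and> I m' s' \<and> aval e s' = 0"
    using assms(1)
  proof (induction m arbitrary: s rule: less_induct)
    case (less m)
    note E = cost[OF less.prems]
    show ?case
    proof (cases "aval e s = 0")
      case True
      have "ucost e s + 1 \<le> (m + 1) * (K + E + 1)" using E by simp
      then show ?thesis using runs_While_false[OF True] less.prems True by blast
    next
      case False
      obtain s1 k1 m1 where 1: "runs c s k1 s1" "k1 \<le> K" "m1 < m" "I m1 s1"
        using body[OF less.prems False, of 0] unfolding wp_def by auto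
      obtain s2 k2 m2 where 2: "runs (While_nz e c) s1 k2 s2" "k2 \<le> (m1 + 1) * (K + E + 1)"
        "I m2 s2" "aval e s2 = 0"
        using less.IH[OF 1(3,4)] by blast
      have "(m1 + 1) * (K + E + 1) \<le> m * (K + E + 1)" using 1(3) by (intro mult_right_mono) auto
      then have "ucost e s + 1 + k1 + k2 \<le> (m + 1) * (K + E + 1)" using E 1(2) 2(2) by simp
      then show ?thesis using runs_While_true[OF False 1(1) 2(1)] 2(3,4) by blast
    qed
  qed
  then obtain s' k m' where "runs (While_nz e c) s k s'" "k \<le> (m + 1) * (K + E + 1)" "I m' s'"
    "aval e s' = 0" by blast
  then show ?thesis unfolding wp_def using Q[of m' s' "t + k"] by auto
qed

text \<open>
  The memory is viewed as sixteen arrays, array \<open>c\<close> occupying the addresses congruent to \<open>c\<close>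
  modulo 16.  Array 0 serves as the register file.
\<close>

definition get :: "nat \<Rightarrow> mem \<Rightarrow> nat \<Rightarrow> nat" where
  "get c s i = s (i * 16 + c)"

definition put :: "nat \<Rightarrow> nat \<Rightarrow> nat \<Rightarrow> mem \<Rightarrow> mem" where
  "put c i v s = s(i * 16 + c := v)"

lemma address_eq_iff:
  assumes "c < 16" "d < 16"
  shows "i * 16 + c = j * 16 + d \<longleftrightarrow> i = j \<and> c = (d :: nat)"
proof
  assume eq: "i * 16 + c = j * 16 + d"
  have "(i * 16 + c) mod 16 = c" "(j * 16 + d) mod 16 = d" using assms by simp_all
  then show "i = j \<and> c = d" using eq by simp
qed simp

lemma get_put [simp]:
  "c < 16 \<Longrightarrow> d < 16 \<Longrightarrow> get c (put d j v s) = (if c = d then (get c s)(j := v) else get c s)"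
  by (auto simp: get_def put_def fun_eq_iff address_eq_iff)

definition arr :: "nat \<Rightarrow> aexp \<Rightarrow> aexp" where
  "arr c e = Mem (Add (Mul e (Const 16)) (Const c))"

abbreviation reg :: "nat \<Rightarrow> aexp" where
  "reg r \<equiv> arr 0 (Const r)"

definition set_arr :: "nat \<Rightarrow> aexp \<Rightarrow> aexp \<Rightarrow> com" where
  "set_arr c e v = Store (Add (Mul e (Const 16)) (Const c)) v"

abbreviation set_reg :: "nat \<Rightarrow> aexp \<Rightarrow> com" where
  "set_reg r v \<equiv> set_arr 0 (Const r) v"

lemma aval_arr [simp]: "aval (arr c e) s = get c s (aval e s)"
  by (simp add: arr_def get_def)

lemma ucost_arr [simp]: "ucost (arr c e) s = ucost e s + c + 26"
  by (simp add: arr_def bits_16)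

lemma wp_set_arr:
  "Q (put c (aval e s) (aval v s) s) (t + (ucost e s + ucost v s + c + 26)) \<Longrightarrow>
     wp (set_arr c e v) Q s t"
  unfolding set_arr_def by (rule wp_Store) (simp add: put_def bits_16 algebra_simps)

definition for_loop :: "nat \<Rightarrow> aexp \<Rightarrow> com \<Rightarrow> com" where
  "for_loop r e c = Seq (set_reg r (Const 0))
     (While_nz (Sub e (reg r)) (Seq c (set_reg r (Add (reg r) (Const 1)))))"

lemma wp_for_loop:
  assumes I0: "I 0 (put 0 r 0 s)"
    and bound: "\<And>k s. k \<le> N \<Longrightarrow> I k s \<Longrightarrow> get 0 s r = k \<Longrightarrow> aval e s = N \<and> ucost e s \<le> E"
    and body: "\<And>k s t. k < N \<Longrightarrow> I k s \<Longrightarrow> get 0 s r = k \<Longrightarrow>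
      wp c (\<lambda>s' t'. t' \<le> t + K \<and> get 0 s' r = k \<and> I (Suc k) (put 0 r (Suc k) s')) s t"
    and Q: "\<And>s' t'. I N s' \<Longrightarrow> get 0 s' r = N \<Longrightarrow>
      t' \<le> t + (N + 2) * (K + E + 3 * r + 200) \<Longrightarrow> Q s' t'"
  shows "wp (for_loop r e c) Q s t"
  unfolding for_loop_def
proof (rule wp_Seq, rule wp_set_arr)
  let ?J = "\<lambda>m s. \<exists>k\<le>N. m = N - k \<and> I k s \<and> get 0 s r = k"
  let ?t = "t + (ucost (Const r) s + ucost (Const 0) s + 0 + 26)"
  show "wp (While_nz (Sub e (reg r)) (Seq c (set_reg r (Add (reg r) (Const 1))))) Q
     (put 0 (aval (Const r) s) (aval (Const 0) s) s) ?t"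
  proof (rule wp_While[where I = ?J and m = N and E = "E + r + 28" and K = "K + 2 * r + 100"])
    show "?J N (put 0 (aval (Const r) s) (aval (Const 0) s) s)"
      using I0 by (intro exI[of _ 0]) simp
  next
    fix m s assume "?J m s"
    then show "ucost (Sub e (reg r)) s \<le> E + r + 28" using bound[of _ s] by auto
  next
    fix m s t assume "?J m s" and nz: "aval (Sub e (reg r)) s \<noteq> 0"
    then obtain k where k: "k \<le> N" "m = N - k" "I k s" "get 0 s r = k" by auto
    then have kN: "k < N" using bound[of k s] nz by auto
    show "wp (Seq c (set_reg r (Add (reg r) (Const 1))))
       (\<lambda>s' t'. t' \<le> t + (K + 2 * r + 100) \<and> (\<exists>m'<m. ?J m' s')) s t"
    proof (rule wp_Seq, rule wp_conseq[OF body[OF kN k(3,4)]], rule wp_set_arr)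
      fix s' t' assume post: "t' \<le> t + K \<and> get 0 s' r = k \<and> I (Suc k) (put 0 r (Suc k) s')"
      have "?J (N - Suc k) (put 0 r (Suc k) s')" using post kN by (intro exI[of _ "Suc k"]) simp
      moreover have "N - Suc k < m" using kN k(2) by simp
      ultimately have "\<exists>m'<m. ?J m' (put 0 r (Suc k) s')" by blast
      then show "t' + (ucost (Const r) s' + ucost (Add (reg r) (Const 1)) s' + 0 + 26)
          \<le> t + (K + 2 * r + 100) \<and>
        (\<exists>m'<m. ?J m' (put 0 (aval (Const r) s') (aval (Add (reg r) (Const 1)) s') s'))"
        using post by simp
    qed
  next
    fix m' s' t' assume J: "?J m' s'" and z: "aval (Sub e (reg r)) s' = 0"
      and t': "t' \<le> ?t + (N + 1) * (K + 2 * r + 100 + (E + r + 28) + 1)"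
    from J z bound have "I N s'" "get 0 s' r = N" by (auto simp: le_antisym)
    moreover have "t' \<le> t + (N + 2) * (K + E + 3 * r + 200)"
      using t' by (simp add: algebra_simps)
    ultimately show "Q s' t'" by (rule Q)
  qed
qed

text \<open>\<open>A\<close> and \<open>R\<close> are the arrays and registers that may differ.\<close>

definition same :: "nat set \<Rightarrow> nat set \<Rightarrow> mem \<Rightarrow> mem \<Rightarrow> bool" where
  "same A R s s' \<longleftrightarrow> (\<forall>c<16. c \<noteq> 0 \<longrightarrow> c \<notin> A \<longrightarrow> get c s = get c s') \<and>
     (\<forall>r. r \<notin> R \<longrightarrow> get 0 s r = get 0 s' r)"

lemma same_refl [simp]: "same A R s s"
  by (simp add: same_def)

lemma same_trans: "same A R s s' \<Longrightarrow> same A R s' s'' \<Longrightarrow> same A R s s''"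
  by (simp add: same_def)

lemma same_mono: "same A R s s' \<Longrightarrow> A \<subseteq> A' \<Longrightarrow> R \<subseteq> R' \<Longrightarrow> same A' R' s s'"
  by (auto simp: same_def)

lemma same_get: "same A R s s' \<Longrightarrow> c < 16 \<Longrightarrow> c \<noteq> 0 \<Longrightarrow> c \<notin> A \<Longrightarrow> get c s = get c s'"
  by (simp add: same_def)

lemma same_reg: "same A R s s' \<Longrightarrow> r \<notin> R \<Longrightarrow> get 0 s r = get 0 s' r"
  by (simp add: same_def)

lemma same_put [simp]:
  "c < 16 \<Longrightarrow> c \<noteq> 0 \<Longrightarrow> c \<in> A \<Longrightarrow> same A R (put c i v s) s' \<longleftrightarrow> same A R s s'"
  "r \<in> R \<Longrightarrow> same A R (put 0 r v s) s' \<longleftrightarrow> same A R s s'"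
  by (auto simp: same_def)

section \<open>Reading the input\<close>

lemma rat_quotient:
  assumes "0 \<le> r"
  shows "r = of_nat (nat (fst (quotient_of r))) / of_nat (nat (snd (quotient_of r)))"
    and "0 < nat (snd (quotient_of r))" and "nat (fst (quotient_of r)) = 0 \<longleftrightarrow> r = 0"
proof -
  obtain p q where pq: "quotient_of r = (p, q)" by (cases "quotient_of r")
  have q: "0 < q" using quotient_of_denom_pos[OF pq] .
  have r: "r = of_int p / of_int q" using quotient_of_div[OF pq] .
  have p: "0 \<le> p" using assms q unfolding r by (simp add: zero_le_divide_iff)
  have "of_nat (nat p) / of_nat (nat q) = r" using p q r by simp
  then show "r = of_nat (nat (fst (quotient_of r))) / of_nat (nat (snd (quotient_of r)))"
    by (simp add: pq)
  show "0 < nat (snd (quotient_of r))" using q by (simp add: pq)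
  have "r = 0 \<longleftrightarrow> p = 0" using r q by simp
  then show "nat (fst (quotient_of r)) = 0 \<longleftrightarrow> r = 0" using p by (simp add: pq)
qed

lemma enc_rats_length: "length (concat (map enc_rat xs)) = 2 * length xs"
  by (induction xs) (auto simp: enc_rat_def)

lemma enc_rats_nth:
  assumes "j < length xs"
  shows "concat (map enc_rat xs) ! (2 * j) = nat (fst (quotient_of (xs ! j)))"
    "concat (map enc_rat xs) ! Suc (2 * j) = nat (snd (quotient_of (xs ! j)))"
  using assms
proof (induction xs arbitrary: j)
  case (Cons x xs)
  {
    case 1
    then show ?case using Cons(1)[of "j - 1"] by (cases j) (auto simp: enc_rat_def)
  next
    case 2
    then show ?case using Cons(2)[of "j - 1"] by (cases j) (auto simp: enc_rat_def)
  }
qed auto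

definition form_at :: "snf \<Rightarrow> mem \<Rightarrow> nat \<Rightarrow> bool" where
  "form_at e s p \<longleftrightarrow> (\<forall>l<length (enc_snf e). get 9 s (p + l) = enc_snf e ! l)"

lemma form_at_FormL:
  assumes "form_at (FormL a0 as) s p"
  shows "get 9 s p = 0"
    and "\<And>j. j \<le> length as \<Longrightarrow>
      get 9 s (Suc (p + 2 * j)) = nat (fst (quotient_of ((a0 # as) ! j)))"
    and "\<And>j. j \<le> length as \<Longrightarrow>
      get 9 s (Suc (Suc (p + 2 * j))) = nat (snd (quotient_of ((a0 # as) ! j)))"
proof -
  have enc: "enc_snf (FormL a0 as) = 0 # concat (map enc_rat (a0 # as))" by simp
  have len: "length (enc_snf (FormL a0 as)) = Suc (2 * Suc (length as))"
    unfolding enc by (simp only: list.size(4) enc_rats_length) simp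
  have g: "get 9 s (p + l) = (0 # concat (map enc_rat (a0 # as))) ! l"
    if "l < Suc (2 * Suc (length as))" for l
    unfolding enc[symmetric] using assms that len by (simp only: form_at_def)
  show "get 9 s p = 0" using g[of 0] by simp
  fix j assume j: "j \<le> length as"
  have "Suc (2 * j) < Suc (2 * Suc (length as))" using j by simp
  from g[OF this] have "get 9 s (p + Suc (2 * j)) = concat (map enc_rat (a0 # as)) ! (2 * j)"
    by (simp only: nth_Cons_Suc)
  then show "get 9 s (Suc (p + 2 * j)) = nat (fst (quotient_of ((a0 # as) ! j)))"
    using enc_rats_nth(1)[of j "a0 # as"] j by simp
  have "Suc (Suc (2 * j)) < Suc (2 * Suc (length as))" using j by simp
  from g[OF this]
  have "get 9 s (p + Suc (Suc (2 * j))) = concat (map enc_rat (a0 # as)) ! Suc (2 * j)"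
    by (simp only: nth_Cons_Suc)
  then show "get 9 s (Suc (Suc (p + 2 * j))) = nat (snd (quotient_of ((a0 # as) ! j)))"
    using enc_rats_nth(2)[of j "a0 # as"] j by simp
qed

lemma form_at_binary:
  "form_at (FormQ j k) s p \<longleftrightarrow> get 9 s p = 1 \<and> get 9 s (Suc p) = j \<and> get 9 s (Suc (Suc p)) = k"
  "form_at (FormMax j k) s p \<longleftrightarrow> get 9 s p = 2 \<and> get 9 s (Suc p) = j \<and> get 9 s (Suc (Suc p)) = k"
  "form_at (FormMin j k) s p \<longleftrightarrow> get 9 s p = 3 \<and> get 9 s (Suc p) = j \<and> get 9 s (Suc (Suc p)) = k"
  by (simp_all add: form_at_def All_less_Suc2)

lemma form_at_cong: "get 9 s = get 9 s' \<Longrightarrow> form_at e s p \<longleftrightarrow> form_at e s' p"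
  by (simp add: form_at_def)

text \<open>Registers: 11 = number of variables, 2 = program counter of the procedure, 3 and 4 = loop
  counters, 5 = found index plus one, 6 = output position, 7 = truth value, 8 = input position,
  9 and 10 = numerator and denominator.  Arrays: 9 = input, 2 = output, 3 = positions of the
  equations in the input, 4 = \<open>S\<close>, 5 = \<open>F\<close>, 6 and 7 = membership in the initial sets of
  steps 1 and 3, 8 = policy.\<close>

definition coef_body :: com where
  "coef_body =
    Seq (set_reg 9 (Add (Mul (reg 9) (arr 9 (Add (reg 8) (Const 1)))) (Mul (reg 10) (arr 9 (reg 8)))))
    (Seq (set_reg 10 (Mul (reg 10) (arr 9 (Add (reg 8) (Const 1)))))
    (set_reg 8 (Add (reg 8) (Const 2))))"

definition parse_form :: com where
  "parse_form =
    Seq (set_arr 3 (reg 3) (reg 8))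
    (If_nz (arr 9 (reg 8))
      (Seq (set_arr 6 (reg 3) (Const 0))
      (Seq (set_arr 7 (reg 3) (Sub (Const 2) (arr 9 (reg 8))))
      (set_reg 8 (Add (reg 8) (Const 3)))))
      (Seq (set_arr 6 (reg 3) (arr 9 (Add (reg 8) (Const 1))))
      (Seq (set_reg 9 (Const 0))
      (Seq (set_reg 10 (Const 1))
      (Seq (set_reg 8 (Add (reg 8) (Const 1)))
      (Seq (for_loop 4 (Add (reg 11) (Const 1)) coef_body)
      (set_arr 7 (reg 3) (Sub (reg 10) (reg 9)))))))))"

lemmas wp_intros = wp_Seq wp_set_arr wp_Skip wp_If

lemma wp_coef_loop:
  assumes bits: "\<And>x. bits (get 9 s x) \<le> B"
    and s: "get 0 s 9 = 0" "get 0 s 10 = 1" "get 0 s 8 = p" "get 0 s 11 = n"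
    and len: "length cs = Suc n" and nonneg: "\<And>c. c \<in> set cs \<Longrightarrow> 0 \<le> c"
    and num: "\<And>j. j \<le> n \<Longrightarrow> get 9 s (p + 2 * j) = nat (fst (quotient_of (cs ! j)))"
    and den: "\<And>j. j \<le> n \<Longrightarrow> get 9 s (Suc (p + 2 * j)) = nat (snd (quotient_of (cs ! j)))"
  shows "wp (for_loop 4 (Add (reg 11) (Const 1)) coef_body)
    (\<lambda>s' t'. t' \<le> t + (n + 3) * (3 * B + 2000) \<and> same {} {4, 8, 9, 10} s' s \<and>
      get 0 s' 8 = p + 2 * Suc n \<and>
      (get 0 s' 9 < get 0 s' 10 \<longleftrightarrow> (\<Sum>l<Suc n. cs ! l) < 1)) s t"
proof (rule wp_for_loop[where N = "Suc n" and E = 50 and K = "3 * B + 1500" and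
    I = "\<lambda>k s'. same {} {4, 8, 9, 10} s' s \<and> get 0 s' 8 = p + 2 * k \<and> 0 < get 0 s' 10 \<and>
      rat_of_nat (get 0 s' 9) = (\<Sum>l<k. cs ! l) * of_nat (get 0 s' 10)"])
  fix k s' t
  assume k: "k < Suc n" and k4: "get 0 s' 4 = k"
    and I: "same {} {4, 8, 9, 10} s' s \<and> get 0 s' 8 = p + 2 * k \<and> 0 < get 0 s' 10 \<and>
      rat_of_nat (get 0 s' 9) = (\<Sum>l<k. cs ! l) * of_nat (get 0 s' 10)"
  then have sm: "same {} {4, 8, 9, 10} s' s" by simp
  note eqs = same_get[OF sm] same_reg[OF sm]
  define nu de where nd: "nu = nat (fst (quotient_of (cs ! k)))" "de = nat (snd (quotient_of (cs ! k)))"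
  have inn: "get 9 s (p + 2 * k) = nu" "get 9 s (Suc (p + 2 * k)) = de" using num den k by (auto simp: nd)
  have b: "bits nu \<le> B" "bits de \<le> B" using bits[of "p + 2 * k"] bits[of "Suc (p + 2 * k)"] inn by simp_all
  have ck: "0 \<le> cs ! k" using nonneg len k by simp
  note q = rat_quotient[OF ck, folded nd]
  have "cs ! k * of_nat de = of_nat nu" by (subst q(1)) (use q(2) in simp)
  then have "rat_of_nat (get 0 s' 9 * de + get 0 s' 10 * nu)
    = (\<Sum>l<Suc k. cs ! l) * of_nat (get 0 s' 10 * de)"
    using I by (simp add: algebra_simps)
  then show "wp coef_body (\<lambda>s'' t'. t' \<le> t + (3 * B + 1500) \<and> get 0 s'' 4 = k \<and>
      same {} {4, 8, 9, 10} (put 0 4 (Suc k) s'') s \<and>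
      get 0 (put 0 4 (Suc k) s'') 8 = p + 2 * Suc k \<and> 0 < get 0 (put 0 4 (Suc k) s'') 10 \<and>
      rat_of_nat (get 0 (put 0 4 (Suc k) s'') 9) =
        (\<Sum>l<Suc k. cs ! l) * of_nat (get 0 (put 0 4 (Suc k) s'') 10)) s' t"
    unfolding coef_body_def
    apply (intro wp_intros)
    using I b q(2) k4 by (simp add: eqs inn)
next
  fix s' t' assume I: "same {} {4, 8, 9, 10} s' s \<and> get 0 s' 8 = p + 2 * Suc n \<and> 0 < get 0 s' 10 \<and>
      rat_of_nat (get 0 s' 9) = (\<Sum>l<Suc n. cs ! l) * of_nat (get 0 s' 10)"
    and t': "t' \<le> t + (Suc n + 2) * (3 * B + 1500 + 50 + 3 * 4 + 200)"
  let ?c = "\<Sum>l<Suc n. cs ! l"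
  have "get 0 s' 9 < get 0 s' 10 \<longleftrightarrow> rat_of_nat (get 0 s' 9) < rat_of_nat (get 0 s' 10)"
    by simp
  also have "\<dots> \<longleftrightarrow> ?c * rat_of_nat (get 0 s' 10) < 1 * rat_of_nat (get 0 s' 10)"
    using I by (simp only: mult_1)
  also have "\<dots> \<longleftrightarrow> ?c < 1" using I by (subst mult_less_cancel_right_pos) auto
  finally have "get 0 s' 9 < get 0 s' 10 \<longleftrightarrow> ?c < 1" .
  moreover have "(Suc n + 2) * (3 * B + 1500 + 50 + 3 * 4 + 200) \<le> (n + 3) * (3 * B + 2000)"
    by (intro mult_mono) auto
  ultimately show "t' \<le> t + (n + 3) * (3 * B + 2000) \<and> same {} {4, 8, 9, 10} s' s \<and>
      get 0 s' 8 = p + 2 * Suc n \<and> (get 0 s' 9 < get 0 s' 10 \<longleftrightarrow> ?c < 1)"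
    using I t' by linarith
next
  fix k s'
  assume "same {} {4, 8, 9, 10} s' s \<and> get 0 s' 8 = p + 2 * k \<and> 0 < get 0 s' 10 \<and>
      rat_of_nat (get 0 s' 9) = (\<Sum>l<k. cs ! l) * of_nat (get 0 s' 10)"
  then have sm: "same {} {4, 8, 9, 10} s' s" by simp
  show "aval (Add (reg 11) (Const 1)) s' = Suc n \<and> ucost (Add (reg 11) (Const 1)) s' \<le> 50"
    using s by (simp add: same_reg[OF sm])
next
  show "same {} {4, 8, 9, 10} (put 0 4 0 s) s \<and> get 0 (put 0 4 0 s) 8 = p + 2 * 0 \<and>
    0 < get 0 (put 0 4 0 s) 10 \<and>
    rat_of_nat (get 0 (put 0 4 0 s) 9) = (\<Sum>l<0. cs ! l) * of_nat (get 0 (put 0 4 0 s) 10)"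
    using s by simp
qed

definition form_flags :: "snf \<Rightarrow> nat \<Rightarrow> nat \<Rightarrow> bool" where
  "form_flags e z w \<longleftrightarrow> (z \<noteq> 0 \<longleftrightarrow> 0 < eval e (\<lambda>_. 0)) \<and>
     (w \<noteq> 0 \<longleftrightarrow> eval e (\<lambda>_. 1) < 1 \<or> is_FormQ e)"

lemma wp_parse_form:
  assumes ok: "snf_ok n e" and s: "get 0 s 3 = i" "get 0 s 11 = n" "get 0 s 8 = p"
    and form: "form_at e s p" and bits: "\<And>x. bits (get 9 s x) \<le> B"
  shows "wp parse_form (\<lambda>s' t'. t' \<le> t + (n + 4) * (3 * B + 2000) \<and>
    same {3, 6, 7} {4, 8, 9, 10} s' s \<and> get 3 s' = (get 3 s)(i := p) \<and>
    get 0 s' 8 = p + length (enc_snf e) \<and>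
    form_flags e (get 6 s' i) (get 7 s' i) \<and>
    (\<forall>l. l \<noteq> i \<longrightarrow> get 6 s' l = get 6 s l \<and> get 7 s' l = get 7 s l)) s t"
proof (cases e)
  case (FormL a0 as)
  note f = form_at_FormL[OF form[unfolded FormL]]
  have n: "length as = n" and a0: "0 \<le> a0" and as: "\<And>a. a \<in> set as \<Longrightarrow> 0 \<le> a"
    using ok FormL by auto
  have z: "get 9 s (Suc p) \<noteq> 0 \<longleftrightarrow> 0 < eval e (\<lambda>_. 0)"
    using f(2)[of 0] rat_quotient(3)[OF a0] a0 FormL by auto
  have sum: "(\<Sum>l<Suc n. (a0 # as) ! l) = a0 + sum_list as"
    unfolding sum.lessThan_Suc_shift n[symmetric] by (simp add: sum_list_sum_nth atLeast0LessThan)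
  have "eval e (\<lambda>_. 1) = of_rat (a0 + sum_list as)"
    by (simp add: FormL of_rat_add of_rat_sum sum_list_sum_nth atLeast0LessThan)
  then have w: "eval e (\<lambda>_. 1) < 1 \<longleftrightarrow> (\<Sum>l<Suc n. (a0 # as) ! l) < 1"
    unfolding sum by (simp only: of_rat_less_1_iff)
  have len: "length (enc_snf e) = 3 + 2 * n"
    using FormL n enc_rats_length[of as] by (simp add: enc_rat_def)
  show ?thesis
    unfolding parse_form_def
    apply (intro wp_intros)
    subgoal using s f(1) by simp
    apply (rule wp_conseq[OF wp_coef_loop[where B = B and cs = "a0 # as" and p = "Suc p" and n = n]])
    subgoal using bits by simp
    subgoal by simp
    subgoal by simp
    subgoal using s by simp
    subgoal using s by simp
    subgoal using n by simp
    subgoal using a0 as by auto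
    subgoal using f(2) n by simp
    subgoal using f(3) n by simp
    subgoal premises prems for s' t'
    proof -
      from prems(2) have sm: "same {} {4, 8, 9, 10} s'
        (put 0 8 (Suc p) (put 0 10 1 (put 0 9 0 (put 6 i (get 9 s (Suc p)) (put 3 i p s)))))"
        using s by simp
      note eqs = same_get[OF sm] same_reg[OF sm]
      have sm': "same {3, 6, 7} {4, 8, 9, 10} s' s"
        using same_mono[OF sm, of "{3, 6, 7}" "{4, 8, 9, 10}"] by (auto simp: same_def)
      have post: "t' \<le> t + 449 + (n + 3) * (3 * B + 2000)" "get 0 s' 8 = Suc p + 2 * Suc n"
        "get 0 s' 9 < get 0 s' 10 \<longleftrightarrow> (\<Sum>l<Suc n. (a0 # as) ! l) < 1"
        using prems(2) by simp_all
      have ff: "form_flags e (get 9 s (Suc p)) (get 0 s' 10 - get 0 s' 9)"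
        using z w post(3) FormL by (auto simp: form_flags_def not_le)
      have "(n + 4) * (3 * B + 2000) = (n + 3) * (3 * B + 2000) + (3 * B + 2000)"
        by (simp add: algebra_simps)
      then have tm: "t' + 137 \<le> t + (n + 4) * (3 * B + 2000)" using post(1) by linarith
      show ?thesis
        apply (intro wp_intros conjI)
        using tm sm' s len post(2) ff by (simp_all add: eqs)
    qed
    done
next
  have nl: ?thesis if "get 9 s p = d" "d \<in> {1, 2, 3}" "length (enc_snf e) = 3" "form_flags e 0 (2 - d)" for d
    unfolding parse_form_def
    apply (intro wp_intros conjI)
    using that s by (auto simp: algebra_simps)
  {
    case (FormQ j k)
    then show ?thesis using form by (intro nl[of 1]) (auto simp: form_at_binary form_flags_def)
  next
    case (FormMax j k)
    then show ?thesis using form by (intro nl[of 2]) (auto simp: form_at_binary form_flags_def)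
  next
    case (FormMin j k)
    then show ?thesis using form by (intro nl[of 3]) (auto simp: form_at_binary form_flags_def)
  }
qed

lemma loop_cost: "a \<le> c \<Longrightarrow> b \<le> c \<Longrightarrow> (n + 2) * a + b \<le> (n + 3) * (c :: nat)"
  using mult_le_mono2[of a c "n + 2"] by (simp add: algebra_simps)

definition offset :: "pps \<Rightarrow> nat \<Rightarrow> nat" where
  "offset P i = 2 + length (concat (map enc_snf (take i P)))"

lemma offset_0: "offset P 0 = 2"
  by (simp add: offset_def)

lemma offset_Suc: "i < length P \<Longrightarrow> offset P (Suc i) = offset P i + length (enc_snf (P ! i))"
  by (simp add: offset_def take_Suc_conv_app_nth)

definition input_at :: "nat list \<Rightarrow> mem \<Rightarrow> bool" where
  "input_at xs s \<longleftrightarrow> (\<forall>l<length xs. get 9 s (Suc l) = xs ! l)"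

lemma input_form_at:
  assumes "input_at (enc_pps P) s" "i < length P"
  shows "form_at (P ! i) s (offset P i)"
  unfolding form_at_def
proof (intro allI impI)
  fix l assume l: "l < length (enc_snf (P ! i))"
  define pre where "pre = length P # concat (map enc_snf (take i P))"
  define post where "post = concat (map enc_snf (drop (Suc i) P))"
  have "concat (map enc_snf P)
    = concat (map enc_snf (take i P)) @ enc_snf (P ! i) @ post"
    by (subst id_take_nth_drop[OF assms(2)]) (simp add: post_def)
  then have enc: "enc_pps P = pre @ enc_snf (P ! i) @ post"
    by (simp add: enc_pps_def pre_def)
  have "length pre + l < length (enc_pps P)" using l by (simp add: enc)
  then have "get 9 s (Suc (length pre + l)) = enc_pps P ! (length pre + l)"
    using assms(1) by (simp add: input_at_def)
  also have "\<dots> = enc_snf (P ! i) ! l" using l by (simp add: enc nth_append)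
  also have "Suc (length pre + l) = offset P i + l" by (simp add: pre_def offset_def)
  finally show "get 9 s (offset P i + l) = enc_snf (P ! i) ! l" .
qed

definition parsed :: "pps \<Rightarrow> mem \<Rightarrow> bool" where
  "parsed P s \<longleftrightarrow> get 0 s 11 = length P \<and>
     (\<forall>i<length P. form_at (P ! i) s (get 3 s i) \<and> form_flags (P ! i) (get 6 s i) (get 7 s i))"

lemma parsed_same:
  assumes "parsed P s" "same A R s' s" "A \<inter> {3, 6, 7, 9} = {}" "11 \<notin> R"
  shows "parsed P s'"
proof -
  have "get 3 s' = get 3 s" "get 6 s' = get 6 s" "get 7 s' = get 7 s" "get 9 s' = get 9 s"
    using assms(3) by (auto intro!: same_get[OF assms(2)])
  then show ?thesis
    using assms(1) same_reg[OF assms(2,4)] form_at_cong[of s' s] by (simp add: parsed_def)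
qed

definition parse_prog :: com where
  "parse_prog = Seq (set_reg 11 (arr 9 (Const 1)))
    (Seq (set_reg 8 (Const 2)) (for_loop 3 (reg 11) parse_form))"

lemma wp_parse_prog:
  assumes P: "max_min_pps P" and inp: "input_at (enc_pps P) s"
    and bits: "\<And>x. bits (get 9 s x) \<le> B"
  shows "wp parse_prog (\<lambda>s' t'. t' \<le> t + (length P + 3) * ((length P + 4) * (3 * B + 2000) + 500)
    \<and> parsed P s') s t"
proof -
  let ?n = "length P"
  let ?K = "(?n + 4) * (3 * B + 2000)"
  have n: "get 9 s (Suc 0) = ?n" using inp by (simp add: input_at_def enc_pps_def)
  define s1 where "s1 = put 0 8 2 (put 0 11 ?n s)"
  have inp1: "input_at (enc_pps P) s1" using inp by (simp add: input_at_def s1_def)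
  have bits1: "bits (get 9 s1 x) \<le> B" for x using bits by (simp add: s1_def)
  have n1: "get 0 s1 11 = ?n" by (simp add: s1_def)
  let ?I = "\<lambda>k s'. same {3, 6, 7} {3, 4, 8, 9, 10} s' s1 \<and> get 0 s' 8 = offset P k \<and>
    (\<forall>i<k. get 3 s' i = offset P i \<and> form_flags (P ! i) (get 6 s' i) (get 7 s' i))"
  show ?thesis
    unfolding parse_prog_def
  proof (intro wp_intros, rule wp_for_loop[where I = ?I and N = ?n and E = 50 and K = ?K])
    fix k s' t assume k: "k < ?n" and I: "?I k s'" and k3: "get 0 s' 3 = k"
    from I have sm: "same {3, 6, 7} {3, 4, 8, 9, 10} s' s1" by simp
    have eq9: "get 9 s' = get 9 s1" using same_get[OF sm] by simp
    have form: "form_at (P ! k) s' (offset P k)"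
      using input_form_at[OF inp1 k] form_at_cong[OF eq9] by simp
    show "wp parse_form (\<lambda>s'' t'. t' \<le> t + ?K \<and> get 0 s'' 3 = k \<and> ?I (Suc k) (put 0 3 (Suc k) s'')) s' t"
    proof (rule wp_conseq[OF wp_parse_form[where p = "offset P k" and B = B and i = k]])
      show "snf_ok ?n (P ! k)" by (rule max_min_ppsD[OF P k])
      show "get 0 s' 3 = k" by fact
      show "get 0 s' 11 = ?n" using same_reg[OF sm] n1 by simp
      show "get 0 s' 8 = offset P k" using I by simp
      show "form_at (P ! k) s' (offset P k)" by fact
      show "bits (get 9 s' x) \<le> B" for x using bits1 eq9 by simp
    next
      fix s'' t'
      assume Q: "t' \<le> t + ?K \<and> same {3, 6, 7} {4, 8, 9, 10} s'' s' \<and>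
        get 3 s'' = (get 3 s')(k := offset P k) \<and> get 0 s'' 8 = offset P k + length (enc_snf (P ! k)) \<and>
        form_flags (P ! k) (get 6 s'' k) (get 7 s'' k) \<and>
        (\<forall>l. l \<noteq> k \<longrightarrow> get 6 s'' l = get 6 s' l \<and> get 7 s'' l = get 7 s' l)"
      then have sm2: "same {3, 6, 7} {4, 8, 9, 10} s'' s'" by simp
      have "same {3, 6, 7} {3, 4, 8, 9, 10} s'' s1"
        by (rule same_trans[OF same_mono[OF sm2] sm]) auto
      moreover have "get 0 s'' 3 = k" using same_reg[OF sm2] k3 by simp
      ultimately show "t' \<le> t + ?K \<and> get 0 s'' 3 = k \<and> ?I (Suc k) (put 0 3 (Suc k) s'')"
        using Q I offset_Suc[OF k] by (auto simp: less_Suc_eq)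
    qed
  next
    fix s' t' assume I: "?I ?n s'"
      and t': "t' \<le> t + (ucost (Const 11) s + ucost (arr 9 (Const 1)) s + 0 + 26) +
       (ucost (Const 8) (put 0 (aval (Const 11) s) (aval (arr 9 (Const 1)) s) s) +
        ucost (Const 2) (put 0 (aval (Const 11) s) (aval (arr 9 (Const 1)) s) s) + 0 + 26) +
       (?n + 2) * (?K + 50 + 3 * 3 + 200)"
    from I have sm: "same {3, 6, 7} {3, 4, 8, 9, 10} s' s1" by simp
    have eq9: "get 9 s' = get 9 s1" using same_get[OF sm] by simp
    have "form_at (P ! i) s' (offset P i)" if "i < ?n" for i
      using input_form_at[OF inp1 that] form_at_cong[OF eq9] by simp
    then have "parsed P s'" using I same_reg[OF sm] n1 by (simp add: parsed_def)
    moreover have "(?n + 2) * (?K + 50 + 3 * 3 + 200) + 200 \<le> (?n + 3) * (?K + 500)"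
      by (rule loop_cost) auto
    ultimately show "t' \<le> t + (?n + 3) * (?K + 500) \<and> parsed P s'" using t' by simp
  next
    show "?I 0 (put 0 3 0 (put 0 (aval (Const 8) (put 0 (aval (Const 11) s) (aval (arr 9 (Const 1)) s) s))
       (aval (Const 2) (put 0 (aval (Const 11) s) (aval (arr 9 (Const 1)) s) s))
       (put 0 (aval (Const 11) s) (aval (arr 9 (Const 1)) s) s)))"
      using n by (simp add: offset_0 flip: s1_def) (simp add: s1_def)
  next
    fix k s' assume "?I k s'"
    then have sm: "same {3, 6, 7} {3, 4, 8, 9, 10} s' s1" by simp
    show "aval (reg 11) s' = ?n \<and> ucost (reg 11) s' \<le> 50"
      using n1 by (simp add: same_reg[OF sm])
  qed
qed

lemma wp_map_loop:
  assumes n: "get 0 s 11 = n" and X: "X < 16" "X \<noteq> 0"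
    and body: "\<And>i s' t. i < n \<Longrightarrow> same {X} {3} s' s \<Longrightarrow> get 0 s' 3 = i \<Longrightarrow> get X s' i = get X s i \<Longrightarrow>
      wp c (\<lambda>s'' t'. t' \<le> t + K \<and> s'' = put X i (v i) s') s' t"
  shows "wp (for_loop 3 (reg 11) c)
    (\<lambda>s' t'. t' \<le> t + (n + 3) * (K + 500) \<and> same {X} {3} s' s \<and> (\<forall>i<n. get X s' i = v i)) s t"
proof (rule wp_for_loop[where N = n and E = 50 and K = K and
    I = "\<lambda>k s'. same {X} {3} s' s \<and> (\<forall>i<k. get X s' i = v i) \<and> (\<forall>i\<ge>k. get X s' i = get X s i)"])
  fix k s' t assume k: "k < n" and k3: "get 0 s' 3 = k"
    and I: "same {X} {3} s' s \<and> (\<forall>i<k. get X s' i = v i) \<and> (\<forall>i\<ge>k. get X s' i = get X s i)"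
  show "wp c (\<lambda>s'' t'. t' \<le> t + K \<and> get 0 s'' 3 = k \<and> same {X} {3} (put 0 3 (Suc k) s'') s \<and>
    (\<forall>i<Suc k. get X (put 0 3 (Suc k) s'') i = v i) \<and>
    (\<forall>i\<ge>Suc k. get X (put 0 3 (Suc k) s'') i = get X s i)) s' t"
    using I X k3 by (intro wp_conseq[OF body[OF k]]) (auto simp: less_Suc_eq)
next
  fix s' t' assume "t' \<le> t + (n + 2) * (K + 50 + 3 * 3 + 200)"
    "same {X} {3} s' s \<and> (\<forall>i<n. get X s' i = v i) \<and> (\<forall>i\<ge>n. get X s' i = get X s i)"
  then show "t' \<le> t + (n + 3) * (K + 500) \<and> same {X} {3} s' s \<and> (\<forall>i<n. get X s' i = v i)"
    using loop_cost[of "K + 50 + 3 * 3 + 200" "K + 500" 0 n] by auto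
next
  fix k s' assume "same {X} {3} s' s \<and> (\<forall>i<k. get X s' i = v i) \<and> (\<forall>i\<ge>k. get X s' i = get X s i)"
  then have sm: "same {X} {3} s' s" by simp
  show "aval (reg 11) s' = n \<and> ucost (reg 11) s' \<le> 50"
    using n by (simp add: same_reg[OF sm])
qed (use X in auto)

section \<open>Writing the output\<close>

definition outs :: "mem \<Rightarrow> nat \<Rightarrow> nat list \<Rightarrow> bool" where
  "outs s b ys \<longleftrightarrow> (\<forall>l<length ys. get 2 s (b + l) = Suc (ys ! l))"

lemma outs_append: "outs s b (xs @ ys) \<longleftrightarrow> outs s b xs \<and> outs s (b + length xs) ys"
proof
  assume l: "outs s b (xs @ ys)"
  have "get 2 s (b + l) = Suc (xs ! l)" if "l < length xs" for l
    using l[unfolded outs_def, rule_format, of l] that by (simp add: nth_append)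
  moreover have "get 2 s (b + length xs + l) = Suc (ys ! l)" if "l < length ys" for l
    using l[unfolded outs_def, rule_format, of "length xs + l"] that by (simp add: add.assoc)
  ultimately show "outs s b xs \<and> outs s (b + length xs) ys" unfolding outs_def by blast
next
  assume r: "outs s b xs \<and> outs s (b + length xs) ys"
  have "get 2 s (b + l) = Suc ((xs @ ys) ! l)" if "l < length (xs @ ys)" for l
  proof (cases "l < length xs")
    case True
    then show ?thesis
      using conjunct1[OF r, unfolded outs_def, rule_format, of l] by (simp add: nth_append)
  next
    case False
    then show ?thesis
      using conjunct2[OF r, unfolded outs_def, rule_format, of "l - length xs"] that
      by (simp add: nth_append)
  qed
  then show "outs s b (xs @ ys)" unfolding outs_def by blast
qed

lemma outs_cong:
  assumes "outs s b ys" "\<And>x. b \<le> x \<Longrightarrow> x < b + length ys \<Longrightarrow> get 2 s' x = get 2 s x"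
  shows "outs s' b ys"
  using assms by (simp add: outs_def)

definition emit_arr :: "nat \<Rightarrow> com" where
  "emit_arr c = for_loop 3 (reg 11)
    (Seq (set_arr 2 (reg 6) (Add (arr c (reg 3)) (Const 1)))
    (set_reg 6 (Add (reg 6) (Const 1))))"

lemma wp_emit_arr:
  assumes c: "c < 16" "c \<noteq> 0" "c \<noteq> 2" and s: "get 0 s 6 = b" "get 0 s 11 = n"
  shows "wp (emit_arr c) (\<lambda>s' t'. t' \<le> t + (n + 3) * 1000 \<and> same {2} {3, 6} s' s \<and>
    get 0 s' 6 = b + n \<and> outs s' b (map (get c s) [0..<n]) \<and> (\<forall>x. x < b \<or> b + n \<le> x \<longrightarrow> get 2 s' x = get 2 s x)) s t"
  unfolding emit_arr_def
proof (rule wp_for_loop[where N = n and E = 50 and K = 500 and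
    I = "\<lambda>k s'. same {2} {3, 6} s' s \<and> get 0 s' 6 = b + k \<and>
      (\<forall>l<k. get 2 s' (b + l) = Suc (get c s l)) \<and> (\<forall>x. x < b \<or> b + n \<le> x \<longrightarrow> get 2 s' x = get 2 s x)"])
  fix k s' t assume k: "k < n" and k3: "get 0 s' 3 = k"
    and I: "same {2} {3, 6} s' s \<and> get 0 s' 6 = b + k \<and>
      (\<forall>l<k. get 2 s' (b + l) = Suc (get c s l)) \<and> (\<forall>x. x < b \<or> b + n \<le> x \<longrightarrow> get 2 s' x = get 2 s x)"
  then have sm: "same {2} {3, 6} s' s" by simp
  have eq: "get c s' = get c s" using same_get[OF sm] c by simp
  show "wp (Seq (set_arr 2 (reg 6) (Add (arr c (reg 3)) (Const 1)))
      (set_reg 6 (Add (reg 6) (Const 1))))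
     (\<lambda>s'' t'. t' \<le> t + 500 \<and> get 0 s'' 3 = k \<and> same {2} {3, 6} (put 0 3 (Suc k) s'') s \<and>
      get 0 (put 0 3 (Suc k) s'') 6 = b + Suc k \<and>
      (\<forall>l<Suc k. get 2 (put 0 3 (Suc k) s'') (b + l) = Suc (get c s l)) \<and>
      (\<forall>x. x < b \<or> b + n \<le> x \<longrightarrow> get 2 (put 0 3 (Suc k) s'') x = get 2 s x)) s' t"
    apply (intro wp_intros)
    using I k k3 c by (auto simp: eq less_Suc_eq)
next
  fix s' t' assume "t' \<le> t + (n + 2) * (500 + 50 + 3 * 3 + 200)"
    "same {2} {3, 6} s' s \<and> get 0 s' 6 = b + n \<and>
      (\<forall>l<n. get 2 s' (b + l) = Suc (get c s l)) \<and> (\<forall>x. x < b \<or> b + n \<le> x \<longrightarrow> get 2 s' x = get 2 s x)"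
  then show "t' \<le> t + (n + 3) * 1000 \<and> same {2} {3, 6} s' s \<and>
    get 0 s' 6 = b + n \<and> outs s' b (map (get c s) [0..<n]) \<and> (\<forall>x. x < b \<or> b + n \<le> x \<longrightarrow> get 2 s' x = get 2 s x)"
    using loop_cost[of "500 + 50 + 3 * 3 + 200" "1000" 0 n] by (auto simp: outs_def)
next
  fix k s' assume "same {2} {3, 6} s' s \<and> get 0 s' 6 = b + k \<and>
      (\<forall>l<k. get 2 s' (b + l) = Suc (get c s l)) \<and> (\<forall>x. x < b \<or> b + n \<le> x \<longrightarrow> get 2 s' x = get 2 s x)"
  then have sm: "same {2} {3, 6} s' s" by simp
  show "aval (reg 11) s' = n \<and> ucost (reg 11) s' \<le> 50"
    using s by (simp add: same_reg[OF sm])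
qed (use s in auto)

definition holds_set :: "nat \<Rightarrow> (nat \<Rightarrow> nat) \<Rightarrow> nat set \<Rightarrow> bool" where
  "holds_set n f A \<longleftrightarrow> (\<forall>i<n. f i = (if i \<in> A then 1 else 0))"

lemma holds_set_enc_set: "holds_set n f A \<Longrightarrow> map f [0..<n] = enc_set n A"
  by (simp add: holds_set_def enc_set_def)

definition emit_config :: com where
  "emit_config = Seq (set_arr 2 (reg 6) (Add (reg 2) (Const 1)))
    (Seq (set_reg 6 (Add (reg 6) (Const 1))) (Seq (emit_arr 4) (emit_arr 5)))"

lemma wp_emit_config:
  assumes s: "get 0 s 6 = b" "get 0 s 11 = n" "get 0 s 2 = enc_control pc"
    and S: "holds_set n (get 4 s) S" and F: "holds_set n (get 5 s) F"
  shows "wp emit_config (\<lambda>s' t'. t' \<le> t + (n + 3) * 3000 \<and> same {2} {3, 6} s' s \<and>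
    get 0 s' 6 = b + Suc (n + n) \<and> outs s' b (enc_config n (pc, S, F)) \<and>
    (\<forall>x<b. get 2 s' x = get 2 s x)) s t"
  unfolding emit_config_def
proof (intro wp_intros)
  define s1 where "s1 = put 0 6 (Suc b) (put 2 b (Suc (enc_control pc)) s)"
  have s1: "put 0 (aval (Const 6) (put 2 (aval (reg 6) s) (aval (Add (reg 2) (Const 1)) s) s))
         (aval (Add (reg 6) (Const 1)) (put 2 (aval (reg 6) s) (aval (Add (reg 2) (Const 1)) s) s))
         (put 2 (aval (reg 6) s) (aval (Add (reg 2) (Const 1)) s) s) = s1"
    using s by (simp add: s1_def)
  have sm1: "same {2} {3, 6} s1 s" by (simp add: s1_def)
  show "wp (emit_arr 4) (wp (emit_arr 5) (\<lambda>s' t'. t' \<le> t + (n + 3) * 3000 \<and> same {2} {3, 6} s' s \<and>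
    get 0 s' 6 = b + Suc (n + n) \<and> outs s' b (enc_config n (pc, S, F)) \<and>
    (\<forall>x<b. get 2 s' x = get 2 s x)))
     (put 0 (aval (Const 6) (put 2 (aval (reg 6) s) (aval (Add (reg 2) (Const 1)) s) s))
         (aval (Add (reg 6) (Const 1)) (put 2 (aval (reg 6) s) (aval (Add (reg 2) (Const 1)) s) s))
         (put 2 (aval (reg 6) s) (aval (Add (reg 2) (Const 1)) s) s))
     (t + (ucost (reg 6) s + ucost (Add (reg 2) (Const 1)) s + 2 + 26) +
      (ucost (Const 6) (put 2 (aval (reg 6) s) (aval (Add (reg 2) (Const 1)) s) s) +
       ucost (Add (reg 6) (Const 1)) (put 2 (aval (reg 6) s) (aval (Add (reg 2) (Const 1)) s) s) +
       0 + 26))"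
    unfolding s1
  proof (rule wp_conseq[OF wp_emit_arr[where b = "Suc b" and n = n]])
    fix s2 t2
    assume 2: "t2 \<le> t + (ucost (reg 6) s + ucost (Add (reg 2) (Const 1)) s + 2 + 26) +
      (ucost (Const 6) (put 2 (aval (reg 6) s) (aval (Add (reg 2) (Const 1)) s) s) +
       ucost (Add (reg 6) (Const 1)) (put 2 (aval (reg 6) s) (aval (Add (reg 2) (Const 1)) s) s) +
       0 + 26) + (n + 3) * 1000 \<and> same {2} {3, 6} s2 s1 \<and>
      get 0 s2 6 = Suc b + n \<and> outs s2 (Suc b) (map (get 4 s1) [0..<n]) \<and>
      (\<forall>x. x < Suc b \<or> Suc b + n \<le> x \<longrightarrow> get 2 s2 x = get 2 s1 x)"
    have sm2: "same {2} {3, 6} s2 s" by (rule same_trans[OF _ sm1]) (use 2 in simp)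
    show "wp (emit_arr 5) (\<lambda>s' t'. t' \<le> t + (n + 3) * 3000 \<and> same {2} {3, 6} s' s \<and>
      get 0 s' 6 = b + Suc (n + n) \<and> outs s' b (enc_config n (pc, S, F)) \<and>
      (\<forall>x<b. get 2 s' x = get 2 s x)) s2 t2"
    proof (rule wp_conseq[OF wp_emit_arr[where b = "Suc b + n" and n = n]])
      fix s3 t3
      assume 3: "t3 \<le> t2 + (n + 3) * 1000 \<and> same {2} {3, 6} s3 s2 \<and>
        get 0 s3 6 = Suc b + n + n \<and> outs s3 (Suc b + n) (map (get 5 s2) [0..<n]) \<and>
        (\<forall>x. x < Suc b + n \<or> Suc b + n + n \<le> x \<longrightarrow> get 2 s3 x = get 2 s2 x)"
      have keep2: "\<And>x. x < Suc b \<Longrightarrow> get 2 s2 x = get 2 s1 x"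
        and keep3: "\<And>x. x < Suc b + n \<Longrightarrow> get 2 s3 x = get 2 s2 x"
        using 2 3 by blast+
      have out2: "outs s2 (Suc b) (map (get 4 s1) [0..<n])"
        and out3: "outs s3 (Suc b + n) (map (get 5 s2) [0..<n])"
        using 2 3 by blast+
      have "outs s3 (Suc b) (map (get 4 s1) [0..<n])"
        by (rule outs_cong[OF out2 keep3]) simp
      moreover have "map (get 4 s1) [0..<n] = enc_set n S"
        using holds_set_enc_set[OF S] by (simp add: s1_def)
      moreover have "map (get 5 s2) [0..<n] = enc_set n F"
        using holds_set_enc_set[OF F] same_get[OF sm2] by simp
      moreover have "get 2 s3 b = Suc (enc_control pc)"
        using keep2[of b] keep3[of b] by (simp add: s1_def)
      then have "outs s3 b [enc_control pc]" by (simp add: outs_def)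
      moreover have "length (enc_set n S) = n" by (simp add: enc_set_def)
      ultimately have "outs s3 b (enc_config n (pc, S, F))"
        using out3 outs_append[of s3 b "[enc_control pc]" "enc_set n S @ enc_set n F"]
          outs_append[of s3 "Suc b" "enc_set n S" "enc_set n F"] by simp
      moreover have "same {2} {3, 6} s3 s" by (rule same_trans[OF _ sm2]) (use 3 in simp)
      moreover have "get 2 s3 x = get 2 s x" if "x < b" for x
        using keep2[of x] keep3[of x] that by (simp add: s1_def)
      ultimately show "t3 \<le> t + (n + 3) * 3000 \<and> same {2} {3, 6} s3 s \<and>
        get 0 s3 6 = b + Suc (n + n) \<and> outs s3 b (enc_config n (pc, S, F)) \<and>
        (\<forall>x<b. get 2 s3 x = get 2 s x)"
        using conjunct1[OF 2] conjunct1[OF 3] conjunct1[OF conjunct2[OF conjunct2[OF 3]]] by simp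
    next
      show "get 0 s2 6 = Suc b + n" using 2 by simp
      show "get 0 s2 11 = n" using s same_reg[OF sm2] by simp
    qed simp_all
  qed (use s in \<open>auto simp: s1_def\<close>)
qed

section \<open>Simulating the steps of the procedure\<close>

lemma bits_2: "bits 2 = 2"
  by (simp add: bits_def compute_floorlog)

definition rule_prog :: "nat \<Rightarrow> aexp \<Rightarrow> aexp \<Rightarrow> com" where
  "rule_prog X both one = Seq (set_reg 7 (Const 0)) (Seq (set_reg 8 (arr 3 (reg 3)))
    (If_nz (arr 9 (reg 8))
      (If_nz (arr X (arr 9 (Add (reg 8) (Const 1))))
        (If_nz (arr X (arr 9 (Add (reg 8) (Const 2)))) (set_reg 7 both) (set_reg 7 one))
        (If_nz (arr X (arr 9 (Add (reg 8) (Const 2)))) (set_reg 7 one) Skip))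
      (for_loop 4 (reg 11)
        (If_nz (arr 9 (Add (Add (reg 8) (Const 3)) (Mul (reg 4) (Const 2))))
          (If_nz (arr X (reg 4)) (set_reg 7 (Const 1)) Skip) Skip))))"

lemma wp_coef_search:
  assumes X: "X < 16" "X \<noteq> 0" and A: "holds_set n (get X s) A"
    and s: "get 0 s 11 = n" "get 0 s 8 = p" "get 0 s 7 = 0"
    and C: "\<And>j. j < n \<Longrightarrow> get 9 s (p + 3 + j * 2) \<noteq> 0 \<longleftrightarrow> j \<in> C" and Cn: "C \<subseteq> {..<n}"
  shows "wp (for_loop 4 (reg 11)
        (If_nz (arr 9 (Add (Add (reg 8) (Const 3)) (Mul (reg 4) (Const 2))))
          (If_nz (arr X (reg 4)) (set_reg 7 (Const 1)) Skip) Skip))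
    (\<lambda>s' t'. t' \<le> t + (n + 3) * 1000 \<and> same {} {4, 7} s' s \<and> (get 0 s' 7 \<noteq> 0 \<longleftrightarrow> C \<inter> A \<noteq> {})) s t"
proof (rule wp_for_loop[where N = n and E = 50 and K = 500 and
    I = "\<lambda>k s'. same {} {4, 7} s' s \<and> (get 0 s' 7 \<noteq> 0 \<longleftrightarrow> (\<exists>j<k. j \<in> C \<and> j \<in> A))"])
  fix k s' t assume k: "k < n" and k4: "get 0 s' 4 = k"
    and I: "same {} {4, 7} s' s \<and> (get 0 s' 7 \<noteq> 0 \<longleftrightarrow> (\<exists>j<k. j \<in> C \<and> j \<in> A))"
  then have sm: "same {} {4, 7} s' s" by simp
  note eqs = same_get[OF sm] same_reg[OF sm]
  have gX: "get X s' = get X s" using X by (simp add: eqs)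
  have g: "get 9 s (p + 3 + k * 2) \<noteq> 0 \<longleftrightarrow> k \<in> C" using C k by simp
  have a: "get X s k \<noteq> 0 \<longleftrightarrow> k \<in> A" using A k by (simp add: holds_set_def)
  have ex: "(\<exists>j<Suc k. j \<in> C \<and> j \<in> A) \<longleftrightarrow> (\<exists>j<k. j \<in> C \<and> j \<in> A) \<or> k \<in> C \<and> k \<in> A"
    by (auto simp: less_Suc_eq)
  have b: "(get 0 s' 7 \<noteq> 0) = (\<exists>j<k. j \<in> C \<and> j \<in> A)" using I by blast
  show "wp (If_nz (arr 9 (Add (Add (reg 8) (Const 3)) (Mul (reg 4) (Const 2))))
          (If_nz (arr X (reg 4)) (set_reg 7 (Const 1)) Skip) Skip)
     (\<lambda>s'' t'. t' \<le> t + 500 \<and> get 0 s'' 4 = k \<and> same {} {4, 7} (put 0 4 (Suc k) s'') s \<and>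
      (get 0 (put 0 4 (Suc k) s'') 7 \<noteq> 0 \<longleftrightarrow> (\<exists>j<Suc k. j \<in> C \<and> j \<in> A))) s' t"
    unfolding ex b[symmetric]
    apply (intro wp_intros)
    using sm k4 s X g a by (simp_all add: eqs gX bits_2)
next
  fix s' t' assume "t' \<le> t + (n + 2) * (500 + 50 + 3 * 4 + 200)"
    "same {} {4, 7} s' s \<and> (get 0 s' 7 \<noteq> 0 \<longleftrightarrow> (\<exists>j<n. j \<in> C \<and> j \<in> A))"
  then show "t' \<le> t + (n + 3) * 1000 \<and> same {} {4, 7} s' s \<and> (get 0 s' 7 \<noteq> 0 \<longleftrightarrow> C \<inter> A \<noteq> {})"
    using loop_cost[of "500 + 50 + 3 * 4 + 200" "1000" 0 n] Cn by auto
next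
  fix k s' assume "same {} {4, 7} s' s \<and> (get 0 s' 7 \<noteq> 0 \<longleftrightarrow> (\<exists>j<k. j \<in> C \<and> j \<in> A))"
  then have sm: "same {} {4, 7} s' s" by simp
  show "aval (reg 11) s' = n \<and> ucost (reg 11) s' \<le> 50"
    using s by (simp add: same_reg[OF sm])
qed (use s in auto)

lemma wp_rule_prog:
  assumes P: "max_min_pps P" and X: "X < 16" "X \<noteq> 0" and A: "holds_set (length P) (get X s) A"
    and pd: "parsed P s" and i: "get 0 s 3 = i" "i < length P"
    and cost: "\<And>s. ucost both s \<le> 300" "\<And>s. ucost one s \<le> 300"
    and vals: "\<And>s'. get 9 s' (get 0 s' 8) = get 9 s (get 3 s i) \<Longrightarrow> aval both s' = vb \<and> aval one s' = vo"
    and lin: "\<And>a0 as. P ! i = FormL a0 as \<Longrightarrow> R \<longleftrightarrow> form_vars (P ! i) \<inter> A \<noteq> {}"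
    and bin: "\<And>j k. P ! i \<in> {FormQ j k, FormMax j k, FormMin j k} \<Longrightarrow>
      R \<longleftrightarrow> (if j \<in> A \<and> k \<in> A then vb \<noteq> 0 else if j \<in> A \<or> k \<in> A then vo \<noteq> 0 else False)"
  shows "wp (rule_prog X both one) (\<lambda>s' t'. t' \<le> t + (length P + 3) * 2000 \<and>
    same {} {4, 7, 8} s' s \<and> (get 0 s' 7 \<noteq> 0 \<longleftrightarrow> R)) s t"
proof -
  let ?n = "length P"
  define p where "p = get 3 s i"
  have form: "form_at (P ! i) s p" and n: "get 0 s 11 = ?n"
    using pd i(2) by (simp_all add: parsed_def p_def)
  have ok: "snf_ok ?n (P ! i)" by (rule max_min_ppsD[OF P i(2)])
  have binary: ?thesis if e: "P ! i \<in> {FormQ j k, FormMax j k, FormMin j k}"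
    and jk: "get 9 s p \<noteq> 0" "get 9 s (Suc p) = j" "get 9 s (Suc (Suc p)) = k" for j k
  proof -
    have jkn: "j < ?n" "k < ?n" using ok e by auto
    have Aj: "get X s j \<noteq> 0 \<longleftrightarrow> j \<in> A" and Ak: "get X s k \<noteq> 0 \<longleftrightarrow> k \<in> A"
      using A jkn by (simp_all add: holds_set_def)
    define s1 where "s1 = put 0 8 p (put 0 7 0 s)"
    have v: "aval both s1 = vb" "aval one s1 = vo"
      using vals[of s1] by (simp_all add: s1_def p_def)
    have R: "R \<longleftrightarrow> (if j \<in> A \<and> k \<in> A then vb \<noteq> 0 else if j \<in> A \<or> k \<in> A then vo \<noteq> 0 else False)"
      by (rule bin[OF e])
    have sm1: "same {} {4, 7, 8} s1 s" by (simp add: s1_def)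
    have g1: "get 9 s1 = get 9 s" "get X s1 = get X s" "get 0 s1 8 = p" "get 0 s1 7 = 0"
      using X by (simp_all add: s1_def)
    have br: "wp (If_nz (arr X (arr 9 (Add (reg 8) (Const 1))))
        (If_nz (arr X (arr 9 (Add (reg 8) (Const 2)))) (set_reg 7 both) (set_reg 7 one))
        (If_nz (arr X (arr 9 (Add (reg 8) (Const 2)))) (set_reg 7 one) Skip))
      (\<lambda>s' t'. t' \<le> t1 + 1000 \<and> same {} {4, 7, 8} s' s \<and> (get 0 s' 7 \<noteq> 0 \<longleftrightarrow> R)) s1 t1" for t1
      apply (intro wp_intros)
      using sm1 cost(1)[of s1] cost(2)[of s1] X(1) Aj Ak by (simp_all add: g1 jk v R)
    show ?thesis
      unfolding rule_prog_def
      apply (intro wp_Seq wp_set_arr, rule wp_If)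
      subgoal premises prems
      proof -
        have eq: "put 0 (aval (Const 8) (put 0 (aval (Const 7) s) (aval (Const 0) s) s))
          (aval (arr 3 (reg 3)) (put 0 (aval (Const 7) s) (aval (Const 0) s) s))
          (put 0 (aval (Const 7) s) (aval (Const 0) s) s) = s1"
          using i by (simp add: s1_def p_def)
        show ?thesis
          unfolding eq
        proof (rule wp_conseq[OF br], goal_cases)
          case (1 s' t')
          then show ?case by simp
        qed
      qed
      subgoal using jk(1) i by (simp add: p_def)
      done
  qed
  show ?thesis
  proof (cases "P ! i")
    case (FormL a0 as)
    note f = form_at_FormL[OF form[unfolded FormL]]
    define s1 where "s1 = put 0 8 p (put 0 7 0 s)"
    have len: "length as = ?n" and nn: "\<And>a. a \<in> set as \<Longrightarrow> 0 \<le> a" using ok FormL by auto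
    have C: "get 9 s1 (p + 3 + j * 2) \<noteq> 0 \<longleftrightarrow> j \<in> form_vars (P ! i)" if "j < ?n" for j
    proof -
      have idx: "p + 3 + j * 2 = Suc (p + 2 * Suc j)" by simp
      have "get 9 s (p + 3 + j * 2) = nat (fst (quotient_of (as ! j)))"
        unfolding idx using f(2)[of "Suc j"] that len by simp
      moreover have "0 \<le> as ! j" using nn that len by simp
      ultimately show ?thesis
        using rat_quotient(3)[of "as ! j"] FormL that len by (simp add: s1_def)
    qed
    have sm1: "same {} {4, 7, 8} s1 s" by (simp add: s1_def)
    have search: "wp (for_loop 4 (reg 11)
        (If_nz (arr 9 (Add (Add (reg 8) (Const 3)) (Mul (reg 4) (Const 2))))
          (If_nz (arr X (reg 4)) (set_reg 7 (Const 1)) Skip) Skip))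
      (\<lambda>s' t'. t' \<le> t1 + (?n + 3) * 1000 \<and> same {} {4, 7} s' s1 \<and>
        (get 0 s' 7 \<noteq> 0 \<longleftrightarrow> form_vars (P ! i) \<inter> A \<noteq> {})) s1 t1" for t1
    proof (rule wp_coef_search[OF X])
      show "holds_set ?n (get X s1) A" using A X by (simp add: s1_def)
      show "get 0 s1 11 = ?n" "get 0 s1 8 = p" "get 0 s1 7 = 0" using n by (simp_all add: s1_def)
      show "form_vars (P ! i) \<subseteq> {..<?n}" using FormL len by auto
    qed (rule C)
    have post: "same {} {4, 7, 8} s' s" if "same {} {4, 7} s' s1" for s'
      by (rule same_trans[OF same_mono[OF that] sm1]) auto
    show ?thesis
      unfolding rule_prog_def
      apply (intro wp_Seq wp_set_arr, rule wp_If)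
      subgoal using f(1) i by (simp add: p_def)
      subgoal premises prems
      proof -
        have eq: "put 0 (aval (Const 8) (put 0 (aval (Const 7) s) (aval (Const 0) s) s))
          (aval (arr 3 (reg 3)) (put 0 (aval (Const 7) s) (aval (Const 0) s) s))
          (put 0 (aval (Const 7) s) (aval (Const 0) s) s) = s1"
          using i by (simp add: s1_def p_def)
        show ?thesis
          unfolding eq
        proof (rule wp_conseq[OF search], goal_cases)
          case (1 s' t')
          then show ?case using post[of s'] lin[OF FormL] by simp
        qed
      qed
      done
  next
    case (FormQ j k)
    then show ?thesis using form by (intro binary[of j k]) (simp_all add: form_at_binary)
  next
    case (FormMax j k)
    then show ?thesis using form by (intro binary[of j k]) (simp_all add: form_at_binary)
  next
    case (FormMin j k)
    then show ?thesis using form by (intro binary[of j k]) (simp_all add: form_at_binary)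
  qed
qed

definition S_rule_prog :: com where
  "S_rule_prog = rule_prog 4 (Const 1)
    (Sub (Const 1) (Add (Sub (arr 9 (reg 8)) (Const 2)) (Sub (Const 2) (arr 9 (reg 8)))))"

definition F_rule_prog :: com where
  "F_rule_prog = rule_prog 5 (Sub (arr 9 (reg 8)) (Const 1)) (Sub (arr 9 (reg 8)) (Const 2))"

lemma form_at_tag:
  "form_at e s p \<Longrightarrow> get 9 s p = (case e of FormL _ _ \<Rightarrow> 0 | FormQ _ _ \<Rightarrow> 1 | FormMax _ _ \<Rightarrow> 2 | FormMin _ _ \<Rightarrow> 3)"
  by (cases e) (auto simp: form_at_FormL form_at_binary)

lemma wp_S_rule_prog:
  assumes P: "max_min_pps P" and S: "holds_set (length P) (get 4 s) S"
    and pd: "parsed P s" and i: "get 0 s 3 = i" "i < length P"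
  shows "wp S_rule_prog (\<lambda>s' t'. t' \<le> t + (length P + 3) * 2000 \<and>
    same {} {4, 7, 8} s' s \<and> (get 0 s' 7 \<noteq> 0 \<longleftrightarrow> S_rule (P ! i) S)) s t"
proof -
  have tag: "get 9 s (get 3 s i) = (case P ! i of FormL _ _ \<Rightarrow> 0 | FormQ _ _ \<Rightarrow> 1 | FormMax _ _ \<Rightarrow> 2 | FormMin _ _ \<Rightarrow> 3)"
    using pd i(2) form_at_tag by (simp add: parsed_def)
  show ?thesis
    unfolding S_rule_prog_def
    by (rule wp_rule_prog[OF P _ _ S pd i, where vb = 1 and
          vo = "1 - ((get 9 s (get 3 s i) - 2) + (2 - get 9 s (get 3 s i)))"])
      (auto simp: tag)
qed

lemma wp_F_rule_prog:
  assumes P: "max_min_pps P" and F: "holds_set (length P) (get 5 s) F"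
    and pd: "parsed P s" and i: "get 0 s 3 = i" "i < length P"
  shows "wp F_rule_prog (\<lambda>s' t'. t' \<le> t + (length P + 3) * 2000 \<and>
    same {} {4, 7, 8} s' s \<and> (get 0 s' 7 \<noteq> 0 \<longleftrightarrow> F_rule (P ! i) F)) s t"
proof -
  have tag: "get 9 s (get 3 s i) = (case P ! i of FormL _ _ \<Rightarrow> 0 | FormQ _ _ \<Rightarrow> 1 | FormMax _ _ \<Rightarrow> 2 | FormMin _ _ \<Rightarrow> 3)"
    using pd i(2) form_at_tag by (simp add: parsed_def)
  show ?thesis
    unfolding F_rule_prog_def
    by (rule wp_rule_prog[OF P _ _ F pd i, where vb = "get 9 s (get 3 s i) - 1" and
          vo = "get 9 s (get 3 s i) - 2"])
      (auto simp: tag)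
qed

definition find_prog :: "com \<Rightarrow> com" where
  "find_prog c = Seq (set_reg 5 (Const 0)) (for_loop 3 (reg 11)
    (Seq c (If_nz (reg 7) (set_reg 5 (Add (reg 3) (Const 1))) Skip)))"

lemma wp_find_prog:
  assumes n: "get 0 s 11 = n"
    and test: "\<And>i s' t. i < n \<Longrightarrow> same {} {3, 4, 5, 7, 8} s' s \<Longrightarrow> get 0 s' 3 = i \<Longrightarrow>
      wp c (\<lambda>s'' t'. t' \<le> t + K \<and> same {} {4, 7, 8} s'' s' \<and> (get 0 s'' 7 \<noteq> 0 \<longleftrightarrow> i \<in> C)) s' t"
  shows "wp (find_prog c) (\<lambda>s' t'. t' \<le> t + (n + 3) * (K + 1000) \<and> same {} {3, 4, 5, 7, 8} s' s \<and>
    (get 0 s' 5 = 0 \<longrightarrow> (\<forall>i<n. i \<notin> C)) \<and>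
    (get 0 s' 5 \<noteq> 0 \<longrightarrow> get 0 s' 5 - 1 \<in> C \<and> get 0 s' 5 - 1 < n)) s t"
  unfolding find_prog_def
proof (intro wp_Seq wp_set_arr, rule wp_for_loop[where N = n and E = 50 and K = "K + 300" and
    I = "\<lambda>k s'. same {} {3, 4, 5, 7, 8} s' s \<and> (get 0 s' 5 = 0 \<longrightarrow> (\<forall>i<k. i \<notin> C)) \<and>
      (get 0 s' 5 \<noteq> 0 \<longrightarrow> get 0 s' 5 - 1 \<in> C \<and> get 0 s' 5 - 1 < n)"])
  fix k s' t assume k: "k < n" and k3: "get 0 s' 3 = k"
    and I: "same {} {3, 4, 5, 7, 8} s' s \<and> (get 0 s' 5 = 0 \<longrightarrow> (\<forall>i<k. i \<notin> C)) \<and>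
      (get 0 s' 5 \<noteq> 0 \<longrightarrow> get 0 s' 5 - 1 \<in> C \<and> get 0 s' 5 - 1 < n)"
  then have sm: "same {} {3, 4, 5, 7, 8} s' s" by simp
  show "wp (Seq c (If_nz (reg 7) (set_reg 5 (Add (reg 3) (Const 1))) Skip))
    (\<lambda>s'' t'. t' \<le> t + (K + 300) \<and> get 0 s'' 3 = k \<and>
      same {} {3, 4, 5, 7, 8} (put 0 3 (Suc k) s'') s \<and>
      (get 0 (put 0 3 (Suc k) s'') 5 = 0 \<longrightarrow> (\<forall>i<Suc k. i \<notin> C)) \<and>
      (get 0 (put 0 3 (Suc k) s'') 5 \<noteq> 0 \<longrightarrow> get 0 (put 0 3 (Suc k) s'') 5 - 1 \<in> C \<and>
        get 0 (put 0 3 (Suc k) s'') 5 - 1 < n)) s' t"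
  proof (rule wp_Seq, rule wp_conseq[OF test[OF k sm k3]])
    fix s'' t' assume Q: "t' \<le> t + K \<and> same {} {4, 7, 8} s'' s' \<and> (get 0 s'' 7 \<noteq> 0 \<longleftrightarrow> k \<in> C)"
    then have sm2: "same {} {4, 7, 8} s'' s'" by simp
    have sm3: "same {} {3, 4, 5, 7, 8} s'' s" by (rule same_trans[OF same_mono[OF sm2] sm]) auto
    have r: "get 0 s'' 3 = k" "get 0 s'' 5 = get 0 s' 5" using k3 by (simp_all add: same_reg[OF sm2])
    show "wp (If_nz (reg 7) (set_reg 5 (Add (reg 3) (Const 1))) Skip)
      (\<lambda>s'' t'. t' \<le> t + (K + 300) \<and> get 0 s'' 3 = k \<and>
      same {} {3, 4, 5, 7, 8} (put 0 3 (Suc k) s'') s \<and>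
      (get 0 (put 0 3 (Suc k) s'') 5 = 0 \<longrightarrow> (\<forall>i<Suc k. i \<notin> C)) \<and>
      (get 0 (put 0 3 (Suc k) s'') 5 \<noteq> 0 \<longrightarrow> get 0 (put 0 3 (Suc k) s'') 5 - 1 \<in> C \<and>
        get 0 (put 0 3 (Suc k) s'') 5 - 1 < n)) s'' t'"
      apply (intro wp_intros)
      using Q I sm3 k by (auto simp: r less_Suc_eq)
  qed
next
  fix s' t' assume t': "t' \<le> t + (ucost (Const 5) s + ucost (Const 0) s + 0 + 26) +
      (n + 2) * (K + 300 + 50 + 3 * 3 + 200)"
    and I: "same {} {3, 4, 5, 7, 8} s' s \<and> (get 0 s' 5 = 0 \<longrightarrow> (\<forall>i<n. i \<notin> C)) \<and>
      (get 0 s' 5 \<noteq> 0 \<longrightarrow> get 0 s' 5 - 1 \<in> C \<and> get 0 s' 5 - 1 < n)"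
  have "(n + 2) * (K + 300 + 50 + 3 * 3 + 200) + 100 \<le> (n + 3) * (K + 1000)"
    by (rule loop_cost) auto
  then have "t' \<le> t + (n + 3) * (K + 1000)" using t' by simp
  then show "t' \<le> t + (n + 3) * (K + 1000) \<and> same {} {3, 4, 5, 7, 8} s' s \<and>
    (get 0 s' 5 = 0 \<longrightarrow> (\<forall>i<n. i \<notin> C)) \<and>
    (get 0 s' 5 \<noteq> 0 \<longrightarrow> get 0 s' 5 - 1 \<in> C \<and> get 0 s' 5 - 1 < n)" using I by blast
next
  fix k s' assume "same {} {3, 4, 5, 7, 8} s' s \<and> (get 0 s' 5 = 0 \<longrightarrow> (\<forall>i<k. i \<notin> C)) \<and>
      (get 0 s' 5 \<noteq> 0 \<longrightarrow> get 0 s' 5 - 1 \<in> C \<and> get 0 s' 5 - 1 < n)"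
  then have sm: "same {} {3, 4, 5, 7, 8} s' s" by simp
  show "aval (reg 11) s' = n \<and> ucost (reg 11) s' \<le> 50"
    using n by (simp add: same_reg[OF sm])
qed simp

definition conf :: "pps \<Rightarrow> mem \<Rightarrow> config \<Rightarrow> bool" where
  "conf P s c \<longleftrightarrow> (case c of (pc, S, F) \<Rightarrow> get 0 s 2 = enc_control pc \<and>
     holds_set (length P) (get 4 s) S \<and> holds_set (length P) (get 5 s) F \<and>
     max_policy P (get 8 s) \<and> policy_positive P S (get 8 s))"

definition simulates :: "pps \<Rightarrow> config \<Rightarrow> nat \<Rightarrow> com \<Rightarrow> mem \<Rightarrow> bool" where
  "simulates P c K prog s \<longleftrightarrow> (\<forall>t. wp prog (\<lambda>s' t'. t' \<le> t + K \<and>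
     same {4, 5, 8} {2, 3, 4, 5, 7, 8} s' s \<and> (\<exists>c'. proc_step P c c' \<and> conf P s' c')) s t)"

lemma max_policy_update:
  assumes "parsed P s" "max_policy P \<sigma>"
    and "\<And>i. i < length P \<Longrightarrow>
      \<sigma>' i \<in> {\<sigma> i, get 9 s (Suc (get 3 s i)), get 9 s (Suc (Suc (get 3 s i)))}"
  shows "max_policy P \<sigma>'"
  unfolding max_policy_def
proof (intro ballI allI impI)
  fix i j k assume i: "i \<in> vars P" and e: "P ! i = FormMax j k"
  have "form_at (P ! i) s (get 3 s i)" using assms(1) i by (simp add: parsed_def)
  then have "get 9 s (Suc (get 3 s i)) = j" "get 9 s (Suc (Suc (get 3 s i))) = k"
    by (simp_all add: e form_at_binary)
  moreover have "\<sigma> i \<in> {j, k}" using assms(2) i e by (simp add: max_policy_def)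
  ultimately show "\<sigma>' i \<in> {j, k}" using assms(3)[of i] i by auto
qed

abbreviation fst_var :: aexp where "fst_var \<equiv> arr 9 (Add (arr 3 (reg 3)) (Const 1))"
abbreviation snd_var :: aexp where "snd_var \<equiv> arr 9 (Add (arr 3 (reg 3)) (Const 2))"

definition step1_prog :: com where
  "step1_prog = Seq (for_loop 3 (reg 11)
      (If_nz (arr 6 (reg 3)) (set_arr 4 (reg 3) (Const 1)) (set_arr 4 (reg 3) (Const 0))))
    (set_reg 2 (Const 2))"

lemma step1_simulates:
  assumes P: "max_min_pps P" and pd: "parsed P s" and c: "conf P s (Step1, S, F)"
  shows "simulates P (Step1, S, F) ((length P + 3) * 2000) step1_prog s"
  unfolding simulates_def
proof
  fix t
  have n: "get 0 s 11 = length P" using pd by (simp add: parsed_def)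
  have flag: "get 6 s i \<noteq> 0 \<longleftrightarrow> i \<in> init_S P" if "i < length P" for i
    using pd that by (simp add: parsed_def form_flags_def init_S_def)
  show "wp step1_prog (\<lambda>s' t'. t' \<le> t + (length P + 3) * 2000 \<and>
     same {4, 5, 8} {2, 3, 4, 5, 7, 8} s' s \<and> (\<exists>c'. proc_step P (Step1, S, F) c' \<and> conf P s' c')) s t"
    unfolding step1_prog_def
  proof (rule wp_Seq, rule wp_conseq[OF wp_map_loop[OF n, where X = 4 and K = 300 and
      v = "\<lambda>i. if i \<in> init_S P then 1 else 0"]])
    fix i s' t assume i: "i < length P" "same {4} {3} s' s" "get 0 s' 3 = i"
    have g: "get 6 s' = get 6 s" using same_get[OF i(2)] by simp
    show "wp (If_nz (arr 6 (reg 3)) (set_arr 4 (reg 3) (Const 1)) (set_arr 4 (reg 3) (Const 0)))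
      (\<lambda>s'' t'. t' \<le> t + 300 \<and> s'' = put 4 i (if i \<in> init_S P then 1 else 0) s') s' t"
      apply (intro wp_intros)
      using flag[OF i(1)] i by (simp_all add: g)
  next
    fix s' t' assume Q: "t' \<le> t + (length P + 3) * (300 + 500) \<and> same {4} {3} s' s \<and>
      (\<forall>i<length P. get 4 s' i = (if i \<in> init_S P then 1 else 0))"
    then have sm: "same {4} {3} s' s" by simp
    have sm': "same {4, 5, 8} {2, 3, 4, 5, 7, 8} s' s" by (rule same_mono[OF sm]) auto
    have S': "holds_set (length P) (get 4 s') (init_S P)" using Q by (simp add: holds_set_def)
    have "conf P (put 0 2 2 s') (Step2, init_S P, F)"
      using c S' policy_positive_init_S[OF P] same_get[OF sm] by (simp add: conf_def)
    moreover have "proc_step P (Step1, S, F) (Step2, init_S P, F)"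
      unfolding init_S_def by (rule proc_step.step1)
    ultimately have "\<exists>c'. proc_step P (Step1, S, F) c' \<and> conf P (put 0 2 2 s') c'" by blast
    then show "wp (set_reg 2 (Const 2)) (\<lambda>s' t'. t' \<le> t + (length P + 3) * 2000 \<and>
     same {4, 5, 8} {2, 3, 4, 5, 7, 8} s' s \<and> (\<exists>c'. proc_step P (Step1, S, F) c' \<and> conf P s' c')) s' t'"
      by (intro wp_set_arr) (use conjunct1[OF Q] sm' in simp)
  qed simp_all
qed

definition test_S :: com where
  "test_S = If_nz (arr 4 (reg 3)) (set_reg 7 (Const 0)) S_rule_prog"

definition step2_prog :: com where
  "step2_prog = Seq (find_prog test_S)
    (If_nz (reg 5)
      (Seq (set_reg 3 (Sub (reg 5) (Const 1)))
      (Seq (If_nz (arr 4 fst_var) (set_arr 8 (reg 3) fst_var) (set_arr 8 (reg 3) snd_var))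
      (set_arr 4 (reg 3) (Const 1))))
      (set_reg 2 (Const 3)))"

lemma wp_test_S:
  assumes P: "max_min_pps P" and S: "holds_set (length P) (get 4 s) S"
    and pd: "parsed P s" and i: "get 0 s 3 = i" "i < length P"
  shows "wp test_S (\<lambda>s' t'. t' \<le> t + (length P + 3) * 2100 \<and>
    same {} {4, 7, 8} s' s \<and> (get 0 s' 7 \<noteq> 0 \<longleftrightarrow> i \<in> S_candidates P S)) s t"
proof -
  have v: "get 4 s i = (if i \<in> S then 1 else 0)" using S i by (simp add: holds_set_def)
  show ?thesis
    unfolding test_S_def
    apply (rule wp_If)
    subgoal by (rule wp_set_arr) (use i v in \<open>auto simp: S_candidates_def split: if_splits\<close>)
    subgoal premises prems
    proof (rule wp_conseq[OF wp_S_rule_prog[OF P S pd i]], goal_cases)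
      case (1 s' t')
      then show ?case using prems i v by (auto simp: S_candidates_def split: if_splits)
    qed
    done
qed

lemma same_find:
  assumes "parsed P s" "same {} {3, 4, 5, 7, 8} s' s"
  shows "parsed P s'" "get 4 s' = get 4 s" "get 5 s' = get 5 s" "get 8 s' = get 8 s" "get 0 s' 2 = get 0 s 2"
  using parsed_same[OF assms] same_get[OF assms(2)] same_reg[OF assms(2)] by simp_all

lemma step2_simulates:
  assumes P: "max_min_pps P" and pd: "parsed P s" and c: "conf P s (Step2, S, F)"
  shows "simulates P (Step2, S, F) ((length P + 3) * ((length P + 3) * 2100 + 2000)) step2_prog s"
  unfolding simulates_def
proof
  fix t
  let ?n = "length P"
  let ?K = "(?n + 3) * ((?n + 3) * 2100 + 2000)"
  let ?Q = "\<lambda>s' t'. t' \<le> t + ?K \<and> same {4, 5, 8} {2, 3, 4, 5, 7, 8} s' s \<and>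
    (\<exists>c'. proc_step P (Step2, S, F) c' \<and> conf P s' c')"
  have n: "get 0 s 11 = ?n" using pd by (simp add: parsed_def)
  have S: "holds_set ?n (get 4 s) S" and F: "holds_set ?n (get 5 s) F"
    and mp: "max_policy P (get 8 s)" and pp: "policy_positive P S (get 8 s)"
    using c by (auto simp: conf_def)
  show "wp step2_prog ?Q s t"
    unfolding step2_prog_def
  proof (rule wp_Seq, rule wp_conseq[OF wp_find_prog[OF n, where K = "(?n + 3) * 2100" and
        C = "S_candidates P S"]])
    fix i s' t assume i: "i < ?n" "same {} {3, 4, 5, 7, 8} s' s" "get 0 s' 3 = i"
    note sf = same_find[OF pd i(2)]
    show "wp test_S (\<lambda>s'' t'. t' \<le> t + (?n + 3) * 2100 \<and> same {} {4, 7, 8} s'' s' \<and>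
      (get 0 s'' 7 \<noteq> 0 \<longleftrightarrow> i \<in> S_candidates P S)) s' t"
      by (rule wp_test_S[OF P _ sf(1) i(3,1)]) (use S sf in simp)
  next
    fix s1 t1
    assume Q: "t1 \<le> t + (?n + 3) * ((?n + 3) * 2100 + 1000) \<and> same {} {3, 4, 5, 7, 8} s1 s \<and>
      (get 0 s1 5 = 0 \<longrightarrow> (\<forall>i<?n. i \<notin> S_candidates P S)) \<and>
      (get 0 s1 5 \<noteq> 0 \<longrightarrow> get 0 s1 5 - 1 \<in> S_candidates P S \<and> get 0 s1 5 - 1 < ?n)"
    then have sm: "same {} {3, 4, 5, 7, 8} s1 s" by blast
    note sf = same_find[OF pd sm]
    have t1: "t1 + 2000 \<le> t + ?K" using conjunct1[OF Q] by (simp add: algebra_simps)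
    have sm': "same {4, 5, 8} {2, 3, 4, 5, 7, 8} s1 s" by (rule same_mono[OF sm]) auto
    show "wp (If_nz (reg 5)
      (Seq (set_reg 3 (Sub (reg 5) (Const 1)))
      (Seq (If_nz (arr 4 fst_var) (set_arr 8 (reg 3) fst_var) (set_arr 8 (reg 3) snd_var))
      (set_arr 4 (reg 3) (Const 1))))
      (set_reg 2 (Const 3))) ?Q s1 t1"
    proof (rule wp_If)
      assume "aval (reg 5) s1 = 0"
      then have "S_candidates P S = {}" using Q by (auto simp: S_candidates_def)
      then have "proc_step P (Step2, S, F) (Step3, S, F)" by (rule proc_step.step2_exit)
      moreover have "conf P (put 0 2 3 s1) (Step3, S, F)"
        using c sf by (simp add: conf_def)
      ultimately have "\<exists>c'. proc_step P (Step2, S, F) c' \<and> conf P (put 0 2 3 s1) c'" by blast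
      then show "wp (set_reg 2 (Const 3)) ?Q s1 (t1 + (ucost (reg 5) s1 + 1))"
        by (intro wp_set_arr) (use t1 sm' in simp)
    next
      assume nz: "aval (reg 5) s1 \<noteq> 0"
      define i where "i = get 0 s1 5 - 1"
      have i: "i \<in> S_candidates P S" "i < ?n" using nz Q by (simp_all add: i_def)
      define a b where "a = get 9 s1 (Suc (get 3 s1 i))" and "b = get 9 s1 (Suc (Suc (get 3 s1 i)))"
      define v where "v = (if get 4 s1 a \<noteq> 0 then a else b)"
      define s2 where "s2 = put 4 i 1 (put 8 i v (put 0 3 i s1))"
      have g8: "get 8 s2 = (get 8 s)(i := v)" using sf by (simp add: s2_def)
      have iS: "i \<notin> S" "S_rule (P ! i) S" using i by (auto simp: S_candidates_def)
      have "max_policy P (get 8 s2)"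
        by (rule max_policy_update[OF sf(1) mp]) (auto simp: g8 v_def a_def b_def)
      moreover have "policy_positive P (insert i S) (get 8 s2)"
      proof (rule policy_positive_insert[OF P pp i(1)])
        show "get 8 s2 l = get 8 s l" if "l \<in> S" for l using that iS by (auto simp: g8)
        fix j k assume e: "P ! i = FormMax j k"
        have "form_at (P ! i) s1 (get 3 s1 i)" using sf(1) i(2) by (simp add: parsed_def)
        then have ab: "a = j" "b = k" by (simp_all add: e form_at_binary a_def b_def)
        have "j < ?n" using max_min_ppsD[OF P i(2)] e by simp
        then have "get 4 s1 j \<noteq> 0 \<longleftrightarrow> j \<in> S" using S sf(2) by (simp add: holds_set_def)
        then show "get 8 s2 i \<in> S" using iS e by (auto simp: g8 v_def ab)
      qed
      moreover have "holds_set ?n (get 4 s2) (insert i S)" "holds_set ?n (get 5 s2) F" "get 0 s2 2 = 2"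
        using S F sf c by (auto simp: s2_def holds_set_def conf_def)
      ultimately have "conf P s2 (Step2, insert i S, F)" by (simp add: conf_def)
      then have ex: "\<exists>c'. proc_step P (Step2, S, F) c' \<and> conf P s2 c'"
        using proc_step.step2_add[OF i(1)] by blast
      have sm2: "same {4, 5, 8} {2, 3, 4, 5, 7, 8} s2 s" using sm' by (simp add: s2_def)
      show "wp (Seq (set_reg 3 (Sub (reg 5) (Const 1)))
        (Seq (If_nz (arr 4 fst_var) (set_arr 8 (reg 3) fst_var) (set_arr 8 (reg 3) snd_var))
        (set_arr 4 (reg 3) (Const 1)))) ?Q s1 (t1 + (ucost (reg 5) s1 + 1))"
        apply (intro wp_intros)
        using t1 sm2 ex by (simp_all add: s2_def v_def a_def b_def i_def)
    qed
  qed
qed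

definition step3_prog :: com where
  "step3_prog = Seq (for_loop 3 (reg 11)
      (If_nz (arr 4 (reg 3)) (set_arr 5 (reg 3) (Const 0))
        (If_nz (arr 7 (reg 3)) (set_arr 5 (reg 3) (Const 1)) (set_arr 5 (reg 3) (Const 0)))))
    (set_reg 2 (Const 4))"

lemma step3_simulates:
  assumes pd: "parsed P s" and c: "conf P s (Step3, S, F)"
  shows "simulates P (Step3, S, F) ((length P + 3) * 2000) step3_prog s"
  unfolding simulates_def
proof
  fix t
  have n: "get 0 s 11 = length P" using pd by (simp add: parsed_def)
  have S: "holds_set (length P) (get 4 s) S" using c by (auto simp: conf_def)
  have flag: "get 4 s i = 0 \<and> get 7 s i \<noteq> 0 \<longleftrightarrow> i \<in> init_F P S" if "i < length P" for i
    using pd that S by (auto simp: parsed_def form_flags_def init_F_def holds_set_def)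
  show "wp step3_prog (\<lambda>s' t'. t' \<le> t + (length P + 3) * 2000 \<and>
     same {4, 5, 8} {2, 3, 4, 5, 7, 8} s' s \<and> (\<exists>c'. proc_step P (Step3, S, F) c' \<and> conf P s' c')) s t"
    unfolding step3_prog_def
  proof (rule wp_Seq, rule wp_conseq[OF wp_map_loop[OF n, where X = 5 and K = 300 and
      v = "\<lambda>i. if i \<in> init_F P S then 1 else 0"]])
    fix i s' t assume i: "i < length P" "same {5} {3} s' s" "get 0 s' 3 = i"
    have g: "get 4 s' = get 4 s" "get 7 s' = get 7 s" using same_get[OF i(2)] by simp_all
    show "wp (If_nz (arr 4 (reg 3)) (set_arr 5 (reg 3) (Const 0))
        (If_nz (arr 7 (reg 3)) (set_arr 5 (reg 3) (Const 1)) (set_arr 5 (reg 3) (Const 0))))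
      (\<lambda>s'' t'. t' \<le> t + 300 \<and> s'' = put 5 i (if i \<in> init_F P S then 1 else 0) s') s' t"
      apply (intro wp_intros)
      using flag[OF i(1)] i by (auto simp: g)
  next
    fix s' t' assume Q: "t' \<le> t + (length P + 3) * (300 + 500) \<and> same {5} {3} s' s \<and>
      (\<forall>i<length P. get 5 s' i = (if i \<in> init_F P S then 1 else 0))"
    then have sm: "same {5} {3} s' s" by simp
    have sm': "same {4, 5, 8} {2, 3, 4, 5, 7, 8} s' s" by (rule same_mono[OF sm]) auto
    have F': "holds_set (length P) (get 5 s') (init_F P S)" using Q by (simp add: holds_set_def)
    have "conf P (put 0 2 4 s') (Step4, S, init_F P S)"
      using c F' same_get[OF sm] by (simp add: conf_def)
    moreover have "proc_step P (Step3, S, F) (Step4, S, init_F P S)"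
      unfolding init_F_def by (rule proc_step.step3)
    ultimately have "\<exists>c'. proc_step P (Step3, S, F) c' \<and> conf P (put 0 2 4 s') c'" by blast
    then show "wp (set_reg 2 (Const 4)) (\<lambda>s' t'. t' \<le> t + (length P + 3) * 2000 \<and>
     same {4, 5, 8} {2, 3, 4, 5, 7, 8} s' s \<and> (\<exists>c'. proc_step P (Step3, S, F) c' \<and> conf P s' c')) s' t'"
      by (intro wp_set_arr) (use conjunct1[OF Q] sm' in simp)
  qed simp_all
qed

definition test_F :: com where
  "test_F = If_nz (arr 4 (reg 3)) (set_reg 7 (Const 0))
    (If_nz (arr 5 (reg 3)) (set_reg 7 (Const 0)) F_rule_prog)"

definition step4_prog :: com where
  "step4_prog = Seq (find_prog test_F)
    (If_nz (reg 5) (set_arr 5 (Sub (reg 5) (Const 1)) (Const 1)) (set_reg 2 (Const 5)))"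

lemma wp_test_F:
  assumes P: "max_min_pps P" and S: "holds_set (length P) (get 4 s) S"
    and F: "holds_set (length P) (get 5 s) F"
    and pd: "parsed P s" and i: "get 0 s 3 = i" "i < length P"
  shows "wp test_F (\<lambda>s' t'. t' \<le> t + (length P + 3) * 2100 \<and>
    same {} {4, 7, 8} s' s \<and> (get 0 s' 7 \<noteq> 0 \<longleftrightarrow> i \<in> F_candidates P S F)) s t"
proof -
  have v: "get 4 s i = (if i \<in> S then 1 else 0)" "get 5 s i = (if i \<in> F then 1 else 0)"
    using S F i by (simp_all add: holds_set_def)
  show ?thesis
    unfolding test_F_def
    apply (rule wp_If)
    subgoal by (rule wp_set_arr) (use i v in \<open>auto simp: F_candidates_def split: if_splits\<close>)
    apply (rule wp_If)
    subgoal by (rule wp_set_arr) (use i v in \<open>auto simp: F_candidates_def split: if_splits\<close>)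
    subgoal premises prems
    proof (rule wp_conseq[OF wp_F_rule_prog[OF P F pd i]], goal_cases)
      case (1 s' t')
      then show ?case using prems i v by (auto simp: F_candidates_def split: if_splits)
    qed
    done
qed

lemma step4_simulates:
  assumes P: "max_min_pps P" and pd: "parsed P s" and c: "conf P s (Step4, S, F)"
  shows "simulates P (Step4, S, F) ((length P + 3) * ((length P + 3) * 2100 + 2000)) step4_prog s"
  unfolding simulates_def
proof
  fix t
  let ?n = "length P"
  let ?K = "(?n + 3) * ((?n + 3) * 2100 + 2000)"
  let ?Q = "\<lambda>s' t'. t' \<le> t + ?K \<and> same {4, 5, 8} {2, 3, 4, 5, 7, 8} s' s \<and>
    (\<exists>c'. proc_step P (Step4, S, F) c' \<and> conf P s' c')"
  have n: "get 0 s 11 = ?n" using pd by (simp add: parsed_def)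
  have S: "holds_set ?n (get 4 s) S" and F: "holds_set ?n (get 5 s) F"
    using c by (auto simp: conf_def)
  show "wp step4_prog ?Q s t"
    unfolding step4_prog_def
  proof (rule wp_Seq, rule wp_conseq[OF wp_find_prog[OF n, where K = "(?n + 3) * 2100" and
        C = "F_candidates P S F"]])
    fix i s' t assume i: "i < ?n" "same {} {3, 4, 5, 7, 8} s' s" "get 0 s' 3 = i"
    note sf = same_find[OF pd i(2)]
    show "wp test_F (\<lambda>s'' t'. t' \<le> t + (?n + 3) * 2100 \<and> same {} {4, 7, 8} s'' s' \<and>
      (get 0 s'' 7 \<noteq> 0 \<longleftrightarrow> i \<in> F_candidates P S F)) s' t"
      by (rule wp_test_F[OF P _ _ sf(1) i(3,1)]) (use S F sf in simp_all)
  next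
    fix s1 t1
    assume Q: "t1 \<le> t + (?n + 3) * ((?n + 3) * 2100 + 1000) \<and> same {} {3, 4, 5, 7, 8} s1 s \<and>
      (get 0 s1 5 = 0 \<longrightarrow> (\<forall>i<?n. i \<notin> F_candidates P S F)) \<and>
      (get 0 s1 5 \<noteq> 0 \<longrightarrow> get 0 s1 5 - 1 \<in> F_candidates P S F \<and> get 0 s1 5 - 1 < ?n)"
    then have sm: "same {} {3, 4, 5, 7, 8} s1 s" by blast
    note sf = same_find[OF pd sm]
    have t1: "t1 + 2000 \<le> t + ?K" using conjunct1[OF Q] by (simp add: algebra_simps)
    have sm': "same {4, 5, 8} {2, 3, 4, 5, 7, 8} s1 s" by (rule same_mono[OF sm]) auto
    show "wp (If_nz (reg 5) (set_arr 5 (Sub (reg 5) (Const 1)) (Const 1)) (set_reg 2 (Const 5))) ?Q s1 t1"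
    proof (rule wp_If)
      assume "aval (reg 5) s1 = 0"
      then have "F_candidates P S F = {}" using Q by (auto simp: F_candidates_def)
      then have "proc_step P (Step4, S, F) (Step5, S, F)" by (rule proc_step.step4_exit)
      moreover have "conf P (put 0 2 5 s1) (Step5, S, F)"
        using c sf by (simp add: conf_def)
      ultimately have "\<exists>c'. proc_step P (Step4, S, F) c' \<and> conf P (put 0 2 5 s1) c'" by blast
      then show "wp (set_reg 2 (Const 5)) ?Q s1 (t1 + (ucost (reg 5) s1 + 1))"
        by (intro wp_set_arr) (use t1 sm' in simp)
    next
      assume nz: "aval (reg 5) s1 \<noteq> 0"
      define i where "i = get 0 s1 5 - 1"
      have i: "i \<in> F_candidates P S F" using nz Q by (simp add: i_def)
      define s2 where "s2 = put 5 i 1 s1"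
      have "conf P s2 (Step4, S, insert i F)"
        using c sf by (auto simp: s2_def conf_def holds_set_def)
      then have ex: "\<exists>c'. proc_step P (Step4, S, F) c' \<and> conf P s2 c'"
        using proc_step.step4_add[OF i] by blast
      have sm2: "same {4, 5, 8} {2, 3, 4, 5, 7, 8} s2 s" using sm' by (simp add: s2_def)
      show "wp (set_arr 5 (Sub (reg 5) (Const 1)) (Const 1)) ?Q s1 (t1 + (ucost (reg 5) s1 + 1))"
        by (rule wp_set_arr) (use t1 sm2 ex in \<open>simp add: s2_def i_def\<close>)
    qed
  qed
qed

definition test_rest :: com where
  "test_rest = If_nz (arr 4 (reg 3)) (set_reg 7 (Const 0))
    (If_nz (arr 5 (reg 3)) (set_reg 7 (Const 0)) (set_reg 7 (Const 1)))"

definition step5_prog :: com where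
  "step5_prog = Seq (find_prog test_rest)
    (If_nz (reg 5) (set_reg 2 (Const 6)) (set_reg 2 (Const 7)))"

lemma step5_simulates:
  assumes pd: "parsed P s" and c: "conf P s (Step5, S, F)" and SF: "S \<union> F \<subseteq> vars P"
  shows "simulates P (Step5, S, F) ((length P + 3) * ((length P + 3) * 2100 + 2000)) step5_prog s"
  unfolding simulates_def
proof
  fix t
  let ?n = "length P"
  let ?K = "(?n + 3) * ((?n + 3) * 2100 + 2000)"
  let ?Q = "\<lambda>s' t'. t' \<le> t + ?K \<and> same {4, 5, 8} {2, 3, 4, 5, 7, 8} s' s \<and>
    (\<exists>c'. proc_step P (Step5, S, F) c' \<and> conf P s' c')"
  have n: "get 0 s 11 = ?n" using pd by (simp add: parsed_def)
  have S: "holds_set ?n (get 4 s) S" and F: "holds_set ?n (get 5 s) F"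
    using c by (auto simp: conf_def)
  show "wp step5_prog ?Q s t"
    unfolding step5_prog_def
  proof (rule wp_Seq, rule wp_conseq[OF wp_find_prog[OF n, where K = "(?n + 3) * 2100" and
        C = "vars P - (S \<union> F)"]])
    fix i s' t assume i: "i < ?n" "same {} {3, 4, 5, 7, 8} s' s" "get 0 s' 3 = i"
    note sf = same_find[OF pd i(2)]
    have v: "get 4 s i = (if i \<in> S then 1 else 0)" "get 5 s i = (if i \<in> F then 1 else 0)"
      using S F i by (simp_all add: holds_set_def)
    show "wp test_rest (\<lambda>s'' t'. t' \<le> t + (?n + 3) * 2100 \<and> same {} {4, 7, 8} s'' s' \<and>
      (get 0 s'' 7 \<noteq> 0 \<longleftrightarrow> i \<in> vars P - (S \<union> F))) s' t"
      unfolding test_rest_def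
      apply (intro wp_intros)
      using i v sf by (auto split: if_splits)
  next
    fix s1 t1
    assume Q: "t1 \<le> t + (?n + 3) * ((?n + 3) * 2100 + 1000) \<and> same {} {3, 4, 5, 7, 8} s1 s \<and>
      (get 0 s1 5 = 0 \<longrightarrow> (\<forall>i<?n. i \<notin> vars P - (S \<union> F))) \<and>
      (get 0 s1 5 \<noteq> 0 \<longrightarrow> get 0 s1 5 - 1 \<in> vars P - (S \<union> F) \<and> get 0 s1 5 - 1 < ?n)"
    then have sm: "same {} {3, 4, 5, 7, 8} s1 s" by blast
    note sf = same_find[OF pd sm]
    have t1: "t1 + 2000 \<le> t + ?K" using conjunct1[OF Q] by (simp add: algebra_simps)
    have sm': "same {4, 5, 8} {2, 3, 4, 5, 7, 8} s1 s" by (rule same_mono[OF sm]) auto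
    show "wp (If_nz (reg 5) (set_reg 2 (Const 6)) (set_reg 2 (Const 7))) ?Q s1 t1"
    proof (rule wp_If)
      assume "aval (reg 5) s1 = 0"
      then have "vars P = S \<union> F" using Q SF by auto
      then have "proc_step P (Step5, S, F) (Halted, S, F)" by (rule proc_step.step5_halt)
      moreover have "conf P (put 0 2 7 s1) (Halted, S, F)"
        using c sf by (simp add: conf_def)
      ultimately have "\<exists>c'. proc_step P (Step5, S, F) c' \<and> conf P (put 0 2 7 s1) c'" by blast
      then show "wp (set_reg 2 (Const 7)) ?Q s1 (t1 + (ucost (reg 5) s1 + 1))"
        by (intro wp_set_arr) (use t1 sm' in simp)
    next
      assume nz: "aval (reg 5) s1 \<noteq> 0"
      then have "get 0 s1 5 - 1 \<in> vars P - (S \<union> F)" using Q by simp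
      then have "vars P \<noteq> S \<union> F" by blast
      then have "proc_step P (Step5, S, F) (Step6, S, F)" by (rule proc_step.step5_continue)
      moreover have "conf P (put 0 2 6 s1) (Step6, S, F)"
        using c sf by (simp add: conf_def)
      ultimately have "\<exists>c'. proc_step P (Step5, S, F) c' \<and> conf P (put 0 2 6 s1) c'" by blast
      then show "wp (set_reg 2 (Const 6)) ?Q s1 (t1 + (ucost (reg 5) s1 + 1))"
        by (intro wp_set_arr) (use t1 sm' in simp)
    qed
  qed
qed

definition step6_prog :: com where
  "step6_prog = Seq (for_loop 3 (reg 11)
      (If_nz (arr 4 (reg 3)) (set_arr 8 (reg 3) (arr 8 (reg 3)))
        (If_nz (arr 5 fst_var) (set_arr 8 (reg 3) snd_var) (set_arr 8 (reg 3) fst_var))))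
    (Seq (for_loop 3 (reg 11) (set_arr 4 (reg 3) (Sub (Const 1) (arr 5 (reg 3)))))
    (set_reg 2 (Const 2)))"

lemma step6_simulates:
  assumes P: "max_min_pps P" and pd: "parsed P s" and c: "conf P s (Step6, S, F)"
    and inv: "proc_inv P (Step6, S, F)"
  shows "simulates P (Step6, S, F) ((length P + 3) * 4000) step6_prog s"
  unfolding simulates_def
proof
  fix t
  let ?n = "length P"
  let ?Q = "\<lambda>s' t'. t' \<le> t + (?n + 3) * 4000 \<and> same {4, 5, 8} {2, 3, 4, 5, 7, 8} s' s \<and>
    (\<exists>c'. proc_step P (Step6, S, F) c' \<and> conf P s' c')"
  have n: "get 0 s 11 = ?n" using pd by (simp add: parsed_def)
  have S: "holds_set ?n (get 4 s) S" and F: "holds_set ?n (get 5 s) F"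
    and mp: "max_policy P (get 8 s)" and pp: "policy_positive P S (get 8 s)"
    using c by (auto simp: conf_def)
  define a b where "a i = get 9 s (Suc (get 3 s i))" and "b i = get 9 s (Suc (Suc (get 3 s i)))" for i
  define v where "v i = (if get 4 s i \<noteq> 0 then get 8 s i else if get 5 s (a i) \<noteq> 0 then b i else a i)" for i
  have SV: "S \<subseteq> vars P" and closed: "F_candidates P S F = {}" and init: "init_F P S \<subseteq> F"
    and FS: "F \<inter> S = {}"
    using inv by simp_all
  have mp': "max_policy P \<sigma>'" if "\<And>i. i < ?n \<Longrightarrow> \<sigma>' i = v i" for \<sigma>'
    by (rule max_policy_update[OF pd mp]) (use that in \<open>auto simp: v_def a_def b_def\<close>)
  have pp': "policy_positive P (vars P - F) \<sigma>'" if \<sigma>': "\<And>i. i < ?n \<Longrightarrow> \<sigma>' i = v i" for \<sigma>'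
  proof (rule policy_positive_compl[OF P pp SV init closed FS])
    show "\<sigma>' l = get 8 s l" if "l \<in> S" for l
    proof -
      have l: "l < ?n" using that SV by auto
      then have "get 4 s l \<noteq> 0" using S that by (simp add: holds_set_def)
      then show ?thesis using \<sigma>'[OF l] by (simp add: v_def)
    qed
    fix i j k assume i: "i \<in> vars P - S - F" and e: "P ! i = FormMax j k"
    then have il: "i < ?n" by simp
    have "form_at (P ! i) s (get 3 s i)" using pd il by (simp add: parsed_def)
    then have ab: "a i = j" "b i = k" by (simp_all add: e form_at_binary a_def b_def)
    have "j < ?n" using max_min_ppsD[OF P il] e by simp
    then have j: "get 5 s j \<noteq> 0 \<longleftrightarrow> j \<in> F" using F by (simp add: holds_set_def)
    have i4: "get 4 s i = 0" using S i by (simp add: holds_set_def)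
    have "\<not> F_rule (P ! i) F" using closed i by (auto simp: F_candidates_def)
    then have "j \<notin> F \<or> k \<notin> F" by (simp add: e)
    then show "\<sigma>' i \<notin> F" using j i4 by (simp add: \<sigma>'[OF il] v_def ab)
  qed
  show "wp step6_prog ?Q s t"
    unfolding step6_prog_def
  proof (rule wp_Seq, rule wp_conseq[OF wp_map_loop[OF n, where X = 8 and K = 500 and v = v]])
    fix i s' t assume i: "i < ?n" "same {8} {3} s' s" "get 0 s' 3 = i" "get 8 s' i = get 8 s i"
    have g: "get 4 s' = get 4 s" "get 5 s' = get 5 s" "get 9 s' = get 9 s" "get 3 s' = get 3 s"
      using same_get[OF i(2)] by simp_all
    show "wp (If_nz (arr 4 (reg 3)) (set_arr 8 (reg 3) (arr 8 (reg 3)))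
        (If_nz (arr 5 fst_var) (set_arr 8 (reg 3) snd_var) (set_arr 8 (reg 3) fst_var)))
      (\<lambda>s'' t'. t' \<le> t + 500 \<and> s'' = put 8 i (v i) s') s' t"
      apply (intro wp_intros)
      using i(3,4) by (simp_all add: g v_def a_def b_def)
  next
    fix s1 t1 assume Q1: "t1 \<le> t + (?n + 3) * (500 + 500) \<and> same {8} {3} s1 s \<and>
      (\<forall>i<?n. get 8 s1 i = v i)"
    then have sm1: "same {8} {3} s1 s" by simp
    have n1: "get 0 s1 11 = ?n" using n same_reg[OF sm1] by simp
    have g1: "get 5 s1 = get 5 s" "get 0 s1 2 = get 0 s 2" using same_get[OF sm1] same_reg[OF sm1] by simp_all
    have v1: "\<And>i. i < ?n \<Longrightarrow> get 8 s1 i = v i" using Q1 by blast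
    show "wp (Seq (for_loop 3 (reg 11) (set_arr 4 (reg 3) (Sub (Const 1) (arr 5 (reg 3)))))
      (set_reg 2 (Const 2))) ?Q s1 t1"
    proof (rule wp_Seq, rule wp_conseq[OF wp_map_loop[OF n1, where X = 4 and K = 300 and
          v = "\<lambda>i. 1 - get 5 s i"]])
      fix i s' t assume i: "i < ?n" "same {4} {3} s' s1" "get 0 s' 3 = i"
      have g: "get 5 s' = get 5 s1" using same_get[OF i(2)] by simp
      show "wp (set_arr 4 (reg 3) (Sub (Const 1) (arr 5 (reg 3))))
        (\<lambda>s'' t'. t' \<le> t + 300 \<and> s'' = put 4 i (1 - get 5 s i) s') s' t"
        by (rule wp_set_arr) (use i g g1 in simp)
    next
      fix s2 t2 assume Q2: "t2 \<le> t1 + (?n + 3) * (300 + 500) \<and> same {4} {3} s2 s1 \<and>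
        (\<forall>i<?n. get 4 s2 i = 1 - get 5 s i)"
      then have sm2: "same {4} {3} s2 s1" by simp
      have v2: "\<And>i. i < ?n \<Longrightarrow> get 4 s2 i = 1 - get 5 s i" using Q2 by blast
      have g2: "get 8 s2 = get 8 s1" "get 5 s2 = get 5 s1" using same_get[OF sm2] by simp_all
      have sm': "same {4, 5, 8} {2, 3, 4, 5, 7, 8} s2 s"
        by (rule same_trans[OF same_mono[OF sm2] same_mono[OF sm1]]) auto
      have "holds_set ?n (get 4 s2) (vars P - F)"
        using v2 F by (simp add: holds_set_def)
      moreover have "holds_set ?n (get 5 s2) F" using F g1 g2 by simp
      moreover have "max_policy P (get 8 s2)" "policy_positive P (vars P - F) (get 8 s2)"
        using mp'[of "get 8 s1"] pp'[of "get 8 s1"] v1 g2 by simp_all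
      ultimately have "conf P (put 0 2 2 s2) (Step2, vars P - F, F)" by (simp add: conf_def)
      then have "\<exists>c'. proc_step P (Step6, S, F) c' \<and> conf P (put 0 2 2 s2) c'"
        using proc_step.step6 by blast
      then show "wp (set_reg 2 (Const 2)) ?Q s2 t2"
        by (intro wp_set_arr) (use conjunct1[OF Q1] conjunct1[OF Q2] sm' in simp)
    qed simp_all
  qed simp_all
qed

lemma simulates_mono: "simulates P c K prog s \<Longrightarrow> K \<le> K' \<Longrightarrow> simulates P c K' prog s"
  unfolding simulates_def by (intro allI, erule allE, erule wp_conseq) auto

lemma simulates_If:
  assumes "aval e s \<noteq> 0 \<Longrightarrow> simulates P c K c1 s" "aval e s = 0 \<Longrightarrow> simulates P c K c2 s"
    and "ucost e s + 1 \<le> E"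
  shows "simulates P c (K + E) (If_nz e c1 c2) s"
  unfolding simulates_def
proof
  fix t
  have step: "wp c0 (\<lambda>s' t'. t' \<le> t + (K + E) \<and> same {4, 5, 8} {2, 3, 4, 5, 7, 8} s' s \<and>
     (\<exists>c'. proc_step P c c' \<and> conf P s' c')) s (t + (ucost e s + 1))"
    if "simulates P c K c0 s" for c0
    by (rule wp_conseq[OF that[unfolded simulates_def, rule_format]]) (use assms(3) in auto)
  show "wp (If_nz e c1 c2) (\<lambda>s' t'. t' \<le> t + (K + E) \<and> same {4, 5, 8} {2, 3, 4, 5, 7, 8} s' s \<and>
     (\<exists>c'. proc_step P c c' \<and> conf P s' c')) s t"
    using assms(1,2) by (intro wp_If step)
qed

definition step_prog :: com where
  "step_prog = If_nz (Sub (reg 2) (Const 1))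
    (If_nz (Sub (reg 2) (Const 2))
      (If_nz (Sub (reg 2) (Const 3))
        (If_nz (Sub (reg 2) (Const 4))
          (If_nz (Sub (reg 2) (Const 5)) step6_prog step5_prog)
          step4_prog)
        step3_prog)
      step2_prog)
    step1_prog"

lemma step_simulates:
  assumes P: "max_min_pps P" and pd: "parsed P s" and c: "conf P s (pc, S, F)"
    and inv: "proc_inv P (pc, S, F)" and pc: "pc \<noteq> Halted"
  shows "simulates P (pc, S, F) ((length P + 3) * ((length P + 3) * 2100 + 4000) + 500) step_prog s"
proof -
  define K where "K = (length P + 3) * ((length P + 3) * 2100 + 4000)"
  have K: "(length P + 3) * 2000 \<le> K" "(length P + 3) * 4000 \<le> K"
    "(length P + 3) * ((length P + 3) * 2100 + 2000) \<le> K"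
    unfolding K_def by (intro mult_le_mono2; simp)+
  have pcv: "get 0 s 2 = enc_control pc" using c by (simp add: conf_def)
  have 1: "simulates P (pc, S, F) K step1_prog s" if "get 0 s 2 - 1 = 0"
  proof -
    have [simp]: "pc = Step1" using that pcv by (cases pc) auto
    show ?thesis using simulates_mono[OF step1_simulates[OF P pd] K(1)] c by simp
  qed
  have 2: "simulates P (pc, S, F) K step2_prog s" if "get 0 s 2 - 1 \<noteq> 0" "get 0 s 2 - 2 = 0"
  proof -
    have [simp]: "pc = Step2" using that pcv by (cases pc) auto
    show ?thesis using simulates_mono[OF step2_simulates[OF P pd] K(3)] c by simp
  qed
  have 3: "simulates P (pc, S, F) K step3_prog s" if "get 0 s 2 - 2 \<noteq> 0" "get 0 s 2 - 3 = 0"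
  proof -
    have [simp]: "pc = Step3" using that pcv by (cases pc) auto
    show ?thesis using simulates_mono[OF step3_simulates[OF pd] K(1)] c by simp
  qed
  have 4: "simulates P (pc, S, F) K step4_prog s" if "get 0 s 2 - 3 \<noteq> 0" "get 0 s 2 - 4 = 0"
  proof -
    have [simp]: "pc = Step4" using that pcv by (cases pc) auto
    show ?thesis using simulates_mono[OF step4_simulates[OF P pd] K(3)] c by simp
  qed
  have 5: "simulates P (pc, S, F) K step5_prog s" if "get 0 s 2 - 4 \<noteq> 0" "get 0 s 2 - 5 = 0"
  proof -
    have [simp]: "pc = Step5" using that pcv by (cases pc) auto
    have "S \<union> F \<subseteq> vars P" using inv by simp
    then show ?thesis using simulates_mono[OF step5_simulates[OF pd] K(3)] c by simp
  qed
  have 6: "simulates P (pc, S, F) K step6_prog s" if "get 0 s 2 - 5 \<noteq> 0"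
  proof -
    have [simp]: "pc = Step6" using that pcv pc by (cases pc) auto
    show ?thesis using simulates_mono[OF step6_simulates[OF P pd] K(2)] c inv by simp
  qed
  have up: "simulates P (pc, S, F) K p s \<Longrightarrow> simulates P (pc, S, F) (K + e) p s" for p e
    by (erule simulates_mono) (rule le_add1)
  have "simulates P (pc, S, F) (K + 100 + 100 + 100 + 100 + 100) step_prog s"
    unfolding step_prog_def
    apply (rule simulates_If)
      apply (rule simulates_If)
        apply (rule simulates_If)
          apply (rule simulates_If)
            apply (rule simulates_If)
    using 1 2 3 4 5 6 by (auto simp del: diff_is_0_eq simp: add.assoc intro!: up)
  then show ?thesis by (rule simulates_mono) (simp add: K_def)
qed

section \<open>The programs\<close>

lemma conf_same:
  assumes "conf P s c" "same A R s' s" "A \<inter> {4, 5, 8} = {}" "2 \<notin> R"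
  shows "conf P s' c"
proof -
  have "get 4 s' = get 4 s" "get 5 s' = get 5 s" "get 8 s' = get 8 s"
    using assms(3) by (auto intro!: same_get[OF assms(2)])
  then show ?thesis using assms(1) same_reg[OF assms(2,4)] by (simp add: conf_def)
qed

definition init_prog :: com where
  "init_prog = Seq (for_loop 3 (reg 11) (set_arr 4 (reg 3) (Const 0)))
    (Seq (for_loop 3 (reg 11) (set_arr 5 (reg 3) (Const 0)))
    (Seq (for_loop 3 (reg 11) (set_arr 8 (reg 3) fst_var))
    (Seq (set_reg 2 (Const 1)) (set_reg 6 (Add (reg 11) (Const 1))))))"

lemma wp_init_prog:
  assumes pd: "parsed P s"
  shows "wp init_prog (\<lambda>s' t'. t' \<le> t + (length P + 3) * 4000 \<and> parsed P s' \<and>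
    conf P s' proc_start \<and> get 0 s' 6 = Suc (length P)) s t"
  unfolding init_prog_def
proof (rule wp_Seq, rule wp_conseq[OF wp_map_loop[where n = "length P" and X = 4 and K = 300 and v = "\<lambda>_. 0"]])
  show "get 0 s 11 = length P" using pd by (simp add: parsed_def)
  show "wp (set_arr 4 (reg 3) (Const 0)) (\<lambda>s'' t'. t' \<le> t + 300 \<and> s'' = put 4 i 0 s') s' t"
    if "get 0 s' 3 = i" for i s' t
    by (rule wp_set_arr) (use that in simp)
next
  let ?n = "length P"
  let ?Q = "\<lambda>s' t'. t' \<le> t + (length P + 3) * 4000 \<and> parsed P s' \<and>
    conf P s' proc_start \<and> get 0 s' 6 = Suc (length P)"
  fix s1 t1 assume Q1: "t1 \<le> t + (?n + 3) * (300 + 500) \<and> same {4} {3} s1 s \<and> (\<forall>i<?n. get 4 s1 i = 0)"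
  then have sm1: "same {4} {3} s1 s" by blast
  have z1: "holds_set ?n (get 4 s1) {}" using Q1 by (simp add: holds_set_def)
  have pd1: "parsed P s1" by (rule parsed_same[OF pd sm1]) auto
  show "wp (Seq (for_loop 3 (reg 11) (set_arr 5 (reg 3) (Const 0)))
    (Seq (for_loop 3 (reg 11) (set_arr 8 (reg 3) fst_var))
    (Seq (set_reg 2 (Const 1)) (set_reg 6 (Add (reg 11) (Const 1)))))) ?Q s1 t1"
  proof (rule wp_Seq, rule wp_conseq[OF wp_map_loop[where n = "length P" and X = 5 and K = 300 and v = "\<lambda>_. 0"]])
    show "get 0 s1 11 = length P" using pd1 by (simp add: parsed_def)
    show "wp (set_arr 5 (reg 3) (Const 0)) (\<lambda>s'' t'. t' \<le> t + 300 \<and> s'' = put 5 i 0 s') s' t"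
      if "get 0 s' 3 = i" for i s' t
      by (rule wp_set_arr) (use that in simp)
  next
    fix s2 t2
    assume Q2: "t2 \<le> t1 + (?n + 3) * (300 + 500) \<and> same {5} {3} s2 s1 \<and> (\<forall>i<?n. get 5 s2 i = 0)"
    then have sm2: "same {5} {3} s2 s1" by blast
    have z2: "holds_set ?n (get 5 s2) {}" using Q2 by (simp add: holds_set_def)
    have pd2: "parsed P s2" by (rule parsed_same[OF pd1 sm2]) auto
    have g2: "get 4 s2 = get 4 s1" using same_get[OF sm2] by simp
    show "wp (Seq (for_loop 3 (reg 11) (set_arr 8 (reg 3) fst_var))
      (Seq (set_reg 2 (Const 1)) (set_reg 6 (Add (reg 11) (Const 1))))) ?Q s2 t2"
    proof (rule wp_Seq, rule wp_conseq[OF wp_map_loop[where n = "length P" and X = 8 and K = 300 and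
          v = "\<lambda>i. get 9 s2 (Suc (get 3 s2 i))"]])
      show "get 0 s2 11 = length P" using pd2 by (simp add: parsed_def)
      fix i s' t assume i: "same {8} {3} s' s2" "get 0 s' 3 = i"
      have g: "get 9 s' = get 9 s2" "get 3 s' = get 3 s2" using same_get[OF i(1)] by simp_all
      show "wp (set_arr 8 (reg 3) fst_var)
        (\<lambda>s'' t'. t' \<le> t + 300 \<and> s'' = put 8 i (get 9 s2 (Suc (get 3 s2 i))) s') s' t"
        by (rule wp_set_arr) (use i g in simp)
    next
      fix s3 t3
      assume Q3: "t3 \<le> t2 + (?n + 3) * (300 + 500) \<and> same {8} {3} s3 s2 \<and>
        (\<forall>i<?n. get 8 s3 i = get 9 s2 (Suc (get 3 s2 i)))"
      then have sm3: "same {8} {3} s3 s2" by blast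
      have pd3: "parsed P s3" by (rule parsed_same[OF pd2 sm3]) auto
      have mp: "max_policy P (get 8 s3)"
        by (rule max_policy_update[OF pd2 max_policy_first_policy]) (use Q3 in simp)
      have g3: "get 4 s3 = get 4 s2" "get 5 s3 = get 5 s2" using same_get[OF sm3] by simp_all
      have n3: "get 0 s3 11 = ?n" using pd3 by (simp add: parsed_def)
      define s4 where "s4 = put 0 6 (Suc ?n) (put 0 2 1 s3)"
      have sm4: "same {} {2, 6} s4 s3" by (simp add: s4_def)
      have "parsed P s4" by (rule parsed_same[OF pd3 sm4]) auto
      moreover have "conf P s4 proc_start"
        using mp z1 z2 by (simp add: conf_def proc_start_def s4_def g2 g3 policy_positive_empty)
      ultimately show "wp (Seq (set_reg 2 (Const 1)) (set_reg 6 (Add (reg 11) (Const 1)))) ?Q s3 t3"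
        using conjunct1[OF Q1] conjunct1[OF Q2] conjunct1[OF Q3]
        by (intro wp_intros) (simp add: n3 s4_def)
    qed simp_all
  qed simp_all
qed simp_all

definition main_inv :: "pps \<Rightarrow> nat \<Rightarrow> mem \<Rightarrow> bool" where
  "main_inv P m s \<longleftrightarrow> parsed P s \<and> (\<exists>cs pc S F. cs \<noteq> [] \<and> hd cs = proc_start \<and>
     successively (proc_step P) cs \<and> last cs = (pc, S, F) \<and> conf P s (pc, S, F) \<and>
     proc_inv P (pc, S, F) \<and> m = proc_measure P (pc, S, F) \<and>
     length cs + m \<le> Suc (proc_measure P proc_start) \<and>
     get 0 s 6 = Suc (length P) + length (enc_run (length P) cs) \<and>
     outs s (Suc (length P)) (enc_run (length P) cs))"

lemma length_enc_config: "length (enc_config n c) = Suc (n + n)"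
  by (cases c) (simp add: enc_set_def)

lemma wp_main_body:
  assumes P: "max_min_pps P" and I: "main_inv P m s" and nz: "aval (Sub (Const 7) (reg 2)) s \<noteq> 0"
  shows "wp (Seq step_prog emit_config) (\<lambda>s' t'. t' \<le> t + ((length P + 3) * ((length P + 3) * 2100 + 7000) + 500)
    \<and> (\<exists>m'<m. main_inv P m' s')) s t"
proof -
  let ?n = "length P"
  obtain cs pc S F where pd: "parsed P s" and cs: "cs \<noteq> []" "hd cs = proc_start"
    "successively (proc_step P) cs" "last cs = (pc, S, F)" and c: "conf P s (pc, S, F)"
    and inv: "proc_inv P (pc, S, F)" and m: "m = proc_measure P (pc, S, F)"
    and len: "length cs + m \<le> Suc (proc_measure P proc_start)"
    and o: "get 0 s 6 = Suc ?n + length (enc_run ?n cs)" and outs: "outs s (Suc ?n) (enc_run ?n cs)"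
    using I unfolding main_inv_def by blast
  have pc: "pc \<noteq> Halted" using nz c by (auto simp: conf_def)
  show ?thesis
  proof (rule wp_Seq, rule wp_conseq[OF step_simulates[OF P pd c inv pc, unfolded simulates_def, rule_format]])
    fix s1 t1
    assume Q1: "t1 \<le> t + ((?n + 3) * ((?n + 3) * 2100 + 4000) + 500) \<and>
      same {4, 5, 8} {2, 3, 4, 5, 7, 8} s1 s \<and> (\<exists>c'. proc_step P (pc, S, F) c' \<and> conf P s1 c')"
    then have sm1: "same {4, 5, 8} {2, 3, 4, 5, 7, 8} s1 s" by blast
    obtain c' where c': "proc_step P (pc, S, F) c'" "conf P s1 c'" using Q1 by blast
    obtain pc' S' F' where c'_eq: "c' = (pc', S', F')" by (cases c')
    have pd1: "parsed P s1" by (rule parsed_same[OF pd sm1]) auto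
    have o1: "get 0 s1 6 = Suc ?n + length (enc_run ?n cs)" using o same_reg[OF sm1] by simp
    have g1: "get 2 s1 = get 2 s" using same_get[OF sm1] by simp
    have outs1: "outs s1 (Suc ?n) (enc_run ?n cs)" using outs by (simp add: outs_def g1)
    have r1: "get 0 s1 11 = ?n" "get 0 s1 2 = enc_control pc'" "holds_set ?n (get 4 s1) S'"
      "holds_set ?n (get 5 s1) F'"
      using pd1 c'(2) by (simp_all add: parsed_def conf_def c'_eq)
    show "wp emit_config (\<lambda>s' t'. t' \<le> t + ((?n + 3) * ((?n + 3) * 2100 + 7000) + 500)
      \<and> (\<exists>m'<m. main_inv P m' s')) s1 t1"
    proof (rule wp_conseq[OF wp_emit_config[OF o1 r1]])
      fix s2 t2
      assume Q2: "t2 \<le> t1 + (?n + 3) * 3000 \<and> same {2} {3, 6} s2 s1 \<and>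
        get 0 s2 6 = Suc ?n + length (enc_run ?n cs) + Suc (?n + ?n) \<and>
        outs s2 (Suc ?n + length (enc_run ?n cs)) (enc_config ?n (pc', S', F')) \<and>
        (\<forall>x<Suc ?n + length (enc_run ?n cs). get 2 s2 x = get 2 s1 x)"
      then have sm2: "same {2} {3, 6} s2 s1"
        and o2: "get 0 s2 6 = Suc ?n + length (enc_run ?n cs) + Suc (?n + ?n)"
        and outs2: "outs s2 (Suc ?n + length (enc_run ?n cs)) (enc_config ?n c')"
        and keep: "\<And>x. x < Suc ?n + length (enc_run ?n cs) \<Longrightarrow> get 2 s2 x = get 2 s1 x"
        unfolding c'_eq by blast+
      let ?cs = "cs @ [c']"
      have run: "enc_run ?n ?cs = enc_run ?n cs @ enc_config ?n c'" by (simp add: enc_run_def)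
      have "outs s2 (Suc ?n) (enc_run ?n cs)" by (rule outs_cong[OF outs1 keep])
      then have "outs s2 (Suc ?n) (enc_run ?n ?cs)" using outs2 by (simp add: run outs_append)
      moreover have "get 0 s2 6 = Suc ?n + length (enc_run ?n ?cs)"
        using o2 by (simp add: run length_enc_config)
      moreover have "parsed P s2" by (rule parsed_same[OF pd1 sm2]) auto
      moreover have "conf P s2 (pc', S', F')"
        unfolding c'_eq[symmetric] by (rule conf_same[OF c'(2) sm2]) auto
      moreover have "proc_inv P (pc', S', F')"
        unfolding c'_eq[symmetric] by (rule proc_inv_step[OF c'(1) inv])
      moreover have mm: "proc_measure P (pc', S', F') < m"
        unfolding c'_eq[symmetric] m by (rule proc_measure_step[OF c'(1) inv])
      moreover have "length ?cs + proc_measure P (pc', S', F') \<le> Suc (proc_measure P proc_start)"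
        using len mm by simp
      moreover have "?cs \<noteq> []" "hd ?cs = proc_start" "last ?cs = (pc', S', F')"
        using cs c'_eq by simp_all
      moreover have "successively (proc_step P) ?cs"
        using cs c'(1) by (simp add: successively_append_iff)
      ultimately have "main_inv P (proc_measure P (pc', S', F')) s2"
        unfolding main_inv_def by blast
      then have "\<exists>m'<m. main_inv P m' s2" using mm by blast
      moreover have "t2 \<le> t + ((?n + 3) * ((?n + 3) * 2100 + 7000) + 500)"
        using conjunct1[OF Q1] conjunct1[OF Q2] by (simp add: algebra_simps)
      ultimately show "t2 \<le> t + ((?n + 3) * ((?n + 3) * 2100 + 7000) + 500)
        \<and> (\<exists>m'<m. main_inv P m' s2)" by blast
    qed
  qed
qed

definition core_prog :: com where
  "core_prog = Seq parse_prog (Seq init_prog (Seq emit_config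
    (While_nz (Sub (Const 7) (reg 2)) (Seq step_prog emit_config))))"

definition core_cost :: "nat \<Rightarrow> nat \<Rightarrow> nat" where
  "core_cost n B = (n + 3) * ((n + 4) * (3 * B + 2000) + 500) + (n + 3) * 7000 +
     (20 * (n + 1)\<^sup>2 + 1) * ((n + 3) * ((n + 3) * 2100 + 7000) + 600)"

definition core_result :: "pps \<Rightarrow> mem \<Rightarrow> bool" where
  "core_result P s \<longleftrightarrow> get 0 s 11 = length P \<and> (\<exists>cs S F. proc_run P cs F \<and>
     length cs \<le> 20 * (length P + 1)\<^sup>2 + 1 \<and> conf P s (Halted, S, F) \<and> proc_inv P (Halted, S, F) \<and>
     get 0 s 6 = Suc (length P) + length (enc_run (length P) cs) \<and>
     outs s (Suc (length P)) (enc_run (length P) cs))"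

lemma wp_core_prog:
  assumes P: "max_min_pps P" and inp: "input_at (enc_pps P) s"
    and bits: "\<And>x. bits (get 9 s x) \<le> B"
  shows "wp core_prog (\<lambda>s' t'. t' \<le> t + core_cost (length P) B \<and> core_result P s') s t"
  unfolding core_prog_def
proof (rule wp_Seq, rule wp_conseq[OF wp_parse_prog[OF P inp bits]], rule wp_Seq)
  let ?n = "length P"
  let ?Q = "\<lambda>s' t'. t' \<le> t + core_cost ?n B \<and> core_result P s'"
  let ?W = "While_nz (Sub (Const 7) (reg 2)) (Seq step_prog emit_config)"
  fix s1 t1 assume Q1: "t1 \<le> t + (?n + 3) * ((?n + 4) * (3 * B + 2000) + 500) \<and> parsed P s1"
  show "wp init_prog (wp (Seq emit_config ?W) ?Q) s1 t1"
  proof (rule wp_conseq[OF wp_init_prog[OF conjunct2[OF Q1]]], rule wp_Seq)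
    fix s2 t2 assume Q2: "t2 \<le> t1 + (?n + 3) * 4000 \<and> parsed P s2 \<and> conf P s2 proc_start \<and>
      get 0 s2 6 = Suc ?n"
    then have pd2: "parsed P s2" and c2: "conf P s2 proc_start" and o2: "get 0 s2 6 = Suc ?n" by blast+
    have r2: "get 0 s2 11 = ?n" "get 0 s2 2 = enc_control Step1" "holds_set ?n (get 4 s2) {}"
      "holds_set ?n (get 5 s2) {}"
      using pd2 c2 by (simp_all add: parsed_def conf_def proc_start_def)
    show "wp emit_config (wp ?W ?Q) s2 t2"
    proof (rule wp_conseq[OF wp_emit_config[OF o2 r2]])
      fix s3 t3
      assume Q3: "t3 \<le> t2 + (?n + 3) * 3000 \<and> same {2} {3, 6} s3 s2 \<and>
        get 0 s3 6 = Suc ?n + Suc (?n + ?n) \<and> outs s3 (Suc ?n) (enc_config ?n (Step1, {}, {})) \<and>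
        (\<forall>x<Suc ?n. get 2 s3 x = get 2 s2 x)"
      then have sm3: "same {2} {3, 6} s3 s2" and o3: "get 0 s3 6 = Suc ?n + Suc (?n + ?n)"
        and outs3: "outs s3 (Suc ?n) (enc_config ?n (Step1, {}, {}))" by blast+
      have pd3: "parsed P s3" by (rule parsed_same[OF pd2 sm3]) auto
      have c3: "conf P s3 proc_start" by (rule conf_same[OF c2 sm3]) auto
      have run: "enc_run ?n [proc_start] = enc_config ?n (Step1, {}, {})"
        by (simp add: enc_run_def proc_start_def)
      have "main_inv P (proc_measure P proc_start) s3"
        unfolding main_inv_def
      proof (intro conjI exI[of _ "[proc_start]"] exI[of _ Step1] exI[of _ "{}"])
        show "proc_inv P (Step1, {}, {})" using proc_inv_start[of P] by (simp only: proc_start_def)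
        show "get 0 s3 6 = Suc ?n + length (enc_run ?n [proc_start])"
          unfolding run length_enc_config by (rule o3)
        show "outs s3 (Suc ?n) (enc_run ?n [proc_start])" unfolding run by (rule outs3)
        show "conf P s3 (Step1, {}, {})" using c3 by (simp only: proc_start_def)
      qed (simp_all add: pd3 proc_start_def del: proc_measure.simps)
      then show "wp ?W ?Q s3 t3"
      proof (rule wp_While[where E = 50 and K = "(?n + 3) * ((?n + 3) * 2100 + 7000) + 500"])
        show "ucost (Sub (Const 7) (reg 2)) s \<le> 50" for s by simp
      next
        fix m s' t' assume "main_inv P m s'" "aval (Sub (Const 7) (reg 2)) s' \<noteq> 0"
        then show "wp (Seq step_prog emit_config) (\<lambda>s'' t''. t'' \<le> t' + ((?n + 3) * ((?n + 3) * 2100 + 7000) + 500)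
          \<and> (\<exists>m'<m. main_inv P m' s'')) s' t'"
          by (rule wp_main_body[OF P])
      next
        fix m s4 t4 assume I: "main_inv P m s4" and z: "aval (Sub (Const 7) (reg 2)) s4 = 0"
          and t4: "t4 \<le> t3 + (proc_measure P proc_start + 1) *
            ((?n + 3) * ((?n + 3) * 2100 + 7000) + 500 + 50 + 1)"
        obtain cs pc S F where pd: "parsed P s4" and cs: "cs \<noteq> []" "hd cs = proc_start"
          "successively (proc_step P) cs" "last cs = (pc, S, F)" and c: "conf P s4 (pc, S, F)"
          and inv: "proc_inv P (pc, S, F)"
          and len: "length cs + m \<le> Suc (proc_measure P proc_start)"
          and o: "get 0 s4 6 = Suc ?n + length (enc_run ?n cs)"
          and outs: "outs s4 (Suc ?n) (enc_run ?n cs)"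
          using I unfolding main_inv_def by blast
        have pc: "pc = Halted" using z c by (cases pc) (simp_all add: conf_def)
        have "proc_run P cs F" using cs pc by (auto simp: proc_run_def)
        moreover have "length cs \<le> 20 * (?n + 1)\<^sup>2 + 1" using len proc_measure_start[of P] by linarith
        ultimately have res: "core_result P s4"
          using pd c inv o outs unfolding core_result_def pc parsed_def by blast
        have "(proc_measure P proc_start + 1) * ((?n + 3) * ((?n + 3) * 2100 + 7000) + 500 + 50 + 1)
          \<le> (20 * (?n + 1)\<^sup>2 + 1) * ((?n + 3) * ((?n + 3) * 2100 + 7000) + 600)"
          using proc_measure_start[of P] by (intro mult_le_mono) auto
        moreover have "(?n + 3) * 7000 = (?n + 3) * 4000 + (?n + 3) * 3000" by simp
        moreover have "t4 \<le> t + (a + b + y)"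
          if "t4 \<le> t3 + x" "x \<le> y" "b = b1 + b2" "t1 \<le> t + a" "t2 \<le> t1 + b1" "t3 \<le> t2 + b2"
          for a b b1 b2 x y
          using that by linarith
        ultimately have "t4 \<le> t + core_cost ?n B"
          using t4 conjunct1[OF Q1] conjunct1[OF Q2] conjunct1[OF Q3] unfolding core_cost_def by blast
        with res show "?Q s4 t4" by blast
      qed
    qed
  qed
qed

definition proc_tail :: com where
  "proc_tail = Seq (set_arr 2 (reg 6) (Const 0)) (Seq (set_reg 6 (Const 1)) (emit_arr 5))"

definition policy_tail :: com where
  "policy_tail = Seq (set_reg 6 (Const 1)) (Seq (emit_arr 8) (set_arr 2 (reg 6) (Const 0)))"

definition output_at :: "nat list \<Rightarrow> mem \<Rightarrow> bool" where
  "output_at ys s \<longleftrightarrow> outs s 1 ys \<and> get 2 s (Suc (length ys)) = 0"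

lemma wp_proc_tail:
  assumes n: "get 0 s 11 = n" and o: "get 0 s 6 = Suc n + length ys"
    and outs: "outs s (Suc n) ys" and F: "holds_set n (get 5 s) F"
  shows "wp proc_tail (\<lambda>s' t'. t' \<le> t + (n + 3) * 1500 \<and> output_at (enc_set n F @ ys) s') s t"
  unfolding proc_tail_def
proof (intro wp_Seq wp_set_arr)
  define s1 where "s1 = put 0 6 1 (put 2 (Suc n + length ys) 0 s)"
  have eq: "put 0 (aval (Const 6) (put 2 (aval (reg 6) s) (aval (Const 0) s) s))
    (aval (Const 1) (put 2 (aval (reg 6) s) (aval (Const 0) s) s))
    (put 2 (aval (reg 6) s) (aval (Const 0) s) s) = s1"
    using o by (simp add: s1_def)
  show "wp (emit_arr 5) (\<lambda>s' t'. t' \<le> t + (n + 3) * 1500 \<and> output_at (enc_set n F @ ys) s')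
    (put 0 (aval (Const 6) (put 2 (aval (reg 6) s) (aval (Const 0) s) s))
      (aval (Const 1) (put 2 (aval (reg 6) s) (aval (Const 0) s) s))
      (put 2 (aval (reg 6) s) (aval (Const 0) s) s))
    (t + (ucost (reg 6) s + ucost (Const 0) s + 2 + 26) +
     (ucost (Const 6) (put 2 (aval (reg 6) s) (aval (Const 0) s) s) +
      ucost (Const 1) (put 2 (aval (reg 6) s) (aval (Const 0) s) s) + 0 + 26))"
    unfolding eq
  proof (rule wp_conseq[OF wp_emit_arr[where b = 1 and n = n]])
    fix s2 t2
    assume Q: "t2 \<le> t + (ucost (reg 6) s + ucost (Const 0) s + 2 + 26) +
     (ucost (Const 6) (put 2 (aval (reg 6) s) (aval (Const 0) s) s) +
      ucost (Const 1) (put 2 (aval (reg 6) s) (aval (Const 0) s) s) + 0 + 26) + (n + 3) * 1000 \<and>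
      same {2} {3, 6} s2 s1 \<and> get 0 s2 6 = 1 + n \<and> outs s2 1 (map (get 5 s1) [0..<n]) \<and>
      (\<forall>x. x < 1 \<or> 1 + n \<le> x \<longrightarrow> get 2 s2 x = get 2 s1 x)"
    then have outs2: "outs s2 1 (map (get 5 s1) [0..<n])"
      and keep: "\<And>x. 1 + n \<le> x \<Longrightarrow> get 2 s2 x = get 2 s1 x" by blast+
    have F1: "map (get 5 s1) [0..<n] = enc_set n F"
      using holds_set_enc_set[OF F] by (simp add: s1_def)
    have len: "length (enc_set n F) = n" by (simp add: enc_set_def)
    have "outs s2 (Suc n) ys"
    proof (rule outs_cong[OF outs])
      fix x assume x: "Suc n \<le> x" "x < Suc n + length ys"
      then show "get 2 s2 x = get 2 s x" using keep[of x] by (simp add: s1_def)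
    qed
    then have "outs s2 1 (enc_set n F @ ys)"
      using outs2 by (simp add: outs_append F1 len)
    moreover have "get 2 s2 (Suc n + length ys) = 0"
      using keep[of "Suc n + length ys"] by (simp add: s1_def)
    ultimately have "output_at (enc_set n F @ ys) s2" by (simp add: output_at_def len)
    then show "t2 \<le> t + (n + 3) * 1500 \<and> output_at (enc_set n F @ ys) s2"
      using conjunct1[OF Q] by simp
  qed (use n in \<open>simp_all add: s1_def\<close>)
qed

lemma wp_policy_tail:
  assumes n: "get 0 s 11 = n"
  shows "wp policy_tail (\<lambda>s' t'. t' \<le> t + (n + 3) * 1500 \<and> output_at (enc_policy n (get 8 s)) s') s t"
  unfolding policy_tail_def
proof (rule wp_Seq, rule wp_set_arr, rule wp_Seq, rule wp_conseq[OF wp_emit_arr[where b = 1 and n = n]])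
  let ?s1 = "put 0 (aval (Const 6) s) (aval (Const 1) s) s"
  fix s2 t2
  assume Q: "t2 \<le> t + (ucost (Const 6) s + ucost (Const 1) s + 0 + 26) + (n + 3) * 1000 \<and>
      same {2} {3, 6} s2 ?s1 \<and> get 0 s2 6 = 1 + n \<and> outs s2 1 (map (get 8 ?s1) [0..<n]) \<and>
      (\<forall>x. x < 1 \<or> 1 + n \<le> x \<longrightarrow> get 2 s2 x = get 2 ?s1 x)"
  then have outs2: "outs s2 1 (map (get 8 ?s1) [0..<n])" and o2: "get 0 s2 6 = Suc n" by simp_all
  have "output_at (enc_policy n (get 8 s)) (put 2 (Suc n) 0 s2)"
    using outs2 by (simp add: output_at_def outs_def enc_policy_def)
  then show "wp (set_arr 2 (reg 6) (Const 0))
    (\<lambda>s' t'. t' \<le> t + (n + 3) * 1500 \<and> output_at (enc_policy n (get 8 s)) s') s2 t2"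
    using conjunct1[OF Q] by (intro wp_set_arr) (simp add: o2)
qed (use n in simp_all)

text \<open>Until the input has been moved, and again while the output is moved back, no address except
  0 is known to be free, so the loop counter is kept there.  The end of the output is
  recognised by a zero, all output values having been incremented.\<close>

definition shift_in :: com where
  "shift_in = While_nz (Mem (Const 0))
    (Seq (set_arr 9 (Mem (Const 0)) (Mem (Mem (Const 0))))
    (Store (Const 0) (Sub (Mem (Const 0)) (Const 1))))"

definition in_inv :: "nat list \<Rightarrow> nat \<Rightarrow> nat \<Rightarrow> mem \<Rightarrow> bool" where
  "in_inv xs B m s \<longleftrightarrow> s 0 = m \<and> m \<le> length xs \<and> (\<forall>l<m. s (Suc l) = xs ! l) \<and>
     (\<forall>l<length xs. m \<le> l \<longrightarrow> get 9 s (Suc l) = xs ! l) \<and> (\<forall>a. bits (s a) \<le> B)"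

lemma wp_shift_in:
  assumes bits: "\<And>a. bits (load xs a) \<le> B"
  shows "wp shift_in (\<lambda>s' t'. t' \<le> t + (length xs + 1) * 200 \<and> input_at xs s' \<and>
    (\<forall>a. bits (s' a) \<le> B)) (load xs) t"
  unfolding shift_in_def
proof (rule wp_While[where m = "length xs" and E = 10 and K = 150 and I = "in_inv xs B"])
  fix m s t
  assume I: "in_inv xs B m s" and nz: "aval (Mem (Const 0)) s \<noteq> 0"
  then have s0: "s 0 = m" and mN: "m \<le> length xs" and lo: "\<And>l. l < m \<Longrightarrow> s (Suc l) = xs ! l"
    and hi: "\<And>l. l < length xs \<Longrightarrow> m \<le> l \<Longrightarrow> get 9 s (Suc l) = xs ! l" and b: "\<And>a. bits (s a) \<le> B"
    unfolding in_inv_def by blast+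
  obtain k where k: "m = Suc k" using nz s0 by (cases m) auto
  define s1 where "s1 = (put 9 m (s m) s)(0 := k)"
  have "s1 (Suc l) = xs ! l" if "l < k" for l
    using lo[of l] that k by (simp add: s1_def put_def)
  moreover have "get 9 s1 (Suc l) = xs ! l" if "l < length xs" "k \<le> l" for l
  proof (cases "l = k")
    case True
    then show ?thesis using lo[of k] k by (simp add: s1_def put_def get_def)
  next
    case False
    then show ?thesis using hi[of l] that k by (simp add: s1_def put_def get_def)
  qed
  moreover have "bits (s1 a) \<le> B" for a
    using b[of a] b[of m] b[of 0] bits_mono[of k m] s0 k by (simp add: s1_def put_def)
  moreover have "s1 0 = k" "k \<le> length xs" using mN k by (simp_all add: s1_def)
  ultimately have "in_inv xs B k s1" unfolding in_inv_def by blast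
  then have post: "\<exists>m'<m. in_inv xs B m' s1" using k by blast
  have put0: "put 9 (Suc k) v s 0 = Suc k" for v using s0 k by (simp add: put_def)
  show "wp (Seq (set_arr 9 (Mem (Const 0)) (Mem (Mem (Const 0))))
    (Store (Const 0) (Sub (Mem (Const 0)) (Const 1))))
    (\<lambda>s' t'. t' \<le> t + 150 \<and> (\<exists>m'<m. in_inv xs B m' s')) s t"
    by (rule wp_Seq, rule wp_set_arr, rule wp_Store) (use post k in \<open>simp add: s1_def s0 put0\<close>)
next
  fix m s t'
  assume I: "in_inv xs B m s" and z: "aval (Mem (Const 0)) s = 0"
    and t': "t' \<le> t + (length xs + 1) * (150 + 10 + 1)"
  have "input_at xs s" using I z by (simp add: input_at_def in_inv_def)
  then show "t' \<le> t + (length xs + 1) * 200 \<and> input_at xs s \<and> (\<forall>a. bits (s a) \<le> B)"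
    using I t' by (auto simp: in_inv_def)
qed (use bits in \<open>auto simp: load_def in_inv_def\<close>)

definition shift_out :: com where
  "shift_out = Seq (Store (Const 0) (Const 1))
    (Seq (While_nz (arr 2 (Mem (Const 0)))
      (Seq (Store (Mem (Const 0)) (Sub (arr 2 (Mem (Const 0))) (Const 1)))
      (Store (Const 0) (Add (Mem (Const 0)) (Const 1)))))
    (Store (Const 0) (Sub (Mem (Const 0)) (Const 1))))"

definition out_inv :: "nat list \<Rightarrow> nat \<Rightarrow> mem \<Rightarrow> bool" where
  "out_inv ys m s \<longleftrightarrow> (\<exists>k. m + k = length ys \<and> s 0 = Suc k \<and> (\<forall>l<k. s (Suc l) = ys ! l) \<and>
     (\<forall>l<length ys. k \<le> l \<longrightarrow> get 2 s (Suc l) = Suc (ys ! l)) \<and> get 2 s (Suc (length ys)) = 0)"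

lemma wp_shift_out:
  assumes out: "output_at ys s"
  shows "wp shift_out (\<lambda>s' t'. t' \<le> t + (length ys + 1) * 200 + 100 \<and> holds_list s' ys) s t"
  unfolding shift_out_def
proof (rule wp_Seq, rule wp_Store, rule wp_Seq, rule wp_While[where m = "length ys" and E = 50 and K = 100 and
      I = "out_inv ys"])
  have "get 2 s (Suc l) = Suc (ys ! l)" if "l < length ys" for l
    using out that by (simp add: output_at_def outs_def)
  moreover have "get 2 s (Suc (length ys)) = 0" using out by (simp add: output_at_def)
  ultimately show "out_inv ys (length ys) (s(aval (Const 0) s := aval (Const 1) s))"
    by (simp add: out_inv_def get_def)
next
  show "ucost (arr 2 (Mem (Const 0))) s \<le> 50" for s by simp
next
  fix m s t assume I: "out_inv ys m s" and nz: "aval (arr 2 (Mem (Const 0))) s \<noteq> 0"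
  then obtain k where k: "m + k = length ys" and s0: "s 0 = Suc k"
    and lo: "\<And>l. l < k \<Longrightarrow> s (Suc l) = ys ! l"
    and hi: "\<And>l. l < length ys \<Longrightarrow> k \<le> l \<Longrightarrow> get 2 s (Suc l) = Suc (ys ! l)"
    and sent: "get 2 s (Suc (length ys)) = 0" unfolding out_inv_def by blast
  have km: "0 < m" using nz s0 sent k by (cases m) auto
  define s1 where "s1 = s(Suc k := ys ! k, 0 := Suc (Suc k))"
  have frame: "get 2 s1 (Suc l) = get 2 s (Suc l)" if "k \<le> l" for l
    using that by (simp add: s1_def get_def)
  have "s1 (Suc l) = ys ! l" if "l < Suc k" for l
    using lo[of l] that by (cases "l = k") (simp_all add: s1_def)
  moreover have "get 2 s1 (Suc l) = Suc (ys ! l)" if "l < length ys" "Suc k \<le> l" for l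
    using hi[of l] frame[of l] that by simp
  moreover have "get 2 s1 (Suc (length ys)) = 0" using sent frame[of "length ys"] k by simp
  moreover have "(m - 1) + Suc k = length ys" "s1 0 = Suc (Suc k)" using k km by (simp_all add: s1_def)
  ultimately have "out_inv ys (m - 1) s1" unfolding out_inv_def by blast
  then have post: "\<exists>m'<m. out_inv ys m' s1" using km by (intro exI[of _ "m - 1"]) simp
  have v: "get 2 s (Suc k) - 1 = ys ! k" using hi[of k] k km by simp
  show "wp (Seq (Store (Mem (Const 0)) (Sub (arr 2 (Mem (Const 0))) (Const 1)))
      (Store (Const 0) (Add (Mem (Const 0)) (Const 1))))
      (\<lambda>s' t'. t' \<le> t + 100 \<and> (\<exists>m'<m. out_inv ys m' s')) s t"
    by (rule wp_Seq, rule wp_Store, rule wp_Store) (use post v s0 in \<open>simp add: s1_def\<close>)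
next
  fix m s2 t2 assume I: "out_inv ys m s2" and z: "aval (arr 2 (Mem (Const 0))) s2 = 0"
    and t2: "t2 \<le> t + (ucost (Const 0) s + ucost (Const 1) s + 1) + (length ys + 1) * (100 + 50 + 1)"
  obtain k where k: "m + k = length ys" and s0: "s2 0 = Suc k"
    and lo: "\<And>l. l < k \<Longrightarrow> s2 (Suc l) = ys ! l"
    and hi: "\<And>l. l < length ys \<Longrightarrow> k \<le> l \<Longrightarrow> get 2 s2 (Suc l) = Suc (ys ! l)"
    using I unfolding out_inv_def by blast
  have "k = length ys"
  proof (rule ccontr)
    assume "k \<noteq> length ys"
    then have "get 2 s2 (Suc k) = Suc (ys ! k)" using hi[of k] k by simp
    then show False using z s0 by simp
  qed
  then have "holds_list (s2(0 := k)) ys" using lo by (simp add: holds_list_def)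
  then show "wp (Store (Const 0) (Sub (Mem (Const 0)) (Const 1)))
    (\<lambda>s' t'. t' \<le> t + (length ys + 1) * 200 + 100 \<and> holds_list s' ys) s2 t2"
    using t2 s0 by (intro wp_Store) simp
qed

lemma computes_withinI:
  assumes wp: "wp c (\<lambda>s' t'. t' \<le> K \<and> holds_list s' ys) (load xs) 0"
    and b: "\<And>a. bits (load xs a) \<le> b" and len: "length ys \<le> K"
  shows "computes_within c xs ys (3 * K * (b + K))"
proof -
  obtain s' k where runs: "runs c (load xs) k s'" and k: "k \<le> K" and ys: "holds_list s' ys"
    using wp unfolding wp_def by auto
  obtain t where ex: "exec c (load xs) t s'"
    and t: "t \<le> 2 * K * (b + K) \<and> (\<forall>a. bits (s' a) \<le> b + K)"
    using runs_mono[OF runs k] b unfolding runs_def by blast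
  have "bits y \<le> b + K" if y: "y \<in> set ys" for y
  proof -
    obtain i where "i < length ys" "y = ys ! i" using y by (auto simp: in_set_conv_nth)
    then have "y = s' (Suc i)" using ys by (simp add: holds_list_def)
    then show ?thesis using t by simp
  qed
  then have "sum_list (map bits ys) \<le> sum_list (map (\<lambda>_. b + K) ys)" by (intro sum_list_mono)
  also have "\<dots> = length ys * (b + K)" by (simp add: sum_list_triv)
  also have "\<dots> \<le> K * (b + K)" using len by (intro mult_right_mono) auto
  finally have "t + sum_list (map bits ys) \<le> 3 * K * (b + K)" using t by (simp add: algebra_simps)
  then show ?thesis using ex ys unfolding computes_within_def by blast
qed

lemma length_le_sum_bits: "length xs \<le> sum_list (map bits xs)"
proof (induction xs)
  case (Cons x xs)
  then show ?case using bits_ge_1[of x] by simp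
qed simp

lemma bits_load_le:
  assumes "xs \<noteq> []"
  shows "bits (load xs a) \<le> sum_list (map bits xs)"
proof -
  have len: "length xs \<le> sum_list (map bits xs)" by (rule length_le_sum_bits)
  have pos: "1 \<le> length xs" using assms by (simp add: Suc_le_eq)
  have l: "bits (length xs) \<le> length xs"
    using pos less_exp[of "length xs"] by (simp add: bits_le_iff)
  have e: "bits (xs ! i) \<le> sum_list (map bits xs)" if "i < length xs" for i
    using that by (intro member_le_sum_list) auto
  have z: "bits 0 \<le> length xs" using pos by (simp add: bits_le_iff)
  show ?thesis using l e[of "a - 1"] z len by (auto simp: load_def)
qed

lemma length_le_pps_size: "length P \<le> pps_size P" "length (enc_pps P) \<le> pps_size P"
proof -
  show 1: "length (enc_pps P) \<le> pps_size P" unfolding pps_size_def by (rule length_le_sum_bits)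
  have ne: "1 \<le> length (enc_snf e)" for e by (cases e) auto
  have "length P \<le> length (concat (map enc_snf P))"
  proof (induction P)
    case (Cons e P)
    then show ?case using ne[of e] by simp
  qed simp
  then show "length P \<le> pps_size P" using 1 by (simp add: enc_pps_def)
qed

definition full_cost :: "nat \<Rightarrow> nat" where
  "full_cost m = 1000000 * (m + 4) ^ 4"

lemma core_cost_le:
  assumes "n \<le> m"
  shows "(m + 1) * 200 + core_cost n m + (n + 3) * 1500 +
    ((n + (20 * (n + 1)\<^sup>2 + 1) * Suc (n + n)) + 1) * 200 + 100 \<le> full_cost m"
    and "n + (20 * (n + 1)\<^sup>2 + 1) * Suc (n + n) \<le> full_cost m"
proof -
  define M where "M = m + 4"
  have M: "n + 3 \<le> M" "n + 4 \<le> M" "n + 1 \<le> M" "n \<le> M" "m + 1 \<le> M" "m \<le> M" "1 \<le> M" "Suc (n + n) \<le> 2 * M"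
    using assms by (simp_all add: M_def)
  have p: "1 \<le> M ^ 4" "M \<le> M ^ 4" "M ^ 2 \<le> M ^ 4" "M ^ 3 \<le> M ^ 4" "M \<le> M ^ 2" "1 \<le> M ^ 2"
    using M(7) power_increasing[of 1 4 M] power_increasing[of 2 4 M] power_increasing[of 3 4 M]
      power_increasing[of 1 2 M] by simp_all
  have "3 * m + 2000 \<le> 2003 * M" using M by linarith
  then have "(n + 4) * (3 * m + 2000) + 500 \<le> M * (2003 * M) + 500 * M ^ 2"
    using M p by (intro add_mono mult_le_mono) auto
  then have c1: "(n + 3) * ((n + 4) * (3 * m + 2000) + 500) \<le> M * (2503 * M ^ 2)"
    using M by (intro mult_le_mono) (auto simp: power2_eq_square)
  have "(n + 1)\<^sup>2 \<le> M ^ 2" using M by (intro power_mono) auto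
  then have sq: "20 * (n + 1)\<^sup>2 + 1 \<le> 21 * M ^ 2" using p by linarith
  have "(n + 3) * 2100 \<le> M * 2100" using M(1) by (rule mult_right_mono) simp
  then have "(n + 3) * 2100 + 7000 \<le> 9100 * M" using M(7) by simp
  then have "(n + 3) * ((n + 3) * 2100 + 7000) + 600 \<le> M * (9100 * M) + 600 * M ^ 2"
    using M p by (intro add_mono mult_le_mono) auto
  then have "(n + 3) * ((n + 3) * 2100 + 7000) + 600 \<le> 9700 * M ^ 2" by (simp add: power2_eq_square)
  then have c2: "(20 * (n + 1)\<^sup>2 + 1) * ((n + 3) * ((n + 3) * 2100 + 7000) + 600)
    \<le> (21 * M ^ 2) * (9700 * M ^ 2)"
    using sq by (intro mult_le_mono)
  have core: "core_cost n m \<le> 2503 * M ^ 3 + 7000 * M + 203700 * M ^ 4"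
  proof -
    have "M * (2503 * M ^ 2) = 2503 * M ^ 3" by (simp add: power2_eq_square power3_eq_cube)
    moreover have "(21 * M ^ 2) * (9700 * M ^ 2) = 203700 * M ^ 4"
      by (simp add: power2_eq_square power4_eq_xxxx)
    moreover have "(n + 3) * 7000 \<le> 7000 * M" using M(1) by simp
    ultimately show ?thesis unfolding core_cost_def using c1 c2 by linarith
  qed
  have out: "(20 * (n + 1)\<^sup>2 + 1) * Suc (n + n) \<le> 42 * M ^ 3"
  proof -
    have "(20 * (n + 1)\<^sup>2 + 1) * Suc (n + n) \<le> (21 * M ^ 2) * (2 * M)"
      using sq M by (intro mult_le_mono) auto
    then show ?thesis by (simp add: power2_eq_square power3_eq_cube)
  qed
  have lin: "(m + 1) * 200 \<le> 200 * M" "(n + 3) * 1500 \<le> 1500 * M" using M by simp_all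
  have small: "n \<le> M ^ 4" using M(4) p(2) by (rule order_trans)
  have dist: "(n + x + 1) * 200 = 200 * n + 200 * x + 200" for x :: nat by simp
  show "(m + 1) * 200 + core_cost n m + (n + 3) * 1500 +
    ((n + (20 * (n + 1)\<^sup>2 + 1) * Suc (n + n)) + 1) * 200 + 100 \<le> full_cost m"
    unfolding full_cost_def M_def[symmetric] dist
    using core out lin small p(1,2,4) by linarith
  show "n + (20 * (n + 1)\<^sup>2 + 1) * Suc (n + n) \<le> full_cost m"
    unfolding full_cost_def M_def[symmetric] using out small p(1,4) by linarith
qed

lemma length_enc_run: "length (enc_run n cs) = length cs * Suc (n + n)"
  by (induction cs) (simp_all add: enc_run_def length_enc_config)

definition proc_com :: com where
  "proc_com = Seq shift_in (Seq core_prog (Seq proc_tail shift_out))"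

definition policy_com :: com where
  "policy_com = Seq shift_in (Seq core_prog (Seq policy_tail shift_out))"

lemma wp_shift_core:
  assumes P: "max_min_pps P"
    and post: "\<And>s t. t \<le> (pps_size P + 1) * 200 + core_cost (length P) (pps_size P) \<Longrightarrow>
      core_result P s \<Longrightarrow> wp c Q s t"
  shows "wp (Seq shift_in (Seq core_prog c)) Q (load (enc_pps P)) 0"
proof -
  let ?m = "pps_size P"
  have b: "bits (load (enc_pps P) a) \<le> ?m" for a
    unfolding pps_size_def by (rule bits_load_le) (simp add: enc_pps_def)
  show ?thesis
  proof (rule wp_Seq, rule wp_conseq[OF wp_shift_in[OF b]], rule wp_Seq)
    fix s1 t1 assume Q1: "t1 \<le> 0 + (length (enc_pps P) + 1) * 200 \<and> input_at (enc_pps P) s1 \<and>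
      (\<forall>a. bits (s1 a) \<le> ?m)"
    have "(length (enc_pps P) + 1) * 200 \<le> (?m + 1) * 200"
      using length_le_pps_size(2)[of P] by (intro mult_right_mono) auto
    then have t1: "t1 \<le> (?m + 1) * 200" using conjunct1[OF Q1] by linarith
    show "wp core_prog (wp c Q) s1 t1"
    proof (rule wp_conseq[OF wp_core_prog[OF P, where B = ?m]])
      show "input_at (enc_pps P) s1" using Q1 by blast
      show "bits (get 9 s1 x) \<le> ?m" for x unfolding get_def using Q1 by blast
    next
      fix s2 t2 assume "t2 \<le> t1 + core_cost (length P) ?m \<and> core_result P s2"
      then show "wp c Q s2 t2" using t1 by (intro post) auto
    qed
  qed
qed

lemma wp_exE: "wp c (\<lambda>s t. \<exists>x. R x s t) s t \<Longrightarrow> \<exists>x. wp c (R x) s t"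
  unfolding wp_def by blast

lemma wp_conj_const: "wp c (\<lambda>s t. A \<and> R s t) s t \<Longrightarrow> A \<and> wp c R s t"
  unfolding wp_def by blast

definition time_bound :: "nat \<Rightarrow> nat" where
  "time_bound m = 3 * full_cost m * (m + full_cost m)"

lemma proc_com_computes:
  assumes P: "max_min_pps P"
  shows "\<exists>cs F. proc_run P cs F \<and> computes_within proc_com (enc_pps P)
    (enc_set (length P) F @ enc_run (length P) cs) (time_bound (pps_size P))"
proof -
  let ?n = "length P" and ?m = "pps_size P"
  let ?out = "\<lambda>cs F. enc_set ?n F @ enc_run ?n cs"
  have nm: "?n \<le> ?m" by (rule length_le_pps_size)
  have "wp proc_com (\<lambda>s t. \<exists>x. (proc_run P (fst x) (snd x) \<and> length (?out (fst x) (snd x)) \<le> full_cost ?m) \<and>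
      t \<le> full_cost ?m \<and> holds_list s (?out (fst x) (snd x))) (load (enc_pps P)) 0"
    unfolding proc_com_def
  proof (rule wp_shift_core[OF P], rule wp_Seq)
    fix s t assume t: "t \<le> (?m + 1) * 200 + core_cost ?n ?m" and "core_result P s"
    then obtain cs S F where n: "get 0 s 11 = ?n" and run: "proc_run P cs F"
      and len: "length cs \<le> 20 * (?n + 1)\<^sup>2 + 1" and c: "conf P s (Halted, S, F)"
      and o: "get 0 s 6 = Suc ?n + length (enc_run ?n cs)" and outs: "outs s (Suc ?n) (enc_run ?n cs)"
      unfolding core_result_def by blast
    have F: "holds_set ?n (get 5 s) F" using c by (simp add: conf_def)
    have "length cs * Suc (?n + ?n) \<le> (20 * (?n + 1)\<^sup>2 + 1) * Suc (?n + ?n)"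
      using len by (rule mult_right_mono) simp
    then have lout: "length (?out cs F) \<le> ?n + (20 * (?n + 1)\<^sup>2 + 1) * Suc (?n + ?n)"
      by (simp add: enc_set_def length_enc_run)
    show "wp proc_tail (wp shift_out (\<lambda>s t. \<exists>x. (proc_run P (fst x) (snd x) \<and>
      length (?out (fst x) (snd x)) \<le> full_cost ?m) \<and> t \<le> full_cost ?m \<and>
      holds_list s (?out (fst x) (snd x)))) s t"
    proof (rule wp_conseq[OF wp_proc_tail[OF n o outs F]])
      fix s1 t1 assume Q1: "t1 \<le> t + (?n + 3) * 1500 \<and> output_at (?out cs F) s1"
      show "wp shift_out (\<lambda>s t. \<exists>x. (proc_run P (fst x) (snd x) \<and>
        length (?out (fst x) (snd x)) \<le> full_cost ?m) \<and> t \<le> full_cost ?m \<and>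
        holds_list s (?out (fst x) (snd x))) s1 t1"
      proof (rule wp_conseq[OF wp_shift_out[OF conjunct2[OF Q1]]])
        fix s2 t2 assume Q2: "t2 \<le> t1 + (length (?out cs F) + 1) * 200 + 100 \<and> holds_list s2 (?out cs F)"
        have "(length (?out cs F) + 1) * 200 \<le> (?n + (20 * (?n + 1)\<^sup>2 + 1) * Suc (?n + ?n) + 1) * 200"
          using lout by (intro mult_right_mono) auto
        then have "t2 \<le> full_cost ?m"
          using conjunct1[OF Q2] conjunct1[OF Q1] t core_cost_le(1)[OF nm] by linarith
        moreover have "length (?out cs F) \<le> full_cost ?m"
          using lout core_cost_le(2)[OF nm] by (rule order_trans)
        ultimately show "\<exists>x. (proc_run P (fst x) (snd x) \<and>
          length (?out (fst x) (snd x)) \<le> full_cost ?m) \<and> t2 \<le> full_cost ?m \<and>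
          holds_list s2 (?out (fst x) (snd x))"
          using run Q2 by (intro exI[of _ "(cs, F)"]) simp
      qed
    qed
  qed
  from wp_exE[OF this] obtain x where
    x: "wp proc_com (\<lambda>s t. (proc_run P (fst x) (snd x) \<and> length (?out (fst x) (snd x)) \<le> full_cost ?m) \<and>
      t \<le> full_cost ?m \<and> holds_list s (?out (fst x) (snd x))) (load (enc_pps P)) 0" by blast
  have b: "bits (load (enc_pps P) a) \<le> ?m" for a
    unfolding pps_size_def by (rule bits_load_le) (simp add: enc_pps_def)
  note x' = wp_conj_const[OF x]
  have "computes_within proc_com (enc_pps P) (?out (fst x) (snd x)) (time_bound ?m)"
    unfolding time_bound_def
    by (rule computes_withinI[OF conjunct2[OF x'] b conjunct2[OF conjunct1[OF x']]])
  then show ?thesis using x' by blast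
qed

lemma policy_com_computes:
  assumes P: "max_min_pps P" and lt1: "\<forall>i\<in>vars P. pps_gfp P i < 1"
  shows "\<exists>\<sigma>. max_policy P \<sigma> \<and> computes_within policy_com (enc_pps P)
      (enc_policy (length P) \<sigma>) (time_bound (pps_size P)) \<and>
    (\<forall>i\<in>vars P. pps_gfp P i > 0 \<longrightarrow> pps_gfp (apply_policy P \<sigma>) i > 0)"
proof -
  let ?n = "length P" and ?m = "pps_size P"
  let ?good = "\<lambda>\<sigma>. max_policy P \<sigma> \<and>
    (\<forall>i\<in>vars P. pps_gfp P i > 0 \<longrightarrow> pps_gfp (apply_policy P \<sigma>) i > 0)"
  have nm: "?n \<le> ?m" by (rule length_le_pps_size)
  have len: "length (enc_policy ?n \<sigma>) = ?n" for \<sigma> by (simp add: enc_policy_def)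
  have "wp policy_com (\<lambda>s t. \<exists>\<sigma>. ?good \<sigma> \<and>
      t \<le> full_cost ?m \<and> holds_list s (enc_policy ?n \<sigma>)) (load (enc_pps P)) 0"
    unfolding policy_com_def
  proof (rule wp_shift_core[OF P], rule wp_Seq)
    fix s t assume t: "t \<le> (?m + 1) * 200 + core_cost ?n ?m" and "core_result P s"
    then obtain S F where n: "get 0 s 11 = ?n" and c: "conf P s (Halted, S, F)"
      and inv: "proc_inv P (Halted, S, F)"
      unfolding core_result_def by blast
    have mp: "max_policy P (get 8 s)" and pp: "policy_positive P S (get 8 s)"
      using c by (simp_all add: conf_def)
    have good: "?good (get 8 s)"
      using mp halted_output(2,3)[OF P lt1 inv mp pp] by blast
    show "wp policy_tail (wp shift_out (\<lambda>s t. \<exists>\<sigma>. ?good \<sigma> \<and>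
      t \<le> full_cost ?m \<and> holds_list s (enc_policy ?n \<sigma>))) s t"
    proof (rule wp_conseq[OF wp_policy_tail[OF n]])
      fix s1 t1 assume Q1: "t1 \<le> t + (?n + 3) * 1500 \<and> output_at (enc_policy ?n (get 8 s)) s1"
      show "wp shift_out (\<lambda>s t. \<exists>\<sigma>. ?good \<sigma> \<and>
        t \<le> full_cost ?m \<and> holds_list s (enc_policy ?n \<sigma>)) s1 t1"
      proof (rule wp_conseq[OF wp_shift_out[OF conjunct2[OF Q1]]])
        fix s2 t2 assume Q2: "t2 \<le> t1 + (length (enc_policy ?n (get 8 s)) + 1) * 200 + 100 \<and>
          holds_list s2 (enc_policy ?n (get 8 s))"
        have "(length (enc_policy ?n (get 8 s)) + 1) * 200
          \<le> (?n + (20 * (?n + 1)\<^sup>2 + 1) * Suc (?n + ?n) + 1) * 200"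
          unfolding len by (intro mult_right_mono) auto
        then have "t2 \<le> full_cost ?m"
          using conjunct1[OF Q2] conjunct1[OF Q1] t core_cost_le(1)[OF nm] by linarith
        then show "\<exists>\<sigma>. ?good \<sigma> \<and> t2 \<le> full_cost ?m \<and> holds_list s2 (enc_policy ?n \<sigma>)"
          using good Q2 by blast
      qed
    qed
  qed
  from wp_exE[OF this] obtain \<sigma> where
    \<sigma>: "wp policy_com (\<lambda>s t. ?good \<sigma> \<and> t \<le> full_cost ?m \<and> holds_list s (enc_policy ?n \<sigma>))
      (load (enc_pps P)) 0" by blast
  have b: "bits (load (enc_pps P) a) \<le> ?m" for a
    unfolding pps_size_def by (rule bits_load_le) (simp add: enc_pps_def)
  note \<sigma>' = wp_conj_const[OF \<sigma>]
  have "?n \<le> full_cost ?m" using core_cost_le(2)[OF nm] by linarith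
  then have "length (enc_policy ?n \<sigma>) \<le> full_cost ?m" by (simp only: len)
  then have "computes_within policy_com (enc_pps P) (enc_policy ?n \<sigma>) (time_bound ?m)"
    unfolding time_bound_def by (rule computes_withinI[OF conjunct2[OF \<sigma>'] b])
  then show ?thesis using \<sigma>' by blast
qed

definition full_cost_poly :: "nat poly" where
  "full_cost_poly = [:1000000:] * [:4, 1:] ^ 4"

definition time_poly :: "nat poly" where
  "time_poly = [:3:] * full_cost_poly * ([:0, 1:] + full_cost_poly)"

lemma poly_time_poly: "poly time_poly m = time_bound m"
  by (simp add: time_poly_def full_cost_poly_def time_bound_def full_cost_def add.commute)

lemma proc_steps_le_time_bound:
  assumes "(proc_step P ^^ m) proc_start c"
  shows "m \<le> time_bound (pps_size P)"
proof -
  let ?s = "pps_size P"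
  have "m \<le> 20 * (length P + 1)\<^sup>2"
    using proc_steps_bound[OF assms] proc_measure_start[of P] by linarith
  also have "\<dots> \<le> (20 * (length P + 1)\<^sup>2 + 1) * Suc (length P + length P)" by simp
  also have "\<dots> \<le> full_cost ?s"
    using core_cost_le(2)[OF length_le_pps_size(1)[of P]] by linarith
  also have "\<dots> \<le> 3 * full_cost ?s * (?s + full_cost ?s)"
  proof -
    have "1 \<le> full_cost ?s" by (simp add: full_cost_def Suc_le_eq)
    then have "(3 * full_cost ?s) * 1 \<le> 3 * full_cost ?s * (?s + full_cost ?s)"
      by (intro mult_left_mono) auto
    then show ?thesis by linarith
  qed
  finally show ?thesis by (simp only: time_bound_def)
qed

theorem theorem9p2:
  "\<exists>(proc_prog :: com) (policy_prog :: com) (q :: nat poly). \<forall>P.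
     max_min_pps P \<longrightarrow> (\<forall>i\<in>vars P. pps_gfp P i < 1) \<longrightarrow>
       (\<nexists>f. f 0 = proc_start \<and> (\<forall>m. proc_step P (f m) (f (Suc m)))) \<and>
       (\<forall>c. (proc_step P)\<^sup>*\<^sup>* proc_start c \<and> (\<nexists>c'. proc_step P c c') \<longrightarrow>
          (\<exists>S. c = (Halted, S, {i \<in> vars P. pps_gfp P i = 0}))) \<and>
       (\<forall>m c. (proc_step P ^^ m) proc_start c \<longrightarrow> m \<le> poly q (pps_size P)) \<and>
       (\<exists>cs F. proc_run P cs F \<and>
          computes_within proc_prog (enc_pps P)
            (enc_set (length P) F @ enc_run (length P) cs) (poly q (pps_size P))) \<and>
       (\<exists>\<sigma>. max_policy P \<sigma> \<and>
          computes_within policy_prog (enc_pps P)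
            (enc_policy (length P) \<sigma>) (poly q (pps_size P)) \<and>
          (\<forall>i\<in>vars P. pps_gfp P i > 0 \<longrightarrow> pps_gfp (apply_policy P \<sigma>) i > 0))"
proof (rule exI[of _ proc_com], rule exI[of _ policy_com], rule exI[of _ time_poly], intro allI impI)
  fix P assume P: "max_min_pps P" and lt1: "\<forall>i\<in>vars P. pps_gfp P i < 1"
  show "(\<nexists>f. f 0 = proc_start \<and> (\<forall>m. proc_step P (f m) (f (Suc m)))) \<and>
       (\<forall>c. (proc_step P)\<^sup>*\<^sup>* proc_start c \<and> (\<nexists>c'. proc_step P c c') \<longrightarrow>
          (\<exists>S. c = (Halted, S, {i \<in> vars P. pps_gfp P i = 0}))) \<and>
       (\<forall>m c. (proc_step P ^^ m) proc_start c \<longrightarrow> m \<le> poly time_poly (pps_size P)) \<and>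
       (\<exists>cs F. proc_run P cs F \<and>
          computes_within proc_com (enc_pps P)
            (enc_set (length P) F @ enc_run (length P) cs) (poly time_poly (pps_size P))) \<and>
       (\<exists>\<sigma>. max_policy P \<sigma> \<and>
          computes_within policy_com (enc_pps P)
            (enc_policy (length P) \<sigma>) (poly time_poly (pps_size P)) \<and>
          (\<forall>i\<in>vars P. pps_gfp P i > 0 \<longrightarrow> pps_gfp (apply_policy P \<sigma>) i > 0))"
    unfolding poly_time_poly
    by (intro conjI proc_no_infinite_run allI impI proc_steps_le_time_bound
        proc_com_computes[OF P] policy_com_computes[OF P lt1])
      (elim conjE, rule proc_stuck[OF P lt1])
qed

end
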